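(* Consider the optimal reinsurance–injection problem with proportional reinsurance, with value function $V$, as defined in the context. Suppose $\delta\ge\frac{\mu^2+2r\sigma^2}{2\mu}$. Put $$\gamma=\frac{\sqrt{(\mu-\delta)^2+2r\sigma^2}+(\mu-\delta)}{\sigma^2},$$ and let $\eta$ be the unique solution on the interval $(c/\gamma,\infty)$ of the equation $$K+\frac{c}{\gamma}\ln\frac{\eta\gamma}{c}+\frac{c}{\gamma}-\eta=0 .$$ Then the value function is $$V(x)=\eta e^{-\gamma x},\qquad x\ge 0 .$$ Moreover, the following policy $\pi^*$ is optimal, i.e. $V(x)=C^{\pi^*}(x)$: the reinsurance control is $u^*_s\equiv 1$, the cash injections are the constant $$\xi_i^*\equiv\frac{1}{\gamma}\ln\frac{\eta\gamma}{c},\qquad i=1,2,\dots,$$ and the injection times $\tau_i^*$, $i=1,2,\dots$, are the successive ruin times of the surplus process under $\pi^*$.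
   Context: Constants: $\mu>0$, $\sigma>0$, $\delta>0$ (debt liability rate), $r>0$ (discount rate), $K>0$ (fixed set-up cost), $c\ge 1$ (proportional cost rate). Let $\{w_s\}_{s\ge0}$ be a standard Brownian motion adapted to a filtration $\{\mathcal F_s\}_{s\ge 0}$ on a probability space $(\Omega,\mathcal F,P)$. A control policy is a triple $\pi=\{u_s,\,s>0;\ (\tau_1,\tau_2,\dots);\ (\xi_1,\xi_2,\dots)\}$, where $u_s$ is a predictable process with values in $[0,1]$ (the fraction of each claim retained by the company), $\tau_1,\tau_2,\dots$ is an increasing sequence of stopping times with respect to $\{\mathcal F_s\}$ (times of cash injections), and each $\xi_i>0$ is an $\mathcal F_{\tau_i}$-measurable random variable (size of the $i$th injection). Proportional reinsurance: $\mu(u)=\mu u$, $\sigma(u)=\sigma u$ for $u\in[0,1]$. Given initial surplus $x\ge 0$, the surplus process under $\pi$ is $$X^\pi_t=x+\int_0^t[\mu(u_s)-\delta]\,ds+\int_0^t\sigma(u_s)\,dw_s+\sum_{\tau_i\le t}\xi_i .$$ The cost of an injection of size $\xi$ is $g(\xi)=K+c\xi$, and the cost function of $\pi$ is $$C^\pi(x)=E_x\Big[\sum_{\tau_i<\infty}e^{-r\tau_i}g(\xi_i)\Big],$$ where $E_x$ is expectation given initial surplus $x$. A policy $\pi$ is admissible if $X^\pi_t\ge 0$ almost surely for all $t$ and $C^\pi(x)<\infty$ for all $x\ge0$; $\Pi$ is the set of admissible policies. The value function is $V(x)=\inf_{\pi\in\Pi}C^\pi(x)$, $x\ge0$. A policy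 $\pi^*\in\Pi$ is optimal if $C^{\pi^*}(x)=V(x)$. Ruin times of the surplus process are the successive times at which the surplus (just before injection) hits zero; if $x=0$ the first ruin time is $0$. *)

theory Defs
  imports "HOL-Probability.Probability"
begin

section \<open>Brownian motion with respect to a filtration\<close>

text \<open>
  Filtrations are indexed by \<open>[0,\<infinity>]\<close> (type \<^typ>\<open>ennreal\<close>), so that the library notions
  \<^const>\<open>stopping_time\<close> and \<^const>\<open>filtration.pre_sigma\<close> cover stopping times with
  value \<open>\<infinity>\<close>. \<open>F \<infinity>\<close> may be any sub-sigma-algebra containing all \<open>F t\<close>.
  No completeness or right-continuity is imposed.
\<close>

definition filtered_prob_space :: "'a measure \<Rightarrow> (ennreal \<Rightarrow> 'a measure) \<Rightarrow> bool" where
  "filtered_prob_space M F \<longleftrightarrow>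
     prob_space M \<and> filtration (space M) F \<and> (\<forall>t. subalgebra M (F t))"

text \<open>
  A standard Brownian motion of the filtration: besides being adapted, its increments after time
  \<open>s\<close> are independent of \<open>F s\<close>, as is needed for stochastic integration.
\<close>

definition standard_brownian_motion ::
    "'a measure \<Rightarrow> (ennreal \<Rightarrow> 'a measure) \<Rightarrow> (real \<Rightarrow> 'a \<Rightarrow> real) \<Rightarrow> bool" where
  "standard_brownian_motion M F w \<longleftrightarrow>
     (\<forall>\<omega>\<in>space M. w 0 \<omega> = 0) \<and>
     (\<forall>\<omega>\<in>space M. continuous_on {0..} (\<lambda>t. w t \<omega>)) \<and>
     (\<forall>t\<ge>0. w t \<in> borel_measurable (F (ennreal t))) \<and>
     (\<forall>s t. 0 \<le> s \<and> s < t \<longrightarrow>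
        distributed M lborel (\<lambda>\<omega>. w t \<omega> - w s \<omega>) (\<lambda>y. ennreal (normal_density 0 (sqrt (t - s)) y)) \<and>
        prob_space.indep_set M (sets (F (ennreal s)))
          (sets (vimage_algebra (space M) (\<lambda>\<omega>. w t \<omega> - w s \<omega>) borel)))"


section \<open>Predictable processes and the stochastic integral\<close>

definition predictable_sigma :: "'a set \<Rightarrow> (ennreal \<Rightarrow> 'a measure) \<Rightarrow> (real \<times> 'a) measure" where
  "predictable_sigma \<Omega> F =
     sigma ({0<..} \<times> \<Omega>) {{a<..b} \<times> A | a b A. 0 \<le> a \<and> A \<in> sets (F (ennreal a))}"

definition predictable :: "'a set \<Rightarrow> (ennreal \<Rightarrow> 'a measure) \<Rightarrow> (real \<Rightarrow> 'a \<Rightarrow> real) \<Rightarrow> bool" where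
  "predictable \<Omega> F H \<longleftrightarrow> (\<lambda>(s, \<omega>). H s \<omega>) \<in> borel_measurable (predictable_sigma \<Omega> F)"

text \<open>
  A list of triples \<open>(a, b, h)\<close> represents the simple process
  \<open>H\<^sub>s = \<Sum> h \<cdot> 1\<^bsub>(a,b]\<^esub>(s)\<close> with bounded, \<open>F a\<close>-measurable coefficients \<open>h\<close>.
\<close>

type_synonym 'a simple_process = "(real \<times> real \<times> ('a \<Rightarrow> real)) list"

definition simple_process :: "'a set \<Rightarrow> (ennreal \<Rightarrow> 'a measure) \<Rightarrow> 'a simple_process \<Rightarrow> bool" where
  "simple_process \<Omega> F S \<longleftrightarrow>
     (\<forall>(a, b, h)\<in>set S. 0 \<le> a \<and> a \<le> b \<and> h \<in> borel_measurable (F (ennreal a)) \<and>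
        (\<exists>B. \<forall>\<omega>\<in>\<Omega>. \<bar>h \<omega>\<bar> \<le> B))"

definition simple_value :: "'a simple_process \<Rightarrow> real \<Rightarrow> 'a \<Rightarrow> real" where
  "simple_value S s \<omega> = (\<Sum>(a, b, h)\<leftarrow>S. h \<omega> * indicator {a<..b} s)"

definition simple_integral :: "(real \<Rightarrow> 'a \<Rightarrow> real) \<Rightarrow> 'a simple_process \<Rightarrow> real \<Rightarrow> 'a \<Rightarrow> real" where
  "simple_integral w S t \<omega> = (\<Sum>(a, b, h)\<leftarrow>S. h \<omega> * (w (min b t) \<omega> - w (min a t) \<omega>))"

text \<open>
  \<open>is_ito_integral M F w H I\<close>: the process \<open>I\<close> is a (continuous version of the) stochastic
  integral \<open>I\<^sub>t = \<integral>\<^sub>0\<^sup>t H\<^sub>s dw\<^sub>s\<close>, i.e. the \<open>L\<^sup>2\<close>-limit of the integrals of simple processes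
  approximating \<open>H\<close> in \<open>L\<^sup>2(ds \<otimes> P)\<close> on every bounded time interval.  By the Ito isometry \<open>I\<close>
  is determined by \<open>H\<close> up to indistinguishability.
\<close>

definition is_ito_integral ::
    "'a measure \<Rightarrow> (ennreal \<Rightarrow> 'a measure) \<Rightarrow> (real \<Rightarrow> 'a \<Rightarrow> real) \<Rightarrow>
     (real \<Rightarrow> 'a \<Rightarrow> real) \<Rightarrow> (real \<Rightarrow> 'a \<Rightarrow> real) \<Rightarrow> bool" where
  "is_ito_integral M F w H I \<longleftrightarrow>
     (\<forall>t\<ge>0. I t \<in> borel_measurable M) \<and>
     (AE \<omega> in M. continuous_on {0..} (\<lambda>t. I t \<omega>)) \<and>
     (\<exists>S :: nat \<Rightarrow> 'a simple_process.
        (\<forall>n. simple_process (space M) F (S n)) \<and>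
        (\<forall>T\<ge>0. (\<lambda>n. \<integral>\<^sup>+ \<omega>. (\<integral>\<^sup>+ s\<in>{0<..T}. ennreal ((simple_value (S n) s \<omega> - H s \<omega>)\<^sup>2) \<partial>lborel) \<partial>M)
                  \<longlonglongrightarrow> 0) \<and>
        (\<forall>t\<ge>0. (\<lambda>n. \<integral>\<^sup>+ \<omega>. ennreal ((simple_integral w (S n) t \<omega> - I t \<omega>)\<^sup>2) \<partial>M) \<longlonglongrightarrow> 0))"


section \<open>Controls, surplus and cost\<close>

text \<open>
  Injections are numbered from \<open>0\<close>; the value \<open>\<infinity>\<close> of an injection time means that the injection
  does not take place.
\<close>

record 'a control =
  retention :: "real \<Rightarrow> 'a \<Rightarrow> real"
  inj_time :: "nat \<Rightarrow> 'a \<Rightarrow> ennreal"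
  inj_size :: "nat \<Rightarrow> 'a \<Rightarrow> real"

definition is_control :: "'a measure \<Rightarrow> (ennreal \<Rightarrow> 'a measure) \<Rightarrow> 'a control \<Rightarrow> bool" where
  "is_control M F p \<longleftrightarrow>
     predictable (space M) F (retention p) \<and>
     (\<forall>s>0. \<forall>\<omega>\<in>space M. retention p s \<omega> \<in> {0..1}) \<and>
     (\<forall>i. stopping_time F (inj_time p i)) \<and>
     (\<forall>i. \<forall>\<omega>\<in>space M. inj_time p i \<omega> \<le> inj_time p (Suc i) \<omega>) \<and>
     (\<forall>i. inj_size p i \<in> borel_measurable (filtration.pre_sigma (space M) F (inj_time p i))) \<and>
     (\<forall>i. \<forall>\<omega>\<in>space M. inj_size p i \<omega> > 0)"

text \<open>
  Proportional reinsurance: \<open>\<mu>(u) = \<mu>u\<close>, \<open>\<sigma>(u) = \<sigma>u\<close>. Here \<open>x\<close> is the initial surplus and \<open>I\<close> a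
  version of \<open>\<integral> \<sigma>(u\<^sub>s) dw\<^sub>s\<close>. The surplus is extended-real valued only because infinitely many
  injections might accumulate in finite time (which the finite cost of an admissible policy
  excludes almost surely).
\<close>

definition uninjected_surplus ::
    "real \<Rightarrow> real \<Rightarrow> real \<Rightarrow> 'a control \<Rightarrow> (real \<Rightarrow> 'a \<Rightarrow> real) \<Rightarrow> real \<Rightarrow> 'a \<Rightarrow> real" where
  "uninjected_surplus \<mu> \<delta> x p I t \<omega> = x + (LINT s:{0<..t}|lborel. \<mu> * retention p s \<omega> - \<delta>) + I t \<omega>"

definition surplus ::
    "real \<Rightarrow> real \<Rightarrow> real \<Rightarrow> 'a control \<Rightarrow> (real \<Rightarrow> 'a \<Rightarrow> real) \<Rightarrow> real \<Rightarrow> 'a \<Rightarrow> ereal" where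
  "surplus \<mu> \<delta> x p I t \<omega> =
     ereal (uninjected_surplus \<mu> \<delta> x p I t \<omega>) +
     enn2ereal (\<Sum>i. if inj_time p i \<omega> \<le> ennreal t then ennreal (inj_size p i \<omega>) else 0)"

text \<open>The left limit \<open>X\<^bsub>t-\<^esub>\<close>, i.e. the surplus just before any injection at time \<open>t\<close>
  (with \<open>X\<^bsub>0-\<^esub> = x\<close>).\<close>

definition surplus_before ::
    "real \<Rightarrow> real \<Rightarrow> real \<Rightarrow> 'a control \<Rightarrow> (real \<Rightarrow> 'a \<Rightarrow> real) \<Rightarrow> real \<Rightarrow> 'a \<Rightarrow> ereal" where
  "surplus_before \<mu> \<delta> x p I t \<omega> =
     ereal (uninjected_surplus \<mu> \<delta> x p I t \<omega>) +
     enn2ereal (\<Sum>i. if inj_time p i \<omega> < ennreal t then ennreal (inj_size p i \<omega>) else 0)"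

abbreviation noise_integral ::
    "'a measure \<Rightarrow> (ennreal \<Rightarrow> 'a measure) \<Rightarrow> (real \<Rightarrow> 'a \<Rightarrow> real) \<Rightarrow> real \<Rightarrow> 'a control \<Rightarrow>
     (real \<Rightarrow> 'a \<Rightarrow> real) \<Rightarrow> bool" where
  "noise_integral M F w \<sigma> p I \<equiv> is_ito_integral M F w (\<lambda>s \<omega>. \<sigma> * retention p s \<omega>) I"

definition control_cost :: "'a measure \<Rightarrow> real \<Rightarrow> real \<Rightarrow> real \<Rightarrow> 'a control \<Rightarrow> ennreal" where
  "control_cost M r K c p =
     (\<integral>\<^sup>+ \<omega>. (\<Sum>i. if inj_time p i \<omega> < \<infinity>
                  then ennreal (exp (- r * enn2real (inj_time p i \<omega>)) * (K + c * inj_size p i \<omega>))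
                  else 0) \<partial>M)"


section \<open>Policies and the value function\<close>

text \<open>
  A policy reacts to the initial surplus \<open>x\<close> (an injection rule such as ``inject at ruin'' yields
  different stopping times for different \<open>x\<close>); hence it assigns a control to every \<open>x \<ge> 0\<close>.
\<close>

type_synonym 'a policy = "real \<Rightarrow> 'a control"

definition cost :: "'a measure \<Rightarrow> real \<Rightarrow> real \<Rightarrow> real \<Rightarrow> 'a policy \<Rightarrow> real \<Rightarrow> ennreal" where
  "cost M r K c \<pi> x = control_cost M r K c (\<pi> x)"

definition admissible ::
    "'a measure \<Rightarrow> (ennreal \<Rightarrow> 'a measure) \<Rightarrow> (real \<Rightarrow> 'a \<Rightarrow> real) \<Rightarrow>
     real \<Rightarrow> real \<Rightarrow> real \<Rightarrow> real \<Rightarrow> real \<Rightarrow> real \<Rightarrow> 'a policy set" where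
  "admissible M F w \<mu> \<sigma> \<delta> r K c =
     {\<pi>. \<forall>x\<ge>0. is_control M F (\<pi> x) \<and>
        (\<exists>I. noise_integral M F w \<sigma> (\<pi> x) I \<and>
             (AE \<omega> in M. \<forall>t\<ge>0. surplus \<mu> \<delta> x (\<pi> x) I t \<omega> \<ge> 0)) \<and>
        cost M r K c \<pi> x < \<infinity>}"

definition value_function ::
    "'a measure \<Rightarrow> (ennreal \<Rightarrow> 'a measure) \<Rightarrow> (real \<Rightarrow> 'a \<Rightarrow> real) \<Rightarrow>
     real \<Rightarrow> real \<Rightarrow> real \<Rightarrow> real \<Rightarrow> real \<Rightarrow> real \<Rightarrow> real \<Rightarrow> ennreal" where
  "value_function M F w \<mu> \<sigma> \<delta> r K c x =
     (INF \<pi>\<in>admissible M F w \<mu> \<sigma> \<delta> r K c. cost M r K c \<pi> x)"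

definition optimal ::
    "'a measure \<Rightarrow> (ennreal \<Rightarrow> 'a measure) \<Rightarrow> (real \<Rightarrow> 'a \<Rightarrow> real) \<Rightarrow>
     real \<Rightarrow> real \<Rightarrow> real \<Rightarrow> real \<Rightarrow> real \<Rightarrow> real \<Rightarrow> 'a policy \<Rightarrow> bool" where
  "optimal M F w \<mu> \<sigma> \<delta> r K c \<pi> \<longleftrightarrow>
     \<pi> \<in> admissible M F w \<mu> \<sigma> \<delta> r K c \<and>
     (\<forall>x\<ge>0. cost M r K c \<pi> x = value_function M F w \<mu> \<sigma> \<delta> r K c x)"

text \<open>
  The injection times of \<open>p\<close> are (almost surely) the successive ruin times of the surplus process
  controlled by \<open>p\<close> itself: the first one is the first \<open>t \<ge> 0\<close> with \<open>X\<^bsub>t-\<^esub> = 0\<close> (hence \<open>0\<close> if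
  \<open>x = 0\<close>), each further one is the first later \<open>t\<close> with \<open>X\<^bsub>t-\<^esub> = 0\<close>; the infimum of the empty
  set is \<open>\<infinity>\<close>.
\<close>

definition injects_at_ruin ::
    "'a measure \<Rightarrow> (ennreal \<Rightarrow> 'a measure) \<Rightarrow> (real \<Rightarrow> 'a \<Rightarrow> real) \<Rightarrow>
     real \<Rightarrow> real \<Rightarrow> real \<Rightarrow> real \<Rightarrow> 'a control \<Rightarrow> bool" where
  "injects_at_ruin M F w \<mu> \<sigma> \<delta> x p \<longleftrightarrow>
     (\<exists>I. noise_integral M F w \<sigma> p I \<and>
        (AE \<omega> in M.
           inj_time p 0 \<omega> = Inf {ennreal t | t. 0 \<le> t \<and> surplus_before \<mu> \<delta> x p I t \<omega> = 0} \<and>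
           (\<forall>i. inj_time p (Suc i) \<omega> =
              Inf {ennreal t | t. 0 \<le> t \<and> inj_time p i \<omega> < ennreal t \<and>
                                  surplus_before \<mu> \<delta> x p I t \<omega> = 0})))"

definition full_retention_ruin_policy ::
    "'a measure \<Rightarrow> (ennreal \<Rightarrow> 'a measure) \<Rightarrow> (real \<Rightarrow> 'a \<Rightarrow> real) \<Rightarrow>
     real \<Rightarrow> real \<Rightarrow> real \<Rightarrow> real \<Rightarrow> 'a policy \<Rightarrow> bool" where
  "full_retention_ruin_policy M F w \<mu> \<sigma> \<delta> \<xi> \<pi> \<longleftrightarrow>
     (\<forall>x\<ge>0. is_control M F (\<pi> x) \<and>
        retention (\<pi> x) = (\<lambda>s \<omega>. 1) \<and>
        inj_size (\<pi> x) = (\<lambda>i \<omega>. \<xi>) \<and>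
        injects_at_ruin M F w \<mu> \<sigma> \<delta> x (\<pi> x))"

end

theory Submission
  imports Defs
begin

text \<open>
  Let \<open>U\<close> be the surplus without injections and \<open>I\<^sub>t = \<integral>\<^sub>0\<^sup>t \<sigma> u\<^sub>s dw\<^sub>s\<close>. Since \<open>V\<close> is a multiple of
  \<open>exp (- \<gamma> x)\<close>, no Ito formula is needed: explicitly \<open>exp (- r t - \<gamma> U\<^sub>t) = exp (- \<gamma> x) Z\<^sub>t A\<^sub>t\<close> with
  the exponential martingale \<open>Z\<^sub>t = exp (- \<gamma> I\<^sub>t - \<gamma>\<^sup>2/2 \<integral>\<^sub>0\<^sup>t \<sigma>\<^sup>2 u\<^sub>s\<^sup>2 ds)\<close> and a factor \<open>A\<^sub>t \<ge> 1\<close>. The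
  condition on \<open>\<delta>\<close> says \<open>\<sigma>\<^sup>2 \<gamma> \<le> \<mu>\<close>, which makes the exponent of \<open>A\<close> nonnegative, and zero for
  \<open>u = 1\<close>.

  Let \<open>S\<^sub>i\<close> be the sum of the first \<open>i\<close> injections. By the choice of \<open>\<eta>\<close>, the \<open>i\<close>-th injection costs at
  least the decrease of \<open>V\<close> that it causes, whose discounted value is at least
  \<open>\<eta> exp (- \<gamma> x) Z\<^sub>\<tau> D\<^sub>i\<close>, where \<open>\<tau>\<close> is the time of the injection and
  \<open>D\<^sub>i = exp (- \<gamma> S\<^sub>i) - exp (- \<gamma> S\<^sub>i\<^sub>+\<^sub>1)\<close>. Optional stopping replaces \<open>Z\<^sub>\<tau>\<close> by \<open>Z\<^sub>T\<close> for the injections up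
  to time \<open>T\<close>. The sum of the \<open>D\<^sub>i\<close> telescopes, and as the surplus at time \<open>T\<close> is nonnegative, the
  remainder is at most \<open>\<eta> exp (- r T)\<close>.

  For \<open>u = 1\<close> and injections of size \<open>\<xi>\<close> at ruin, the \<open>n\<close>-th ruin time (counted from \<open>0\<close>) is the first
  time at which \<open>U\<close> equals \<open>- n \<xi>\<close>. Its discount factor has expectation at most
  \<open>exp (- \<gamma> (x + n \<xi>))\<close>, again by optional stopping, and summing the geometric series gives the
  matching upper bound.
\<close>

section \<open>Integration lemmas and increments of the Brownian motion\<close>

text \<open>The stochastic integral is known only through L2-convergence at fixed times, and
  \<open>I\<close> is not assumed adapted. The martingale property of \<open>Z\<close> is therefore
  expressed by test variables: \<open>Z\<^sub>t * Y\<close> and \<open>Z\<^sub>s * Y\<close> have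
  the same integral for every \<open>F s\<close>-measurable \<open>Y\<close> with values in [0, 1].
  For step integrands this follows from one normal increment at a time. The obstacle is the limit:
  the approximating simple processes need not be uniformly bounded, so their exponentials could fail
  to be uniformly integrable. Clipping them to the range [0, b] of the true integrand preserves the
  convergence and bounds the second moments uniformly. Such a bound also carries optional stopping
  from grid times to continuous time. The constants come from a tangency. The decrease
  \<open>\<eta> * (1 - exp (- \<gamma> * y))\<close> of the value under an injection of size
  \<open>y\<close> at surplus 0 is concave in \<open>y\<close>, and the equation for
  \<open>\<eta>\<close> says that the cost line \<open>K + c * y\<close> touches it, namely at
  \<open>y = \<xi>\<close>. Hence no injection costs less than the decrease, and an injection of
  size \<open>\<xi>\<close> at surplus 0 costs exactly that.\<close>

lemma nn_integral_normal_exp: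
  assumes v: "v > 0"
  shows "(\<integral>\<^sup>+ y. ennreal (exp (a * y - a\<^sup>2 * v / 2)) * ennreal (normal_density 0 (sqrt v) y) \<partial>lborel) = 1"
proof -
  have "exp (a * y - a\<^sup>2 * v / 2) * normal_density 0 (sqrt v) y = normal_density (a * v) (sqrt v) y" for y
  proof -
    have "a * y - a\<^sup>2 * v / 2 + - y\<^sup>2 / (2 * v) = - (y - a * v)\<^sup>2 / (2 * v)"
      using v by (simp add: field_simps power2_eq_square)
    then show ?thesis
      using v by (simp add: normal_density_def mult.commute mult.left_commute flip: exp_add)
  qed
  then have "(\<integral>\<^sup>+ y. ennreal (exp (a * y - a\<^sup>2 * v / 2)) * ennreal (normal_density 0 (sqrt v) y) \<partial>lborel)
      = (\<integral>\<^sup>+ y. ennreal (normal_density (a * v) (sqrt v) y) \<partial>lborel)"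
    by (simp flip: ennreal_mult)
  also have "\<dots> = 1"
    using v by (subst nn_integral_eq_integral) auto
  finally show ?thesis .
qed

lemma nn_integral_normal_square:
  assumes v: "v > 0"
  shows "(\<integral>\<^sup>+ y. ennreal ((i + g * y)\<^sup>2) * ennreal (normal_density 0 (sqrt v) y) \<partial>lborel)
    = ennreal (i\<^sup>2 + g\<^sup>2 * v)"
proof -
  let ?n = "normal_density 0 (sqrt v)"
  have s: "0 < sqrt v" using v by simp
  have 2: "has_bochner_integral lborel (\<lambda>y. ?n y * y\<^sup>2) v"
    using normal_moment_even[OF s, of 0 1] v by (simp add: fact_numeral)
  have 0: "has_bochner_integral lborel ?n 1"
    using v by (simp add: has_bochner_integral_iff)
  have 1: "has_bochner_integral lborel (\<lambda>y. ?n y * y) 0"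
    by (rule normal_moment_nz_1[OF s])
  have "has_bochner_integral lborel (\<lambda>y. ?n y * i\<^sup>2 + (?n y * y) * (2 * i * g) + (?n y * y\<^sup>2) * g\<^sup>2)
      (1 * i\<^sup>2 + 0 * (2 * i * g) + v * g\<^sup>2)"
    by (intro has_bochner_integral_add has_bochner_integral_mult_left 0 1 2)
  then have "has_bochner_integral lborel (\<lambda>y. (i + g * y)\<^sup>2 * ?n y) (i\<^sup>2 + g\<^sup>2 * v)"
    by (simp add: power2_eq_square algebra_simps)
  then show ?thesis
    by (simp add: has_bochner_integral_iff nn_integral_eq_integral flip: ennreal_mult)
qed

text \<open>Along a subsequence whose integrals are below \<open>(1/2) ^ n\<close>, the sum of the
  terms has a finite integral. It is then finite almost everywhere, so its terms tend to 0.\<close>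

lemma AE_subseq_of_nn_integral_tendsto_0:
  assumes [measurable]: "\<And>n. X n \<in> borel_measurable M"
    and lim: "(\<lambda>n. \<integral>\<^sup>+ \<omega>. X n \<omega> \<partial>M) \<longlonglongrightarrow> 0"
  shows "\<exists>r. strict_mono (r :: nat \<Rightarrow> nat) \<and> (AE \<omega> in M. (\<lambda>n. X (r n) \<omega>) \<longlonglongrightarrow> (0 :: ennreal))"
proof -
  have ev: "\<forall>n. eventually (\<lambda>m. (\<integral>\<^sup>+ \<omega>. X m \<omega> \<partial>M) < ennreal ((1/2) ^ n)) sequentially"
    using lim by (auto intro!: order_tendstoD(2))
  obtain r :: "nat \<Rightarrow> nat" where r: "strict_mono r" "\<And>n. (\<integral>\<^sup>+ \<omega>. X (r n) \<omega> \<partial>M) < ennreal ((1/2) ^ n)"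
  proof -
    have "\<exists>r. \<forall>n. (\<integral>\<^sup>+ \<omega>. X (r n) \<omega> \<partial>M) < ennreal ((1/2) ^ n) \<and> r n < (r (Suc n) :: nat)"
    proof (rule dependent_nat_choice)
      show "\<exists>m. (\<integral>\<^sup>+ \<omega>. X m \<omega> \<partial>M) < ennreal ((1/2) ^ 0)"
        using ev[rule_format, of 0] eventually_happens[of _ sequentially] by auto
      fix m n
      show "\<exists>k. (\<integral>\<^sup>+ \<omega>. X k \<omega> \<partial>M) < ennreal ((1/2) ^ Suc n) \<and> (m :: nat) < k"
        using eventually_happens[OF eventually_conj[OF ev[rule_format, of "Suc n"] eventually_gt_at_top[of m]]]
        by auto
    qed
    then show ?thesis using that by (auto simp: strict_mono_Suc_iff)
  qed
  have "(\<integral>\<^sup>+ \<omega>. (\<Sum>n. X (r n) \<omega>) \<partial>M) = (\<Sum>n. \<integral>\<^sup>+ \<omega>. X (r n) \<omega> \<partial>M)"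
    by (rule nn_integral_suminf) auto
  also have "\<dots> \<le> (\<Sum>n. ennreal ((1/2) ^ n))"
    by (intro suminf_le less_imp_le[OF r(2)]) auto
  also have "\<dots> < \<infinity>"
    by (subst suminf_ennreal2) (simp_all add: summable_geometric ennreal_less_top)
  finally have "AE \<omega> in M. (\<Sum>n. X (r n) \<omega>) \<noteq> \<infinity>"
    by (intro nn_integral_PInf_AE) auto
  then have "AE \<omega> in M. (\<lambda>n. X (r n) \<omega>) \<longlonglongrightarrow> 0"
  proof eventually_elim
    case (elim \<omega>)
    have *: "X (r n) \<omega> \<noteq> \<infinity>" for n
      using elim ennreal_suminf_lessD[of "\<lambda>n. X (r n) \<omega>" \<infinity>] by (auto simp: less_top)
    define a where "a n = enn2real (X (r n) \<omega>)" for n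
    have a: "X (r n) \<omega> = ennreal (a n)" "0 \<le> a n" for n
      using *[of n] by (auto simp: a_def less_top)
    have "summable a"
      using elim by (intro summable_suminf_not_top a) (simp add: a)
    then have "a \<longlonglongrightarrow> 0" by (rule summable_LIMSEQ_zero)
    then show ?case
      using tendsto_ennrealI[of a 0 sequentially] by (simp add: a)
  qed
  with r(1) show ?thesis by auto
qed

lemma ennreal_le_add_inverse_imp_le:
  assumes "\<And>L. L > 0 \<Longrightarrow> a \<le> b + ennreal (C / L)"
  shows "a \<le> b"
proof -
  have "(\<lambda>n. b + ennreal (C / real (Suc n))) \<longlonglongrightarrow> b + ennreal 0"
    by (intro tendsto_add tendsto_const tendsto_ennrealI lim_const_over_n[THEN LIMSEQ_Suc])
  then show ?thesis
    by (intro LIMSEQ_le_const[of _ b a]) (auto intro!: assms exI[of _ 0])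
qed

text \<open>An \<open>L\<^sup>2\<close> bound makes the sequence uniformly integrable, so the truncation error at level \<open>L\<close>
  is at most \<open>C / L\<close>.\<close>

lemma (in finite_measure) nn_integral_tendsto_of_square_bound:
  fixes X :: "nat \<Rightarrow> 'a \<Rightarrow> real" and X' :: "'a \<Rightarrow> real"
  assumes [measurable]: "\<And>n. X n \<in> borel_measurable M" and X': "X' \<in> borel_measurable M"
    and lim: "AE \<omega> in M. (\<lambda>n. X n \<omega>) \<longlonglongrightarrow> X' \<omega>"
    and nonneg: "\<And>n \<omega>. 0 \<le> X n \<omega>"
    and C: "\<And>n. (\<integral>\<^sup>+ \<omega>. ennreal ((X n \<omega>)\<^sup>2) \<partial>M) \<le> ennreal C"
  shows "(\<lambda>n. \<integral>\<^sup>+ \<omega>. ennreal (X n \<omega>) \<partial>M) \<longlonglongrightarrow> (\<integral>\<^sup>+ \<omega>. ennreal (X' \<omega>) \<partial>M)"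
proof -
  note X'[measurable]
  define B where "B = \<bar>C\<bar>"
  have B: "0 \<le> B" "\<And>n. (\<integral>\<^sup>+ \<omega>. ennreal ((X n \<omega>)\<^sup>2) \<partial>M) \<le> ennreal B"
    using C by (auto simp: B_def intro: order_trans[OF C ennreal_leI])
  let ?I = "\<lambda>n. \<integral>\<^sup>+ \<omega>. ennreal (X n \<omega>) \<partial>M" and ?I' = "\<integral>\<^sup>+ \<omega>. ennreal (X' \<omega>) \<partial>M"
  have "AE \<omega> in M. ennreal (X' \<omega>) = liminf (\<lambda>n. ennreal (X n \<omega>))"
    using lim
    by eventually_elim (rule lim_imp_Liminf[symmetric], auto intro: tendsto_ennrealI)
  then have "?I' = (\<integral>\<^sup>+ \<omega>. liminf (\<lambda>n. ennreal (X n \<omega>)) \<partial>M)"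
    by (rule nn_integral_cong_AE)
  also have "\<dots> \<le> liminf ?I"
    by (rule nn_integral_liminf) simp
  finally have lower: "?I' \<le> liminf ?I" .
  have upper: "limsup ?I \<le> ?I' + ennreal (B / L)" if L: "L > 0" for L
  proof -
    have "X n \<omega> \<le> min (X n \<omega>) L + (X n \<omega>)\<^sup>2 / L" for n \<omega>
    proof (cases "X n \<omega> \<le> L")
      case False
      then have "X n \<omega> * L \<le> X n \<omega> * X n \<omega>"
        using nonneg[of n \<omega>] by (intro mult_left_mono) auto
      then show ?thesis using L False by (simp add: field_simps power2_eq_square min_def add_increasing)
    qed (use L in auto)
    then have "?I n \<le> (\<integral>\<^sup>+ \<omega>. ennreal (min (X n \<omega>) L) + ennreal (1/L) * ennreal ((X n \<omega>)\<^sup>2) \<partial>M)" for n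
      using L nonneg
      by (intro nn_integral_mono) (auto simp flip: ennreal_plus ennreal_mult intro!: ennreal_leI)
    also have "\<dots> n = (\<integral>\<^sup>+ \<omega>. ennreal (min (X n \<omega>) L) \<partial>M) + ennreal (1/L) * (\<integral>\<^sup>+ \<omega>. ennreal ((X n \<omega>)\<^sup>2) \<partial>M)" for n
      by (simp add: nn_integral_add nn_integral_cmult)
    also have "\<dots> n \<le> (\<integral>\<^sup>+ \<omega>. ennreal (min (X n \<omega>) L) \<partial>M) + ennreal (B/L)" for n
      using mult_left_mono[OF B(2), of "ennreal (1/L)" n] L B(1)
      by (intro add_left_mono) (simp flip: ennreal_mult)
    finally have *: "?I n \<le> (\<integral>\<^sup>+ \<omega>. ennreal (min (X n \<omega>) L) \<partial>M) + ennreal (B/L)" for n .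
    have "(\<lambda>n. \<integral>\<^sup>+ \<omega>. ennreal (min (X n \<omega>) L) \<partial>M) \<longlonglongrightarrow> (\<integral>\<^sup>+ \<omega>. ennreal (min (X' \<omega>) L) \<partial>M)"
    proof (rule nn_integral_dominated_convergence[where w="\<lambda>_. ennreal L"])
      show "(\<integral>\<^sup>+ x. ennreal L \<partial>M) < \<infinity>"
        using L by (simp add: ennreal_mult_less_top emeasure_finite less_top[symmetric] ennreal_mult_eq_top_iff)
      show "AE \<omega> in M. (\<lambda>n. ennreal (min (X n \<omega>) L)) \<longlonglongrightarrow> ennreal (min (X' \<omega>) L)"
        using lim by eventually_elim (intro tendsto_ennrealI tendsto_min tendsto_const)
    qed (auto intro!: ennreal_leI)
    then have "(\<lambda>n. (\<integral>\<^sup>+ \<omega>. ennreal (min (X n \<omega>) L) \<partial>M) + ennreal (B/L)) \<longlonglongrightarrow> (\<integral>\<^sup>+ \<omega>. ennreal (min (X' \<omega>) L) \<partial>M) + ennreal (B/L)"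
      by (intro tendsto_add tendsto_const)
    then have "limsup (\<lambda>n. (\<integral>\<^sup>+ \<omega>. ennreal (min (X n \<omega>) L) \<partial>M) + ennreal (B/L)) = (\<integral>\<^sup>+ \<omega>. ennreal (min (X' \<omega>) L) \<partial>M) + ennreal (B/L)"
      by (intro lim_imp_Limsup) auto
    moreover have "limsup ?I \<le> limsup (\<lambda>n. (\<integral>\<^sup>+ \<omega>. ennreal (min (X n \<omega>) L) \<partial>M) + ennreal (B/L))"
      by (intro Limsup_mono always_eventually allI *)
    ultimately have "limsup ?I \<le> (\<integral>\<^sup>+ \<omega>. ennreal (min (X' \<omega>) L) \<partial>M) + ennreal (B/L)"
      by simp
    also have "\<dots> \<le> ?I' + ennreal (B/L)"
      by (intro add_right_mono nn_integral_mono ennreal_leI) auto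
    finally show ?thesis .
  qed
  then have "limsup ?I \<le> ?I'" by (rule ennreal_le_add_inverse_imp_le)
  moreover have "liminf ?I \<le> limsup ?I" by (rule Liminf_le_Limsup) simp
  ultimately show ?thesis
    using lower by (subst tendsto_iff_Liminf_eq_Limsup) auto
qed

section \<open>The filtered space and the independence of increments\<close>

locale brownian_filtration =
  fixes M :: "'a measure" and F :: "ennreal \<Rightarrow> 'a measure" and w :: "real \<Rightarrow> 'a \<Rightarrow> real"
  assumes filtered: "filtered_prob_space M F"
    and brownian: "standard_brownian_motion M F w"
begin

sublocale prob_space M
  using filtered by (simp add: filtered_prob_space_def)

sublocale filtration "space M" F
  using filtered by (simp add: filtered_prob_space_def)

lemma measurable_F_M: "f \<in> measurable (F t) N \<Longrightarrow> f \<in> measurable M N"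
  using filtered by (auto simp: filtered_prob_space_def intro: measurable_from_subalg)

lemma measurable_F_mono: "f \<in> measurable (F s) N \<Longrightarrow> s \<le> t \<Longrightarrow> f \<in> measurable (F t) N"
  using sets_F_mono[of s t] by (auto simp: measurable_def space_F)

lemma w_0: "\<omega> \<in> space M \<Longrightarrow> w 0 \<omega> = 0"
  using brownian by (simp add: standard_brownian_motion_def)

lemma w_continuous: "\<omega> \<in> space M \<Longrightarrow> continuous_on {0..} (\<lambda>t. w t \<omega>)"
  using brownian by (simp add: standard_brownian_motion_def)

lemma w_measurable_F: "0 \<le> s \<Longrightarrow> s \<le> t \<Longrightarrow> w s \<in> borel_measurable (F (ennreal t))"
  using brownian unfolding standard_brownian_motion_def
  by (auto intro: measurable_F_mono[of _ "ennreal s"] ennreal_leI)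

lemma w_measurable: "0 \<le> s \<Longrightarrow> w s \<in> borel_measurable M"
  using w_measurable_F[of s s] by (auto intro: measurable_F_M)

text \<open>Integrating out the increment first, with the past \<open>\<omega>\<close> frozen.\<close>

lemma nn_integral_increment:
  assumes st: "0 \<le> s" "s < t"
    and f: "f \<in> borel_measurable (F (ennreal s) \<Otimes>\<^sub>M borel)"
  shows "(\<integral>\<^sup>+ \<omega>. f (\<omega>, w t \<omega> - w s \<omega>) \<partial>M)
    = (\<integral>\<^sup>+ \<omega>. (\<integral>\<^sup>+ y. f (\<omega>, y) * ennreal (normal_density 0 (sqrt (t - s)) y) \<partial>lborel) \<partial>M)"
proof -
  define D where "D = (\<lambda>\<omega>. w t \<omega> - w s \<omega>)"
  let ?n = "\<lambda>y. ennreal (normal_density 0 (sqrt (t - s)) y)"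
  have d: "distributed M lborel D ?n" and
    i: "indep_set (sets (F (ennreal s))) (sets (vimage_algebra (space M) D borel))"
    using brownian st unfolding standard_brownian_motion_def D_def by auto
  have [measurable]: "D \<in> borel_measurable M"
    using st by (auto simp: D_def intro!: borel_measurable_diff w_measurable)
  have id: "(\<lambda>\<omega>. \<omega>) \<in> measurable M (F (ennreal s))"
    by (rule measurable_F_M[where t="ennreal s"]) simp
  interpret S: prob_space "distr M (F (ennreal s)) (\<lambda>\<omega>. \<omega>)"
    by (rule prob_space_distr[OF id])
  interpret D: prob_space "distr M borel D"
    by (rule prob_space_distr) simp
  \<comment> \<open>Independence as a product law: the identity from \<open>M\<close> to
    \<open>F s\<close> is the random variable that carries the whole past, and rectangles determine
    the joint law.\<close>
  have eq: "distr M (F (ennreal s)) (\<lambda>\<omega>. \<omega>) \<Otimes>\<^sub>M distr M borel D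
      = distr M (F (ennreal s) \<Otimes>\<^sub>M borel) (\<lambda>\<omega>. (\<omega>, D \<omega>))"
  proof (rule pair_measure_eqI)
    fix A B assume "A \<in> sets (distr M (F (ennreal s)) (\<lambda>\<omega>. \<omega>))" "B \<in> sets (distr M borel D)"
    then have [measurable]: "A \<in> sets (F (ennreal s))" "B \<in> sets borel" by auto
    have A: "A \<in> events"
      using measurable_sets[OF id, of A] sets.sets_into_space[of A "F (ennreal s)"]
      by (simp add: space_F Int_absorb2)
    have "D -` B \<inter> space M \<in> sets (vimage_algebra (space M) D borel)"
      by (rule in_vimage_algebra) simp
    then have "prob (A \<inter> (D -` B \<inter> space M)) = prob A * prob (D -` B \<inter> space M)"
      by (intro indep_setD[OF i]) auto
    moreover have "(\<lambda>\<omega>. (\<omega>, D \<omega>)) -` (A \<times> B) \<inter> space M = A \<inter> (D -` B \<inter> space M)"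
      using sets.sets_into_space[OF A] by auto
    moreover have "(\<lambda>\<omega>. \<omega>) -` A \<inter> space M = A"
      using sets.sets_into_space[OF A] by auto
    ultimately show "emeasure (distr M (F (ennreal s)) (\<lambda>\<omega>. \<omega>)) A * emeasure (distr M borel D) B
        = emeasure (distr M (F (ennreal s) \<Otimes>\<^sub>M borel) (\<lambda>\<omega>. (\<omega>, D \<omega>))) (A \<times> B)"
      using id by (simp add: emeasure_distr emeasure_eq_measure flip: ennreal_mult)
  qed (auto intro: S.sigma_finite_measure_axioms D.sigma_finite_measure_axioms)
  have D: "distr M borel D = density lborel ?n"
    using d by (auto simp: distributed_def cong: distr_cong)
  have f': "f \<in> borel_measurable (distr M (F (ennreal s)) (\<lambda>\<omega>. \<omega>) \<Otimes>\<^sub>M distr M borel D)"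
    using f by simp
  have "(\<integral>\<^sup>+ \<omega>. f (\<omega>, D \<omega>) \<partial>M) = (\<integral>\<^sup>+ z. f z \<partial>distr M (F (ennreal s) \<Otimes>\<^sub>M borel) (\<lambda>\<omega>. (\<omega>, D \<omega>)))"
    using f id by (subst nn_integral_distr) auto
  also have "\<dots> = (\<integral>\<^sup>+ \<omega>. \<integral>\<^sup>+ y. f (\<omega>, y) \<partial>distr M borel D \<partial>distr M (F (ennreal s)) (\<lambda>\<omega>. \<omega>))"
    unfolding eq[symmetric] by (rule D.nn_integral_fst[OF f', symmetric])
  also have "\<dots> = (\<integral>\<^sup>+ \<omega>. \<integral>\<^sup>+ y. f (\<omega>, y) \<partial>distr M borel D \<partial>M)"
    using f' by (subst nn_integral_distr[OF id]) (auto intro!: D.borel_measurable_nn_integral_fst)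
  also have "\<dots> = (\<integral>\<^sup>+ \<omega>. (\<integral>\<^sup>+ y. f (\<omega>, y) * ?n y \<partial>lborel) \<partial>M)"
    unfolding D using f
    by (intro nn_integral_cong, subst nn_integral_density)
       (auto simp: mult.commute space_F[of "ennreal s", symmetric] intro!: measurable_compose[OF measurable_Pair1'])
  finally show ?thesis by (simp add: D_def)
qed

end

section \<open>Step processes\<close>

context brownian_filtration
begin

text \<open>The process stays a function of time with the grid as separate data, so that pointwise
  maps such as clipping act on it directly. The value on a grid interval is read at the right
  endpoint, since the intervals are open on the left, but has to be known at the left
  endpoint.\<close>

definition step_process :: "(nat \<Rightarrow> real) \<Rightarrow> nat \<Rightarrow> (real \<Rightarrow> 'a \<Rightarrow> real) \<Rightarrow> bool" where
  "step_process p m V \<longleftrightarrow> p 0 = 0 \<and> (\<forall>j<m. p j < p (Suc j)) \<and>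
     (\<forall>j<m. V (p (Suc j)) \<in> borel_measurable (F (ennreal (p j)))) \<and>
     (\<forall>j<m. \<forall>s\<in>{p j<..p (Suc j)}. V s = V (p (Suc j)))"

definition step_integral :: "(nat \<Rightarrow> real) \<Rightarrow> (real \<Rightarrow> 'a \<Rightarrow> real) \<Rightarrow> nat \<Rightarrow> 'a \<Rightarrow> real" where
  "step_integral p V k \<omega> = (\<Sum>j<k. V (p (Suc j)) \<omega> * (w (p (Suc j)) \<omega> - w (p j) \<omega>))"

lemma
  assumes "step_process p m V"
  shows step_process_0: "p 0 = 0"
    and step_process_less: "j < m \<Longrightarrow> p j < p (Suc j)"
    and step_process_measurable: "j < m \<Longrightarrow> V (p (Suc j)) \<in> borel_measurable (F (ennreal (p j)))"
    and step_process_const: "j < m \<Longrightarrow> p j < s \<Longrightarrow> s \<le> p (Suc j) \<Longrightarrow> V s = V (p (Suc j))"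
  using assms unfolding step_process_def by (blast, blast, blast, metis greaterThanAtMost_iff)

text \<open>Serves for the clipped process and for the part that clipping removes.\<close>

lemma step_process_comp:
  assumes V: "step_process p m V" and \<phi>: "\<phi> \<in> borel_measurable borel"
  shows "step_process p m (\<lambda>s \<omega>. \<phi> (V s \<omega>))"
  unfolding step_process_def
proof (intro conjI allI impI ballI)
  show "(\<lambda>\<omega>. \<phi> (V (p (Suc j)) \<omega>)) \<in> borel_measurable (F (ennreal (p j)))" if "j < m" for j
    using measurable_compose[OF step_process_measurable[OF V that] \<phi>] .
  show "(\<lambda>\<omega>. \<phi> (V s \<omega>)) = (\<lambda>\<omega>. \<phi> (V (p (Suc j)) \<omega>))" if "j < m" "s \<in> {p j<..p (Suc j)}" for j s
    using step_process_const[OF V that(1), of s] that by simp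
qed (use step_process_0[OF V] step_process_less[OF V] in auto)

lemma step_process_mono:
  assumes "step_process p m V" "j \<le> k" "k \<le> m"
  shows "p j \<le> p k"
  using assms(2,3)
proof (induction k rule: dec_induct)
  case (step n)
  then show ?case using step_process_less[OF assms(1), of n] by simp
qed simp

lemma step_process_nonneg:
  assumes "step_process p m V" "k \<le> m"
  shows "0 \<le> p k"
  using step_process_mono[OF assms(1), of 0 k] assms by (simp add: step_process_0)

lemma step_value_measurable:
  assumes "step_process p m V" "j < k" "k \<le> m"
  shows "V (p (Suc j)) \<in> borel_measurable (F (ennreal (p k)))"
  using assms step_process_mono[OF assms(1), of j k] step_process_measurable[OF assms(1), of j]
  by (auto simp: ennreal_leI intro: measurable_F_mono[of _ "ennreal (p j)"])

lemma step_integral_measurable: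
  assumes "step_process p m V" "k \<le> m"
  shows "step_integral p V k \<in> borel_measurable (F (ennreal (p k)))"
  unfolding step_integral_def using assms
  by (intro borel_measurable_sum borel_measurable_times borel_measurable_diff w_measurable_F
        step_value_measurable[OF assms(1)])
     (auto intro: step_process_mono step_process_nonneg)

lemma step_process_integral:
  assumes V: "step_process p m V" and "k \<le> m"
  shows "has_bochner_integral lborel (\<lambda>s. indicator {0<..p k} s * (f (V s \<omega>) :: real))
    (\<Sum>j<k. f (V (p (Suc j)) \<omega>) * (p (Suc j) - p j))"
  using assms(2)
proof (induction k)
  case 0
  then show ?case using step_process_0[OF V] has_bochner_integral_zero by simp
next
  case (Suc k)
  have lt: "p k < p (Suc k)" and c: "\<And>s. s \<in> {p k<..p (Suc k)} \<Longrightarrow> V s = V (p (Suc k))"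
    using step_process_less[OF V] step_process_const[OF V] Suc by auto
  have 0: "0 \<le> p k" using step_process_nonneg[OF V] Suc by auto
  have "has_bochner_integral lborel (\<lambda>s. indicator {0<..p k} s * f (V s \<omega>) + indicator {p k<..p (Suc k)} s * f (V (p (Suc k)) \<omega>))
    ((\<Sum>j<k. f (V (p (Suc j)) \<omega>) * (p (Suc j) - p j)) + measure lborel {p k<..p (Suc k)} * f (V (p (Suc k)) \<omega>))"
    using Suc lt by (intro has_bochner_integral_add has_bochner_integral_mult_left has_bochner_integral_real_indicator) auto
  also have "(\<lambda>s. indicator {0<..p k} s * f (V s \<omega>) + indicator {p k<..p (Suc k)} s * f (V (p (Suc k)) \<omega>))
    = (\<lambda>s. indicator {0<..p (Suc k)} s * f (V s \<omega>))"
  proof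
    fix s
    show "indicator {0<..p k} s * f (V s \<omega>) + indicator {p k<..p (Suc k)} s * f (V (p (Suc k)) \<omega>)
      = indicator {0<..p (Suc k)} s * f (V s \<omega>)"
      using 0 lt by (cases "s \<in> {p k<..p (Suc k)}") (simp_all only: c, auto simp: indicator_def)
  qed
  also have "(\<Sum>j<k. f (V (p (Suc j)) \<omega>) * (p (Suc j) - p j)) + measure lborel {p k<..p (Suc k)} * f (V (p (Suc k)) \<omega>)
    = (\<Sum>j<Suc k. f (V (p (Suc j)) \<omega>) * (p (Suc j) - p j))"
    using lt by (simp add: mult.commute)
  finally show ?case .
qed

lemma step_process_nn_integral:
  assumes V: "step_process p m V" and "k \<le> m" and "\<And>x. 0 \<le> f x"
  shows "(\<integral>\<^sup>+ s\<in>{0<..p k}. ennreal (f (V s \<omega>)) \<partial>lborel)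
    = ennreal (\<Sum>j<k. f (V (p (Suc j)) \<omega>) * (p (Suc j) - p j))"
proof -
  have "(\<integral>\<^sup>+ s\<in>{0<..p k}. ennreal (f (V s \<omega>)) \<partial>lborel)
    = (\<integral>\<^sup>+ s. ennreal (indicator {0<..p k} s * f (V s \<omega>)) \<partial>lborel)"
    by (intro nn_integral_cong) (auto simp: indicator_def)
  then show ?thesis
    using step_process_integral[OF V, of k f \<omega>] assms
    by (simp add: nn_integral_eq_integral has_bochner_integral_iff)
qed

text \<open>Induction along the grid: with the past frozen, the next increment is centred normal, so
  the cross term vanishes and the square contributes the length of the interval. The identity is one
  in [0, \<infinity>], so unbounded coefficients are covered.\<close>

lemma step_isometry:
  assumes V: "step_process p m V" and "k \<le> m"
  shows "(\<integral>\<^sup>+ \<omega>. ennreal ((step_integral p V k \<omega>)\<^sup>2) \<partial>M)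
    = (\<integral>\<^sup>+ \<omega>. (\<integral>\<^sup>+ s\<in>{0<..p k}. ennreal ((V s \<omega>)\<^sup>2) \<partial>lborel) \<partial>M)"
proof -
  have "(\<integral>\<^sup>+ \<omega>. ennreal ((step_integral p V k \<omega>)\<^sup>2) \<partial>M)
    = (\<integral>\<^sup>+ \<omega>. ennreal (\<Sum>j<k. (V (p (Suc j)) \<omega>)\<^sup>2 * (p (Suc j) - p j)) \<partial>M)"
    using assms(2)
  proof (induction k)
    case 0
    then show ?case by (simp add: step_integral_def)
  next
    case (Suc k)
    have lt: "p k < p (Suc k)" and 0: "0 \<le> p k"
      using step_process_less[OF V] Suc step_process_nonneg[OF V, of k] by auto
    have gF[measurable]: "V (p (Suc k)) \<in> borel_measurable (F (ennreal (p k)))"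
      using step_process_measurable[OF V] Suc by auto
    have iF[measurable]: "step_integral p V k \<in> borel_measurable (F (ennreal (p k)))"
      using step_integral_measurable[OF V] Suc by auto
    note [measurable] = measurable_F_M[OF gF] measurable_F_M[OF iF]
    have qM[measurable]: "(\<lambda>\<omega>. \<Sum>j<k. (V (p (Suc j)) \<omega>)\<^sup>2 * (p (Suc j) - p j)) \<in> borel_measurable M"
      using measurable_F_M[OF step_value_measurable[OF V, of _ k]] Suc
      by (intro borel_measurable_sum borel_measurable_times borel_measurable_power) auto
    have q0: "0 \<le> (\<Sum>j<k. (V (p (Suc j)) \<omega>)\<^sup>2 * (p (Suc j) - p j))" for \<omega>
      using step_process_less[OF V] Suc by (intro sum_nonneg) (auto simp: less_imp_le)
    have "(\<integral>\<^sup>+ \<omega>. ennreal ((step_integral p V (Suc k) \<omega>)\<^sup>2) \<partial>M)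
      = (\<integral>\<^sup>+ \<omega>. (\<lambda>(\<omega>, y). ennreal ((step_integral p V k \<omega> + V (p (Suc k)) \<omega> * y)\<^sup>2)) (\<omega>, w (p (Suc k)) \<omega> - w (p k) \<omega>) \<partial>M)"
      by (simp add: step_integral_def)
    also have "\<dots> = (\<integral>\<^sup>+ \<omega>. (\<integral>\<^sup>+ y. ennreal ((step_integral p V k \<omega> + V (p (Suc k)) \<omega> * y)\<^sup>2)
        * ennreal (normal_density 0 (sqrt (p (Suc k) - p k)) y) \<partial>lborel) \<partial>M)"
      by (subst nn_integral_increment[OF 0 lt]) auto
    also have "\<dots> = (\<integral>\<^sup>+ \<omega>. ennreal ((step_integral p V k \<omega>)\<^sup>2 + (V (p (Suc k)) \<omega>)\<^sup>2 * (p (Suc k) - p k)) \<partial>M)"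
      using lt by (subst nn_integral_normal_square) auto
    also have "\<dots> = (\<integral>\<^sup>+ \<omega>. ennreal ((step_integral p V k \<omega>)\<^sup>2) \<partial>M) + (\<integral>\<^sup>+ \<omega>. ennreal ((V (p (Suc k)) \<omega>)\<^sup>2 * (p (Suc k) - p k)) \<partial>M)"
      using lt by (subst nn_integral_add[symmetric]) (auto simp: ennreal_plus)
    also have "\<dots> = (\<integral>\<^sup>+ \<omega>. ennreal (\<Sum>j<Suc k. (V (p (Suc j)) \<omega>)\<^sup>2 * (p (Suc j) - p j)) \<partial>M)"
      using lt Suc q0 by (subst Suc.IH, simp, subst nn_integral_add[symmetric]) (auto simp: ennreal_plus)
    finally show ?case .
  qed
  then show ?thesis
    using step_process_nn_integral[OF V assms(2), of "\<lambda>x. x\<^sup>2"] by simp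
qed

text \<open>The stochastic exponential of \<open>\<theta>\<close> times the step integral; the sum
  is the quadratic variation of the step integral.\<close>

definition step_exp :: "real \<Rightarrow> (nat \<Rightarrow> real) \<Rightarrow> (real \<Rightarrow> 'a \<Rightarrow> real) \<Rightarrow> nat \<Rightarrow> 'a \<Rightarrow> real" where
  "step_exp \<theta> p V k \<omega> = exp (\<theta> * step_integral p V k \<omega>
     - \<theta>\<^sup>2 / 2 * (\<Sum>j<k. (V (p (Suc j)) \<omega>)\<^sup>2 * (p (Suc j) - p j)))"

lemma step_exp_measurable:
  assumes V: "step_process p m V" and "k \<le> m"
  shows "step_exp \<theta> p V k \<in> borel_measurable (F (ennreal (p k)))"
proof -
  note [measurable] = step_integral_measurable[OF assms]
  have [measurable]: "(\<lambda>\<omega>. \<Sum>j<k. (V (p (Suc j)) \<omega>)\<^sup>2 * (p (Suc j) - p j)) \<in> borel_measurable (F (ennreal (p k)))"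
    using step_value_measurable[OF V] assms(2)
    by (intro borel_measurable_sum borel_measurable_times borel_measurable_power) auto
  show ?thesis unfolding step_exp_def by measurable
qed

text \<open>With the past frozen, each new factor is the exponential of a normal variable normalised
  to mean 1. Testing against \<open>Y\<close> takes the place of conditional expectations.\<close>

lemma step_exp_martingale:
  assumes V: "step_process p m V" and "j \<le> k" "k \<le> m"
    and Y: "Y \<in> borel_measurable (F (ennreal (p j)))"
  shows "(\<integral>\<^sup>+ \<omega>. ennreal (step_exp \<theta> p V k \<omega>) * Y \<omega> \<partial>M)
    = (\<integral>\<^sup>+ \<omega>. ennreal (step_exp \<theta> p V j \<omega>) * Y \<omega> \<partial>M)"
  using assms(2,3)
proof (induction k rule: dec_induct)
  case (step k)
  have lt: "p k < p (Suc k)" and 0: "0 \<le> p k" and jk: "p j \<le> p k"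
    using step_process_less[OF V] step step_process_nonneg[OF V, of k] step_process_mono[OF V, of j k] by auto
  let ?d = "p (Suc k) - p k" and ?g = "V (p (Suc k))"
  have [measurable]: "?g \<in> borel_measurable (F (ennreal (p k)))"
    using step_process_measurable[OF V] step by auto
  have [measurable]: "step_exp \<theta> p V k \<in> borel_measurable (F (ennreal (p k)))"
    using step_exp_measurable[OF V] step by auto
  have [measurable]: "Y \<in> borel_measurable (F (ennreal (p k)))"
    using jk by (intro measurable_F_mono[OF Y] ennreal_leI)
  have "(\<integral>\<^sup>+ \<omega>. ennreal (step_exp \<theta> p V (Suc k) \<omega>) * Y \<omega> \<partial>M)
    = (\<integral>\<^sup>+ \<omega>. (\<lambda>(\<omega>, y). ennreal (step_exp \<theta> p V k \<omega>) * Y \<omega> * ennreal (exp ((\<theta> * ?g \<omega>) * y - (\<theta> * ?g \<omega>)\<^sup>2 * ?d / 2)))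
        (\<omega>, w (p (Suc k)) \<omega> - w (p k) \<omega>) \<partial>M)"
  proof (intro nn_integral_cong)
    fix \<omega>
    have "step_exp \<theta> p V (Suc k) \<omega> = step_exp \<theta> p V k \<omega>
        * exp ((\<theta> * ?g \<omega>) * (w (p (Suc k)) \<omega> - w (p k) \<omega>) - (\<theta> * ?g \<omega>)\<^sup>2 * ?d / 2)"
      by (simp add: step_exp_def step_integral_def field_simps flip: exp_add)
    then show "ennreal (step_exp \<theta> p V (Suc k) \<omega>) * Y \<omega> =
      (\<lambda>(\<omega>, y). ennreal (step_exp \<theta> p V k \<omega>) * Y \<omega> * ennreal (exp ((\<theta> * ?g \<omega>) * y - (\<theta> * ?g \<omega>)\<^sup>2 * ?d / 2)))
        (\<omega>, w (p (Suc k)) \<omega> - w (p k) \<omega>)"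
      by (simp add: ennreal_mult step_exp_def mult_ac)
  qed
  also have "\<dots> = (\<integral>\<^sup>+ \<omega>. (\<integral>\<^sup>+ y. ennreal (step_exp \<theta> p V k \<omega>) * Y \<omega> * (ennreal (exp ((\<theta> * ?g \<omega>) * y - (\<theta> * ?g \<omega>)\<^sup>2 * ?d / 2))
        * ennreal (normal_density 0 (sqrt ?d) y)) \<partial>lborel) \<partial>M)"
    by (subst nn_integral_increment[OF 0 lt]) (auto simp: mult.assoc)
  also have "\<dots> = (\<integral>\<^sup>+ \<omega>. ennreal (step_exp \<theta> p V k \<omega>) * Y \<omega> \<partial>M)"
    using lt by (subst nn_integral_cmult) (auto simp: nn_integral_normal_exp)
  finally show ?case using step by simp
qed simp

text \<open>The square of the exponential for \<open>\<theta>\<close> is the exponential for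
  \<open>2 * \<theta>\<close>, which has mean 1, times \<open>exp (\<theta>\<^sup>2 * Q)\<close>
  with the quadratic variation \<open>Q\<close>, and \<open>Q\<close> is at most
  \<open>B\<^sup>2 * p k\<close>.\<close>

lemma step_exp_square_bound:
  assumes V: "step_process p m V" and "k \<le> m" and B: "\<And>s \<omega>. \<bar>V s \<omega>\<bar> \<le> B"
  shows "(\<integral>\<^sup>+ \<omega>. ennreal ((step_exp \<theta> p V k \<omega>)\<^sup>2) \<partial>M) \<le> ennreal (exp (\<theta>\<^sup>2 * B\<^sup>2 * p k))"
proof -
  have q: "(\<Sum>j<k. (V (p (Suc j)) \<omega>)\<^sup>2 * (p (Suc j) - p j)) \<le> B\<^sup>2 * p k" for \<omega>
  proof -
    have "(\<Sum>j<k. (V (p (Suc j)) \<omega>)\<^sup>2 * (p (Suc j) - p j)) \<le> (\<Sum>j<k. B\<^sup>2 * (p (Suc j) - p j))"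
      using step_process_less[OF V] assms(2) B by (intro sum_mono mult_right_mono abs_le_square_iff[THEN iffD1])
        (auto simp: less_imp_le intro: order_trans[OF _ abs_ge_self])
    also have "\<dots> = B\<^sup>2 * p k"
      using step_process_0[OF V] sum_lessThan_telescope[of p k] by (simp flip: sum_distrib_left)
    finally show ?thesis .
  qed
  have "(step_exp \<theta> p V k \<omega>)\<^sup>2 \<le> exp (\<theta>\<^sup>2 * B\<^sup>2 * p k) * step_exp (2 * \<theta>) p V k \<omega>" for \<omega>
  proof -
    have "(step_exp \<theta> p V k \<omega>)\<^sup>2 = exp (\<theta>\<^sup>2 * (\<Sum>j<k. (V (p (Suc j)) \<omega>)\<^sup>2 * (p (Suc j) - p j))) * step_exp (2 * \<theta>) p V k \<omega>"
      by (simp add: step_exp_def field_simps power2_eq_square flip: exp_add)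
    then show ?thesis
      using mult_left_mono[OF q, of "\<theta>\<^sup>2" \<omega>] by (simp add: step_exp_def mult.assoc)
  qed
  then have "(\<integral>\<^sup>+ \<omega>. ennreal ((step_exp \<theta> p V k \<omega>)\<^sup>2) \<partial>M)
      \<le> (\<integral>\<^sup>+ \<omega>. ennreal (exp (\<theta>\<^sup>2 * B\<^sup>2 * p k)) * (ennreal (step_exp (2 * \<theta>) p V k \<omega>) * 1) \<partial>M)"
    by (intro nn_integral_mono) (simp add: step_exp_def flip: ennreal_mult)
  also have "\<dots> = ennreal (exp (\<theta>\<^sup>2 * B\<^sup>2 * p k)) * (\<integral>\<^sup>+ \<omega>. ennreal (step_exp (2 * \<theta>) p V k \<omega>) * 1 \<partial>M)"
    using measurable_F_M[OF step_exp_measurable[OF V assms(2)]] by (intro nn_integral_cmult) auto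
  also have "(\<integral>\<^sup>+ \<omega>. ennreal (step_exp (2 * \<theta>) p V k \<omega>) * 1 \<partial>M) = 1"
    using step_exp_martingale[OF V _ assms(2), of 0 "\<lambda>_. 1" "2 * \<theta>"]
    by (simp add: step_exp_def step_integral_def emeasure_space_1)
  finally show ?thesis by simp
qed

text \<open>The intervals of a simple process may overlap and come in any order. Sorting all their
  endpoints gives a common refinement; the times \<open>ts\<close> are added because the two
  integrals are compared at grid points only.\<close>

lemma simple_process_grid:
  assumes S: "simple_process (space M) F S" and ts: "finite ts" "ts \<subseteq> {0..}"
  obtains p m where "step_process p m (simple_value S)"
    and "\<And>t. t \<in> ts \<Longrightarrow> \<exists>k\<le>m. p k = t"
    and "\<And>k \<omega>. k \<le> m \<Longrightarrow> simple_integral w S (p k) \<omega> = step_integral p (simple_value S) k \<omega>"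
proof -
  define P where "P = insert 0 (ts \<union> fst ` set S \<union> (fst \<circ> snd) ` set S)"
  have P: "finite P" "P \<noteq> {}" "0 \<in> P" using ts by (auto simp: P_def)
  have S': "0 \<le> a" "a \<le> b" "h \<in> borel_measurable (F (ennreal a))" if "(a, b, h) \<in> set S" for a b h
    using bspec[OF S[unfolded simple_process_def] that] by auto
  have SP: "a \<in> P" "b \<in> P" if "(a, b, h) \<in> set S" for a b h
    using imageI[OF that, of fst] imageI[OF that, of "fst \<circ> snd"] by (auto simp: P_def)
  have nonneg: "0 \<le> x" if x: "x \<in> P" for x
  proof -
    consider "x = 0" | "x \<in> ts" | (endpoint) z where "z \<in> set S" "x = fst z \<or> x = fst (snd z)"
      using x unfolding P_def by auto
    then show ?thesis
    proof cases
      case (endpoint z)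
      obtain a b h where "z = (a, b, h)" by (cases z)
      then show ?thesis using S'[of a b h] endpoint by auto
    qed (use ts in auto)
  qed
  define xs where "xs = sorted_list_of_set P"
  define p where "p = nth xs"
  define m where "m = card P - 1"
  have len: "length xs = Suc m" using P by (simp add: xs_def m_def card_gt_0_iff)
  have xs: "set xs = P" "sorted_wrt (<) xs" using P by (auto simp: xs_def)
  have p_less: "p i < p j" if "i < j" "j \<le> m" for i j
    using sorted_wrt_nth_less[OF xs(2), of i j] that len by (simp add: p_def)
  have p_mono: "p i \<le> p j" if "i \<le> j" "j \<le> m" for i j
    using p_less[of i j] that by (cases "i = j") auto
  have inP: "\<exists>k\<le>m. p k = x" if "x \<in> P" for x
    using that len unfolding xs(1)[symmetric] in_set_conv_nth p_def by (auto simp: less_Suc_eq_le)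
  have p_in: "p k \<in> P" if "k \<le> m" for k
    using that len xs(1) by (auto simp: p_def)
  have p0: "p 0 = 0"
  proof -
    obtain k where "k \<le> m" "p k = 0" using inP[OF P(3)] by auto
    then show ?thesis using p_mono[of 0 k] nonneg[OF p_in[of 0]] by auto
  qed
  \<comment> \<open>Neighbouring grid points have no endpoint strictly between them, so each
    interval of \<open>S\<close> contains a grid interval or misses it.\<close>
  have gap: "x \<le> p j \<or> p (Suc j) \<le> x" if x: "x \<in> P" and j: "j < m" for x j
  proof -
    obtain k where "k \<le> m" "p k = x" using inP[OF x] by auto
    then show ?thesis using p_mono[of k j] p_mono[of "Suc j" k] j by (cases "k \<le> j") auto
  qed
  have step: "step_process p m (simple_value S)"
    unfolding step_process_def
  proof (intro conjI allI impI ballI p0 p_less)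
    fix j assume j: "j < m"
    \<comment> \<open>A coefficient that is not yet known at \<open>p j\<close> belongs to an
      interval beginning at \<open>p (Suc j)\<close> or later, where the indicator vanishes.\<close>
    have m1: "(\<lambda>\<omega>. h \<omega> * indicator {a<..b} (p (Suc j))) \<in> borel_measurable (F (ennreal (p j)))"
      if "(a, b, h) \<in> set S" for a b h
    proof (cases "a \<le> p j")
      case True
      then have [measurable]: "h \<in> borel_measurable (F (ennreal (p j)))"
        using measurable_F_mono[OF S'(3)[OF that] ennreal_leI] by blast
      show ?thesis by measurable
    next
      case False
      then have "p (Suc j) \<le> a" using gap[of a j] SP[OF that] j by auto
      then show ?thesis by simp
    qed
    show "simple_value S (p (Suc j)) \<in> borel_measurable (F (ennreal (p j)))"
      using m1 unfolding simple_value_def[abs_def]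
    proof (induction S)
      case (Cons z S)
      obtain a b h where z: "z = (a, b, h)" by (cases z)
      have 1: "(\<lambda>\<omega>. h \<omega> * indicator {a<..b} (p (Suc j))) \<in> borel_measurable (F (ennreal (p j)))"
        using Cons.prems[of a b h] z by auto
      show ?case
        using borel_measurable_add[OF 1 Cons.IH] Cons.prems by (simp add: z)
    qed simp
    fix s assume s: "s \<in> {p j<..p (Suc j)}"
    have "indicator {a<..b} s = (indicator {a<..b} (p (Suc j)) :: real)" if "(a, b, h) \<in> set S" for a b h
      using gap[of a j] gap[of b j] SP[OF that] j s by (auto simp: indicator_def)
    then have "map (\<lambda>(a, b, h). h \<omega> * indicator {a<..b} s) S = map (\<lambda>(a, b, h). h \<omega> * indicator {a<..b} (p (Suc j))) S" for \<omega>
      by (intro map_cong) auto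
    then show "simple_value S s = simple_value S (p (Suc j))"
      unfolding simple_value_def by (intro ext) (rule arg_cong)
  qed auto
  have single: "h \<omega> * (w (min b (p k)) \<omega> - w (min a (p k)) \<omega>)
      = (\<Sum>j<k. h \<omega> * indicator {a<..b} (p (Suc j)) * (w (p (Suc j)) \<omega> - w (p j) \<omega>))"
    if "(a, b, h) \<in> set S" "k \<le> m" for a b h k \<omega>
    using that(2)
  proof (induction k)
    case 0
    then show ?case using S'[OF that(1)] by (simp add: p0 min_absorb2)
  next
    case (Suc k)
    have lt: "p k < p (Suc k)" using p_less Suc by auto
    have g: "a \<le> p k \<or> p (Suc k) \<le> a" "b \<le> p k \<or> p (Suc k) \<le> b"
      using gap[of a k] gap[of b k] SP[OF that(1)] Suc by auto
    have "h \<omega> * (w (min b (p (Suc k))) \<omega> - w (min a (p (Suc k))) \<omega>)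
        = h \<omega> * (w (min b (p k)) \<omega> - w (min a (p k)) \<omega>) + h \<omega> * indicator {a<..b} (p (Suc k)) * (w (p (Suc k)) \<omega> - w (p k) \<omega>)"
      using g lt S'(2)[OF that(1)] by (elim disjE) (simp_all add: min_absorb1 min_absorb2 indicator_def algebra_simps)
    then show ?case using Suc by simp
  qed
  have "simple_integral w S (p k) \<omega> = step_integral p (simple_value S) k \<omega>" if "k \<le> m" for k \<omega>
  proof -
    have "simple_integral w S (p k) \<omega>
      = (\<Sum>(a, b, h)\<leftarrow>S. \<Sum>j<k. h \<omega> * indicator {a<..b} (p (Suc j)) * (w (p (Suc j)) \<omega> - w (p j) \<omega>))"
      unfolding simple_integral_def using single[OF _ that]
      by (intro arg_cong[where f=sum_list] map_cong) auto
    also have "\<dots> = step_integral p (simple_value S) k \<omega>"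
      unfolding step_integral_def simple_value_def
      by (induction S) (auto simp: sum.distrib distrib_right)
    finally show ?thesis .
  qed
  then show ?thesis
    using step inP by (intro that[of p m]) (auto simp: P_def)
qed

end

section \<open>The exponential martingale\<close>

text \<open>Clipping is the projection onto [0, b]: it brings \<open>x\<close> no further from a
  point \<open>h\<close> of the interval, and moves \<open>x\<close> no further than to
  \<open>h\<close>. The first bound keeps the clipped integrands convergent, the second controls
  what is cut off.\<close>

lemma clip_square_le:
  fixes x h b :: real
  assumes "0 \<le> h" "h \<le> b"
  shows "(max 0 (min b x) - h)\<^sup>2 \<le> (x - h)\<^sup>2" "(x - max 0 (min b x))\<^sup>2 \<le> (x - h)\<^sup>2"
  using assms by (auto simp: abs_le_square_iff[symmetric] max_def min_def)

text \<open>First \<open>e\<close> is chosen small, then \<open>n\<close> large. This yields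
  convergence of quadratic variations from L2-convergence of the integrands without the
  Cauchy-Schwarz inequality.\<close>

lemma tendsto_0_of_trade_off:
  fixes x g :: "nat \<Rightarrow> real"
  assumes g: "g \<longlonglongrightarrow> 0" and x: "\<And>e n. e > 0 \<Longrightarrow> \<bar>x n\<bar> \<le> e * T + C / e * g n" and T: "0 \<le> T"
  shows "x \<longlonglongrightarrow> 0"
proof (rule tendstoI)
  fix \<epsilon> :: real assume \<epsilon>: "0 < \<epsilon>"
  define e where "e = \<epsilon> / (2 * (T + 1))"
  have e: "0 < e" using \<epsilon> T by (simp add: e_def)
  have eT: "e * T < \<epsilon> / 2" using \<epsilon> T by (simp add: e_def field_simps)
  have "(\<lambda>n. C / e * g n) \<longlonglongrightarrow> C / e * 0" by (intro tendsto_intros g)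
  then have "\<forall>\<^sub>F n in sequentially. C / e * g n < \<epsilon> / 2"
    using \<epsilon> by (intro order_tendstoD(2)) auto
  then show "\<forall>\<^sub>F n in sequentially. dist (x n) 0 < \<epsilon>"
  proof eventually_elim
    case (elim n)
    then show ?case using x[OF e, of n] eT elim unfolding dist_real_def diff_0_right by linarith
  qed
qed

lemma tendsto_0_of_ennreal_square:
  assumes "(\<lambda>n. ennreal ((x n)\<^sup>2)) \<longlonglongrightarrow> 0"
  shows "x \<longlonglongrightarrow> 0"
proof -
  have "(\<lambda>n. sqrt ((x n)\<^sup>2)) \<longlonglongrightarrow> sqrt 0"
    using assms by (intro tendsto_intros) (simp add: ennreal_tendsto_0_iff)
  then show ?thesis by (simp add: tendsto_rabs_zero_iff)
qed

lemma set_integrable_bounded: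
  fixes f :: "real \<Rightarrow> real"
  assumes "f \<in> borel_measurable borel" "\<And>s. \<bar>f s\<bar> \<le> B"
  shows "set_integrable lborel {0<..t} f"
proof -
  have "emeasure lborel {0<..t} < \<infinity>" by (cases "0 \<le> t") auto
  then show ?thesis
    unfolding set_integrable_def using assms
    by (intro integrableI_bounded_set_indicator[where B=B]) auto
qed

lemma nn_integral_eq_set_lebesgue_integral:
  fixes f :: "real \<Rightarrow> real"
  assumes "set_integrable M A f" "\<And>s. 0 \<le> f s"
  shows "(\<integral>\<^sup>+ s\<in>A. ennreal (f s) \<partial>M) = ennreal (LINT s:A|M. f s)"
proof -
  have "(\<integral>\<^sup>+ s\<in>A. ennreal (f s) \<partial>M) = (\<integral>\<^sup>+ s. ennreal (indicator A s * f s) \<partial>M)"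
    by (intro nn_integral_cong) (auto simp: indicator_def)
  then show ?thesis
    using assms by (simp add: set_integrable_def set_lebesgue_integral_def nn_integral_eq_integral)
qed

lemma simple_value_measurable:
  assumes "\<And>a b h. (a, b, h) \<in> set S \<Longrightarrow> h \<in> borel_measurable M"
  shows "(\<lambda>(s, \<omega>). simple_value S s \<omega>) \<in> borel_measurable (borel \<Otimes>\<^sub>M M)"
  using assms
proof (induction S)
  case (Cons z S)
  obtain a b h where z: "z = (a, b, h)" by (cases z)
  have [measurable]: "h \<in> borel_measurable M" using Cons.prems z by auto
  have [measurable]: "(\<lambda>(s, \<omega>). simple_value S s \<omega>) \<in> borel_measurable (borel \<Otimes>\<^sub>M M)"
    using Cons by auto
  have "(\<lambda>(s, \<omega>). simple_value (z # S) s \<omega>) = (\<lambda>(s, \<omega>). h \<omega> * indicator {a<..b} s + simple_value S s \<omega>)"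
    by (simp add: simple_value_def z)
  then show ?case by simp
qed (simp add: simple_value_def case_prod_beta')

text \<open>The stochastic exponential of \<open>\<theta> * I\<close>, the continuous-time
  counterpart of \<open>step_exp\<close>.\<close>

definition ito_exp :: "real \<Rightarrow> (real \<Rightarrow> 'a \<Rightarrow> real) \<Rightarrow> (real \<Rightarrow> 'a \<Rightarrow> real) \<Rightarrow> real \<Rightarrow> 'a \<Rightarrow> real" where
  "ito_exp \<theta> H I t \<omega> = exp (\<theta> * I t \<omega> - \<theta>\<^sup>2 / 2 * (LINT s:{0<..t}|lborel. (H s \<omega>)\<^sup>2))"

context brownian_filtration
begin

text \<open>The initial value is not part of the notion of stochastic integral. It follows because
  all simple integrals vanish at time 0, so that a constant sequence tends to 0.\<close>

lemma ito_integral_initial: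
  assumes "is_ito_integral M F w H I"
  shows "AE \<omega> in M. I 0 \<omega> = 0"
proof -
  obtain S where S: "\<And>n. simple_process (space M) F (S n)"
    "(\<lambda>n. \<integral>\<^sup>+ \<omega>. ennreal ((simple_integral w (S n) 0 \<omega> - I 0 \<omega>)\<^sup>2) \<partial>M) \<longlonglongrightarrow> 0"
    using assms unfolding is_ito_integral_def by blast
  have [measurable]: "I 0 \<in> borel_measurable M"
    using assms by (simp add: is_ito_integral_def)
  have "simple_integral w (S n) 0 \<omega> = 0" for n \<omega>
  proof -
    have "map (\<lambda>(a, b, h). h \<omega> * (w (min b 0) \<omega> - w (min a 0) \<omega>)) (S n) = map (\<lambda>_. 0) (S n)"
      using S(1)[of n] by (intro map_cong) (auto simp: simple_process_def min_absorb2)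
    then show ?thesis unfolding simple_integral_def by (metis sum_list_0)
  qed
  then have "(\<integral>\<^sup>+ \<omega>. ennreal ((I 0 \<omega>)\<^sup>2) \<partial>M) = 0"
    using S(2) LIMSEQ_unique tendsto_const by (simp add: LIMSEQ_const_iff)
  then have "AE \<omega> in M. ennreal ((I 0 \<omega>)\<^sup>2) = 0"
    by (subst (asm) nn_integral_0_iff_AE) auto
  then show ?thesis by eventually_elim auto
qed

text \<open>The simple processes are clipped to [0, b], which makes
  \<open>step_exp_square_bound\<close> uniform in \<open>n\<close>. The clipped integrals still
  converge to \<open>I\<close>, and the quadratic variations converge as well. Along a subsequence
  the exponentials converge almost everywhere, and by the uniform second moments so do their
  integrals against \<open>Y\<close>.\<close>

lemma ito_exp_martingale_aux:
  assumes I: "is_ito_integral M F w H I"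
    and Hm: "(\<lambda>(s, \<omega>). H s \<omega>) \<in> borel_measurable (borel \<Otimes>\<^sub>M M)"
    and Hb: "\<And>s \<omega>. \<omega> \<in> space M \<Longrightarrow> 0 \<le> H s \<omega>" "\<And>s \<omega>. \<omega> \<in> space M \<Longrightarrow> H s \<omega> \<le> b" and b: "0 \<le> b"
    and st: "0 \<le> s" "s < t"
    and Y: "Y \<in> borel_measurable (F (ennreal s))" "\<And>\<omega>. 0 \<le> Y \<omega>" "\<And>\<omega>. Y \<omega> \<le> 1"
  shows "(\<integral>\<^sup>+ \<omega>. ennreal (ito_exp \<theta> H I t \<omega> * Y \<omega>) \<partial>M) = (\<integral>\<^sup>+ \<omega>. ennreal (ito_exp \<theta> H I s \<omega> * Y \<omega>) \<partial>M)"
proof -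
  obtain S where S: "\<And>n. simple_process (space M) F (S n)"
    "\<And>T. 0 \<le> T \<Longrightarrow> (\<lambda>n. \<integral>\<^sup>+ \<omega>. (\<integral>\<^sup>+ s\<in>{0<..T}. ennreal ((simple_value (S n) s \<omega> - H s \<omega>)\<^sup>2) \<partial>lborel) \<partial>M) \<longlonglongrightarrow> 0"
    "\<And>t. 0 \<le> t \<Longrightarrow> (\<lambda>n. \<integral>\<^sup>+ \<omega>. ennreal ((simple_integral w (S n) t \<omega> - I t \<omega>)\<^sup>2) \<partial>M) \<longlonglongrightarrow> 0"
    using I unfolding is_ito_integral_def by blast
  have [measurable]: "Y \<in> borel_measurable M" using Y(1) by (rule measurable_F_M)
  have Im: "I r \<in> borel_measurable M" if "0 \<le> r" for r
    using I that by (simp add: is_ito_integral_def)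
  have t: "0 \<le> t" using st by simp
  note [measurable] = Im[OF st(1)] Im[OF t] Hm
  have Hsec: "(\<lambda>s. H s \<omega>) \<in> borel_measurable borel" if "\<omega> \<in> space M" for \<omega>
    using measurable_compose[OF measurable_Pair2'[OF that] Hm] by simp
  define clip where "clip = (\<lambda>x. max 0 (min b x))"
  have clip_m[measurable]: "clip \<in> borel_measurable borel" by (simp add: clip_def)
  have clip: "0 \<le> clip x" "clip x \<le> b" for x using b by (auto simp: clip_def)
  have clip_le: "(clip x - h)\<^sup>2 \<le> (x - h)\<^sup>2" "(x - clip x)\<^sup>2 \<le> (x - h)\<^sup>2" if "0 \<le> h" "h \<le> b" for x h
    using clip_square_le[OF that] by (simp_all add: clip_def)
  define V where "V n = simple_value (S n)" for n
  define C where "C n = (\<lambda>s \<omega>. clip (V n s \<omega>))" for n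
  have "\<exists>p m ks kt. step_process p m (V n) \<and> ks \<le> kt \<and> kt \<le> m \<and> p ks = s \<and> p kt = t \<and>
      (\<forall>k\<le>m. \<forall>\<omega>. simple_integral w (S n) (p k) \<omega> = step_integral p (V n) k \<omega>)" for n
  proof -
    obtain p m where pm: "step_process p m (V n)" "\<And>r. r \<in> {s, t} \<Longrightarrow> \<exists>k\<le>m. p k = r"
      "\<And>k \<omega>. k \<le> m \<Longrightarrow> simple_integral w (S n) (p k) \<omega> = step_integral p (V n) k \<omega>"
      using simple_process_grid[OF S(1)[of n], of "{s, t}"] st unfolding V_def by auto
    obtain ks kt where k: "ks \<le> m" "p ks = s" "kt \<le> m" "p kt = t"
      using pm(2)[of s] pm(2)[of t] by auto
    then have "ks \<le> kt"
      using step_process_mono[OF pm(1), of kt ks] st by (cases "ks \<le> kt") auto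
    then show ?thesis using pm k by blast
  qed
  then obtain p m ks kt where step: "\<And>n. step_process (p n) (m n) (V n)"
    and ks: "\<And>n. ks n \<le> kt n" "\<And>n. p n (ks n) = s" and kt: "\<And>n. kt n \<le> m n" "\<And>n. p n (kt n) = t"
    and simple: "\<And>n k \<omega>. k \<le> m n \<Longrightarrow> simple_integral w (S n) (p n k) \<omega> = step_integral (p n) (V n) k \<omega>"
    by metis
  have ks_m: "ks n \<le> m n" for n using ks(1)[of n] kt(1)[of n] by simp
  have stepC: "step_process (p n) (m n) (C n)" for n
    unfolding C_def by (rule step_process_comp[OF step clip_m])
  have Vm[measurable]: "(\<lambda>(s, \<omega>). V n s \<omega>) \<in> borel_measurable (borel \<Otimes>\<^sub>M M)" for n
    unfolding V_def
  proof (rule simple_value_measurable)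
    fix a b h assume "(a, b, h) \<in> set (S n)"
    then have "h \<in> borel_measurable (F (ennreal a))"
      using S(1)[of n] by (auto simp: simple_process_def)
    then show "h \<in> borel_measurable M" by (rule measurable_F_M)
  qed
  have Cm[measurable]: "(\<lambda>(s, \<omega>). C n s \<omega>) \<in> borel_measurable (borel \<Otimes>\<^sub>M M)" for n
    unfolding C_def by measurable
  have Csec: "(\<lambda>s. C n s \<omega>) \<in> borel_measurable borel" if "\<omega> \<in> space M" for \<omega> n
    using measurable_compose[OF measurable_Pair2'[OF that] Cm] by simp
  define J where "J n k = step_integral (p n) (C n) k" for n k
  define G where "G n \<omega> = (\<integral>\<^sup>+ s\<in>{0<..t}. ennreal ((C n s \<omega> - H s \<omega>)\<^sup>2) \<partial>lborel)" for n \<omega>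
  have Gm[measurable]: "G n \<in> borel_measurable M" for n
    unfolding G_def by measurable
  have Jm: "J n k \<in> borel_measurable M" if "k \<le> m n" for n k
    unfolding J_def using step_integral_measurable[OF stepC that] by (rule measurable_F_M)
  have J_lim: "(\<lambda>n. \<integral>\<^sup>+ \<omega>. ennreal ((J n (k n) \<omega> - I r \<omega>)\<^sup>2) \<partial>M) \<longlonglongrightarrow> 0"
    if k: "\<And>n. k n \<le> m n" "\<And>n. p n (k n) = r" and r: "0 \<le> r" for k r
  proof -
    have [measurable]: "J n (k n) \<in> borel_measurable M" for n using Jm k by auto
    have [measurable]: "step_integral (p n) (V n) (k n) \<in> borel_measurable M" for n
      using step_integral_measurable[OF step k(1)] by (rule measurable_F_M)
    note [measurable] = Im[OF r]
    let ?e1 = "\<lambda>n. \<integral>\<^sup>+ \<omega>. (\<integral>\<^sup>+ s\<in>{0<..r}. ennreal ((V n s \<omega> - H s \<omega>)\<^sup>2) \<partial>lborel) \<partial>M"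
    let ?e2 = "\<lambda>n. \<integral>\<^sup>+ \<omega>. ennreal ((simple_integral w (S n) r \<omega> - I r \<omega>)\<^sup>2) \<partial>M"
    have le: "(\<integral>\<^sup>+ \<omega>. ennreal ((J n (k n) \<omega> - I r \<omega>)\<^sup>2) \<partial>M) \<le> 2 * ?e1 n + 2 * ?e2 n" for n
    proof -
      let ?x = "\<lambda>\<omega>. step_integral (p n) (V n) (k n) \<omega>"
      \<comment> \<open>By the isometry, clipping changes the integral by the L2-norm of the part
        cut off, which is at most the approximation error of \<open>V\<close>.\<close>
      have stepD: "step_process (p n) (m n) (\<lambda>s \<omega>. V n s \<omega> - C n s \<omega>)"
        unfolding C_def by (rule step_process_comp[OF step, where \<phi>="\<lambda>x. x - clip x"]) simp
      have D: "?x \<omega> - J n (k n) \<omega> = step_integral (p n) (\<lambda>s \<omega>. V n s \<omega> - C n s \<omega>) (k n) \<omega>" for \<omega>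
        by (simp add: J_def step_integral_def sum_subtractf left_diff_distrib)
      have "(\<integral>\<^sup>+ \<omega>. ennreal ((?x \<omega> - J n (k n) \<omega>)\<^sup>2) \<partial>M)
          = (\<integral>\<^sup>+ \<omega>. (\<integral>\<^sup>+ s\<in>{0<..r}. ennreal ((V n s \<omega> - C n s \<omega>)\<^sup>2) \<partial>lborel) \<partial>M)"
        unfolding D by (subst step_isometry[OF stepD k(1)]) (simp add: k(2))
      also have "\<dots> \<le> ?e1 n"
        using Hb by (intro nn_integral_mono mult_right_mono ennreal_leI) (auto simp: C_def intro: clip_le(2))
      finally have 1: "(\<integral>\<^sup>+ \<omega>. ennreal ((?x \<omega> - J n (k n) \<omega>)\<^sup>2) \<partial>M) \<le> ?e1 n" .
      have 2: "(\<integral>\<^sup>+ \<omega>. ennreal ((?x \<omega> - I r \<omega>)\<^sup>2) \<partial>M) = ?e2 n"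
        using simple[OF k(1)[of n]] by (simp add: k(2))
      have "(\<integral>\<^sup>+ \<omega>. ennreal ((J n (k n) \<omega> - I r \<omega>)\<^sup>2) \<partial>M)
          \<le> (\<integral>\<^sup>+ \<omega>. 2 * ennreal ((?x \<omega> - J n (k n) \<omega>)\<^sup>2) + 2 * ennreal ((?x \<omega> - I r \<omega>)\<^sup>2) \<partial>M)"
      proof (rule nn_integral_mono)
        fix \<omega>
        have "0 \<le> (2 * ?x \<omega> - J n (k n) \<omega> - I r \<omega>)\<^sup>2" by simp
        then have "(J n (k n) \<omega> - I r \<omega>)\<^sup>2 \<le> 2 * (?x \<omega> - J n (k n) \<omega>)\<^sup>2 + 2 * (?x \<omega> - I r \<omega>)\<^sup>2"
          by (simp add: power2_eq_square algebra_simps)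
        then have "ennreal ((J n (k n) \<omega> - I r \<omega>)\<^sup>2) \<le> ennreal (2 * (?x \<omega> - J n (k n) \<omega>)\<^sup>2 + 2 * (?x \<omega> - I r \<omega>)\<^sup>2)"
          by (rule ennreal_leI)
        then show "ennreal ((J n (k n) \<omega> - I r \<omega>)\<^sup>2) \<le> 2 * ennreal ((?x \<omega> - J n (k n) \<omega>)\<^sup>2) + 2 * ennreal ((?x \<omega> - I r \<omega>)\<^sup>2)"
          by (simp add: ennreal_plus ennreal_mult)
      qed
      also have "\<dots> = 2 * (\<integral>\<^sup>+ \<omega>. ennreal ((?x \<omega> - J n (k n) \<omega>)\<^sup>2) \<partial>M) + 2 * ?e2 n"
        unfolding 2[symmetric] by (subst nn_integral_add) (auto simp: nn_integral_cmult)
      also have "\<dots> \<le> 2 * ?e1 n + 2 * ?e2 n"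
        by (intro add_right_mono mult_left_mono 1) simp
      finally show ?thesis .
    qed
    have "(\<lambda>n. 2 * ?e1 n + 2 * ?e2 n) \<longlonglongrightarrow> 2 * 0 + 2 * 0"
      using S(2)[OF r] S(3)[OF r] unfolding V_def
      by (intro tendsto_add ennreal_tendsto_cmult) auto
    then have lim: "(\<lambda>n. 2 * ?e1 n + 2 * ?e2 n) \<longlonglongrightarrow> 0" by simp
    show ?thesis
      by (rule tendsto_sandwich[OF _ _ tendsto_const lim]) (auto intro: always_eventually le)
  qed
  have G_lim: "(\<lambda>n. \<integral>\<^sup>+ \<omega>. G n \<omega> \<partial>M) \<longlonglongrightarrow> 0"
  proof (rule tendsto_sandwich[OF _ _ tendsto_const S(2)[OF t]])
    show "\<forall>\<^sub>F n in sequentially. (\<integral>\<^sup>+ \<omega>. G n \<omega> \<partial>M)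
      \<le> (\<integral>\<^sup>+ \<omega>. (\<integral>\<^sup>+ s\<in>{0<..t}. ennreal ((simple_value (S n) s \<omega> - H s \<omega>)\<^sup>2) \<partial>lborel) \<partial>M)"
      unfolding G_def C_def V_def using Hb
      by (intro always_eventually allI nn_integral_mono mult_right_mono ennreal_leI) (auto intro: clip_le(1))
  qed simp
  \<comment> \<open>All errors are summed so that one subsequence serves both times \<open>s\<close>
    and \<open>t\<close> as well as the quadratic variations.\<close>
  define X where "X n \<omega> = ennreal ((J n (kt n) \<omega> - I t \<omega>)\<^sup>2) + (ennreal ((J n (ks n) \<omega> - I s \<omega>)\<^sup>2) + G n \<omega>)" for n \<omega>
  have Jm'[measurable]: "J n (kt n) \<in> borel_measurable M" "J n (ks n) \<in> borel_measurable M" for n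
    using Jm ks_m kt by auto
  have Xm: "X n \<in> borel_measurable M" for n unfolding X_def by measurable
  have "(\<lambda>n. \<integral>\<^sup>+ \<omega>. X n \<omega> \<partial>M) \<longlonglongrightarrow> 0"
  proof -
    have "(\<integral>\<^sup>+ \<omega>. X n \<omega> \<partial>M) = (\<integral>\<^sup>+ \<omega>. ennreal ((J n (kt n) \<omega> - I t \<omega>)\<^sup>2) \<partial>M)
        + ((\<integral>\<^sup>+ \<omega>. ennreal ((J n (ks n) \<omega> - I s \<omega>)\<^sup>2) \<partial>M) + (\<integral>\<^sup>+ \<omega>. G n \<omega> \<partial>M))" for n
      unfolding X_def by (simp add: nn_integral_add)
    moreover have "(\<lambda>n. (\<integral>\<^sup>+ \<omega>. ennreal ((J n (kt n) \<omega> - I t \<omega>)\<^sup>2) \<partial>M)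
        + ((\<integral>\<^sup>+ \<omega>. ennreal ((J n (ks n) \<omega> - I s \<omega>)\<^sup>2) \<partial>M) + (\<integral>\<^sup>+ \<omega>. G n \<omega> \<partial>M))) \<longlonglongrightarrow> 0 + (0 + 0)"
      by (intro tendsto_add G_lim J_lim kt ks ks_m t st)
    ultimately show ?thesis by simp
  qed
  from AE_subseq_of_nn_integral_tendsto_0[OF Xm this]
  obtain q :: "nat \<Rightarrow> nat" where q: "AE \<omega> in M. (\<lambda>n. X (q n) \<omega>) \<longlonglongrightarrow> 0" by auto
  have Z_lim: "AE \<omega> in M. (\<lambda>n. step_exp \<theta> (p (q n)) (C (q n)) (k (q n)) \<omega>) \<longlonglongrightarrow> ito_exp \<theta> H I r \<omega>"
    if k: "\<And>n. k n \<le> m n" "\<And>n. p n (k n) = r" and r: "0 \<le> r" "r \<le> t"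
      and J: "\<And>n \<omega>. ennreal ((J n (k n) \<omega> - I r \<omega>)\<^sup>2) \<le> X n \<omega>" for k r
    using q AE_space
  proof eventually_elim
    case (elim \<omega>)
    let ?Q = "LINT s:{0<..r}|lborel. (H s \<omega>)\<^sup>2" and ?C = "\<lambda>n. LINT s:{0<..r}|lborel. (C n s \<omega>)\<^sup>2"
    note [measurable] = Hsec[OF elim(2)] Csec[OF elim(2)]
    have "(\<lambda>n. ennreal ((J (q n) (k (q n)) \<omega> - I r \<omega>)\<^sup>2)) \<longlonglongrightarrow> 0"
      by (rule tendsto_sandwich[OF _ _ tendsto_const elim(1)]) (auto intro: always_eventually J)
    then have "(\<lambda>n. J (q n) (k (q n)) \<omega> - I r \<omega>) \<longlonglongrightarrow> 0"
      by (rule tendsto_0_of_ennreal_square)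
    then have J: "(\<lambda>n. J (q n) (k (q n)) \<omega>) \<longlonglongrightarrow> I r \<omega>"
      by (rule LIM_zero_cancel)
    have bnd: "\<bar>(C n s \<omega>)\<^sup>2\<bar> \<le> b\<^sup>2" "\<bar>(H s \<omega>)\<^sup>2\<bar> \<le> b\<^sup>2" "\<bar>(C n s \<omega> - H s \<omega>)\<^sup>2\<bar> \<le> b\<^sup>2" for n s
    proof -
      have "\<bar>C n s \<omega>\<bar> \<le> b" "\<bar>H s \<omega>\<bar> \<le> b" "\<bar>C n s \<omega> - H s \<omega>\<bar> \<le> b"
        using Hb[OF elim(2), of s] clip[of "V n s \<omega>"] by (auto simp: C_def abs_le_iff)
      then show "\<bar>(C n s \<omega>)\<^sup>2\<bar> \<le> b\<^sup>2" "\<bar>(H s \<omega>)\<^sup>2\<bar> \<le> b\<^sup>2" "\<bar>(C n s \<omega> - H s \<omega>)\<^sup>2\<bar> \<le> b\<^sup>2"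
        using b by (auto simp: abs_le_square_iff[symmetric])
    qed
    have int: "set_integrable lborel {0<..r'} (\<lambda>s. (C n s \<omega>)\<^sup>2)" "set_integrable lborel {0<..r'} (\<lambda>s. (H s \<omega>)\<^sup>2)"
      "set_integrable lborel {0<..r'} (\<lambda>s. (C n s \<omega> - H s \<omega>)\<^sup>2)" for n r'
      by (rule set_integrable_bounded, measurable, rule bnd)+
    define g where "g n = (LINT s:{0<..r}|lborel. (C n s \<omega> - H s \<omega>)\<^sup>2)" for n
    have g: "ennreal (g n) \<le> X n \<omega>" for n
    proof -
      have "ennreal (g n) = (\<integral>\<^sup>+ s\<in>{0<..r}. ennreal ((C n s \<omega> - H s \<omega>)\<^sup>2) \<partial>lborel)"
        unfolding g_def by (rule nn_integral_eq_set_lebesgue_integral[symmetric, OF int(3)]) simp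
      also have "\<dots> \<le> G n \<omega>"
        unfolding G_def using r by (intro nn_integral_mono mult_left_mono) (auto simp: indicator_def)
      also have "\<dots> \<le> X n \<omega>" by (simp add: X_def add_increasing)
      finally show ?thesis .
    qed
    have g0: "0 \<le> g n" for n
      unfolding g_def set_lebesgue_integral_def by (intro integral_nonneg_AE) auto
    have "(\<lambda>n. ennreal (g (q n))) \<longlonglongrightarrow> 0"
      by (rule tendsto_sandwich[OF _ _ tendsto_const elim(1)]) (auto intro: always_eventually g)
    then have g_lim: "(\<lambda>n. g (q n)) \<longlonglongrightarrow> 0" using g0 by (simp add: ennreal_tendsto_0_iff)
    have "(\<lambda>n. ?C (q n) - ?Q) \<longlonglongrightarrow> 0"
    proof (rule tendsto_0_of_trade_off[OF g_lim _ r(1)])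
      fix e :: real and n assume e: "0 < e"
      define n' where "n' = q n"
      have "\<bar>?C n' - ?Q\<bar> = \<bar>LINT s:{0<..r}|lborel. (C n' s \<omega>)\<^sup>2 - (H s \<omega>)\<^sup>2\<bar>"
        using int by (simp add: set_integral_diff)
      also have "\<dots> \<le> (LINT s:{0<..r}|lborel. \<bar>(C n' s \<omega>)\<^sup>2 - (H s \<omega>)\<^sup>2\<bar>)"
        using set_integral_norm_bound[OF set_integral_diff(1)[OF int(1)[of r n'] int(2)[of r]]] by simp
      \<comment> \<open>From \<open>\<bar>C + H\<bar> \<le> 2 * b\<close> and
        \<open>2 * b * y \<le> e + b\<^sup>2 / e * y\<^sup>2\<close> with
        \<open>y = \<bar>C - H\<bar>\<close>. Here \<open>e\<close> is free; it tends to 0 only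
        after \<open>n\<close> has become large.\<close>
      also have "\<dots> \<le> (LINT s:{0<..r}|lborel. e + b\<^sup>2 / e * (C n' s \<omega> - H s \<omega>)\<^sup>2)"
      proof (rule set_integral_mono)
        show "set_integrable lborel {0<..r} (\<lambda>s. \<bar>(C n' s \<omega>)\<^sup>2 - (H s \<omega>)\<^sup>2\<bar>)"
          by (intro set_integrable_abs set_integral_diff int)
        show "set_integrable lborel {0<..r} (\<lambda>s. e + b\<^sup>2 / e * (C n' s \<omega> - H s \<omega>)\<^sup>2)"
          by (intro set_integral_add(1) set_integrable_mult_right int set_integrable_bounded[where B="\<bar>e\<bar>"]) auto
        fix s
        have "\<bar>C n' s \<omega> + H s \<omega>\<bar> \<le> 2 * b"
          using Hb[OF elim(2), of s] clip[of "V n' s \<omega>"] by (auto simp: C_def abs_le_iff)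
        then have "\<bar>C n' s \<omega> + H s \<omega>\<bar> * \<bar>C n' s \<omega> - H s \<omega>\<bar> \<le> 2 * b * \<bar>C n' s \<omega> - H s \<omega>\<bar>"
          by (rule mult_right_mono) simp
        moreover have "0 \<le> (e - b * \<bar>C n' s \<omega> - H s \<omega>\<bar>)\<^sup>2" by simp
        then have "2 * b * \<bar>C n' s \<omega> - H s \<omega>\<bar> \<le> e + b\<^sup>2 / e * (C n' s \<omega> - H s \<omega>)\<^sup>2"
          using e by (simp add: field_simps power2_eq_square flip: abs_mult)
        moreover have "\<bar>(C n' s \<omega>)\<^sup>2 - (H s \<omega>)\<^sup>2\<bar> = \<bar>C n' s \<omega> + H s \<omega>\<bar> * \<bar>C n' s \<omega> - H s \<omega>\<bar>"
          by (simp add: power2_eq_square algebra_simps flip: abs_mult)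
        ultimately show "\<bar>(C n' s \<omega>)\<^sup>2 - (H s \<omega>)\<^sup>2\<bar> \<le> e + b\<^sup>2 / e * (C n' s \<omega> - H s \<omega>)\<^sup>2"
          by linarith
      qed
      also have "\<dots> = e * r + b\<^sup>2 / e * g n'"
        using int(3)[of r n'] r by (subst set_integral_add)
          (auto simp: g_def set_integral_const intro!: set_integrable_bounded[where B="\<bar>e\<bar>"])
      finally show "\<bar>?C (q n) - ?Q\<bar> \<le> e * r + b\<^sup>2 / e * g (q n)" by (simp add: n'_def)
    qed
    then have Q: "(\<lambda>n. ?C (q n)) \<longlonglongrightarrow> ?Q" by (rule LIM_zero_cancel)
    have "step_exp \<theta> (p n) (C n) (k n) \<omega> = exp (\<theta> * J n (k n) \<omega> - \<theta>\<^sup>2 / 2 * ?C n)" for n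
      using step_process_integral[OF stepC k(1), of n "\<lambda>x. x\<^sup>2" \<omega>]
      by (simp add: step_exp_def J_def k(2) has_bochner_integral_iff set_lebesgue_integral_def)
    then show ?case
      unfolding ito_exp_def by (simp add: tendsto_intros J Q)
  qed
  have E_lim: "(\<lambda>n. \<integral>\<^sup>+ \<omega>. ennreal (step_exp \<theta> (p (q n)) (C (q n)) (k (q n)) \<omega> * Y \<omega>) \<partial>M)
      \<longlonglongrightarrow> (\<integral>\<^sup>+ \<omega>. ennreal (ito_exp \<theta> H I r \<omega> * Y \<omega>) \<partial>M)"
    if k: "\<And>n. k n \<le> m n" "\<And>n. p n (k n) = r" and r: "0 \<le> r" "r \<le> t"
      and J: "\<And>n \<omega>. ennreal ((J n (k n) \<omega> - I r \<omega>)\<^sup>2) \<le> X n \<omega>" for k r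
  proof (rule nn_integral_tendsto_of_square_bound)
    have [measurable]: "I r \<in> borel_measurable M" using Im r by auto
    have [measurable]: "(\<lambda>\<omega>. LINT s:{0<..r}|lborel. (H s \<omega>)\<^sup>2) \<in> borel_measurable M"
      unfolding set_lebesgue_integral_def by measurable
    show "(\<lambda>\<omega>. ito_exp \<theta> H I r \<omega> * Y \<omega>) \<in> borel_measurable M"
      unfolding ito_exp_def by measurable
    show "AE \<omega> in M. (\<lambda>n. step_exp \<theta> (p (q n)) (C (q n)) (k (q n)) \<omega> * Y \<omega>) \<longlonglongrightarrow> ito_exp \<theta> H I r \<omega> * Y \<omega>"
      using Z_lim[OF k r J] by eventually_elim (intro tendsto_intros)
    fix n
    have [measurable]: "step_exp \<theta> (p (q n)) (C (q n)) (k (q n)) \<in> borel_measurable M"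
      using step_exp_measurable[OF stepC k(1)] by (rule measurable_F_M)
    show "(\<lambda>\<omega>. step_exp \<theta> (p (q n)) (C (q n)) (k (q n)) \<omega> * Y \<omega>) \<in> borel_measurable M" by measurable
    show "0 \<le> step_exp \<theta> (p (q n)) (C (q n)) (k (q n)) \<omega> * Y \<omega>" for \<omega>
      using Y by (simp add: step_exp_def)
    have "(\<integral>\<^sup>+ \<omega>. ennreal ((step_exp \<theta> (p (q n)) (C (q n)) (k (q n)) \<omega> * Y \<omega>)\<^sup>2) \<partial>M)
        \<le> (\<integral>\<^sup>+ \<omega>. ennreal ((step_exp \<theta> (p (q n)) (C (q n)) (k (q n)) \<omega>)\<^sup>2) \<partial>M)"
      using Y by (intro nn_integral_mono ennreal_leI) (auto simp: power_mult_distrib mult_left_le power_le_one)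
    also have "\<dots> \<le> ennreal (exp (\<theta>\<^sup>2 * b\<^sup>2 * p (q n) (k (q n))))"
      using clip by (intro step_exp_square_bound[OF stepC k(1)]) (auto simp: C_def)
    finally show "(\<integral>\<^sup>+ \<omega>. ennreal ((step_exp \<theta> (p (q n)) (C (q n)) (k (q n)) \<omega> * Y \<omega>)\<^sup>2) \<partial>M)
        \<le> ennreal (exp (\<theta>\<^sup>2 * b\<^sup>2 * r))" by (simp add: k(2))
  qed
  have "(\<integral>\<^sup>+ \<omega>. ennreal (step_exp \<theta> (p n) (C n) (kt n) \<omega> * Y \<omega>) \<partial>M)
      = (\<integral>\<^sup>+ \<omega>. ennreal (step_exp \<theta> (p n) (C n) (ks n) \<omega> * Y \<omega>) \<partial>M)" for n
    using step_exp_martingale[OF stepC ks(1)[of n] kt(1), where Y="\<lambda>\<omega>. ennreal (Y \<omega>)" and \<theta>=\<theta>] Y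
    by (simp add: ks(2) ennreal_mult step_exp_def)
  then show ?thesis
    using E_lim[of kt t] E_lim[of ks s] kt ks ks_m st
    by (intro LIMSEQ_unique[OF E_lim[of kt t] ]) (auto simp: X_def add_increasing add_increasing2)
qed

end

section \<open>Optional stopping\<close>

lemma set_integral_Ioc_lipschitz:
  fixes f :: "real \<Rightarrow> real"
  assumes f: "f \<in> borel_measurable borel" "\<And>s. \<bar>f s\<bar> \<le> B" and st: "0 \<le> s" "s \<le> t"
  shows "\<bar>(LINT r:{0<..t}|lborel. f r) - (LINT r:{0<..s}|lborel. f r)\<bar> \<le> B * (t - s)"
proof -
  have int: "set_integrable lborel {0<..t} f" by (rule set_integrable_bounded[OF f])
  have sub: "{0<..t} = {0<..s} \<union> {s<..t}" using st by auto
  have int': "set_integrable lborel {0<..s} f" "set_integrable lborel {s<..t} f"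
    using st by (auto intro: set_integrable_subset[OF int])
  have "(LINT r:{0<..t}|lborel. f r) = (LINT r:{0<..s}|lborel. f r) + (LINT r:{s<..t}|lborel. f r)"
    unfolding sub by (rule set_integral_Un[OF _ int']) auto
  then have "\<bar>(LINT r:{0<..t}|lborel. f r) - (LINT r:{0<..s}|lborel. f r)\<bar> = \<bar>LINT r:{s<..t}|lborel. f r\<bar>"
    by simp
  also have "\<dots> \<le> (LINT r:{s<..t}|lborel. \<bar>f r\<bar>)"
    using set_integral_norm_bound[OF int'(2)] by simp
  also have "\<dots> \<le> (LINT r:{s<..t}|lborel. B)"
    using f(2) int'(2) st by (intro set_integral_mono set_integrable_abs) (auto simp: set_integrable_def)
  also have "\<dots> = B * (t - s)"
    using st by (simp add: set_integral_const)
  finally show ?thesis .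
qed

lemma continuous_on_set_integral_Ioc:
  fixes f :: "real \<Rightarrow> real"
  assumes f: "f \<in> borel_measurable borel" "\<And>s. \<bar>f s\<bar> \<le> B"
  shows "continuous_on {0..} (\<lambda>t. LINT s:{0<..t}|lborel. f s)"
proof -
  have "dist (LINT r:{0<..s}|lborel. f r) (LINT r:{0<..t}|lborel. f r) \<le> B * dist s t"
    if "s \<in> {0..}" "t \<in> {0..}" for s t
    using set_integral_Ioc_lipschitz[OF f, of s t] set_integral_Ioc_lipschitz[OF f, of t s] that
    by (cases "s \<le> t") (auto simp: dist_real_def abs_minus_commute)
  moreover have "0 \<le> B" using f(2)[of 0] by (rule order_trans[OF abs_ge_zero])
  ultimately have "B-lipschitz_on {0..} (\<lambda>t. LINT s:{0<..t}|lborel. f s)"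
    by (rule lipschitz_onI)
  then show ?thesis by (rule lipschitz_on_continuous_on)
qed

text \<open>The weights with which a time \<open>\<tau> \<le> T\<close>, rounded up to the grid of mesh \<open>T / N\<close>, hits the
  individual grid points.\<close>

definition grid_weight :: "real \<Rightarrow> nat \<Rightarrow> ennreal \<Rightarrow> real \<Rightarrow> nat \<Rightarrow> real" where
  "grid_weight T N \<tau> d k =
     d * of_bool (\<tau> \<le> ennreal (T * k / N)) -
     (if k = 0 then 0 else d * of_bool (\<tau> \<le> ennreal (T * real (k - 1) / N)))"

lemma grid_weight_bounds:
  assumes "0 \<le> d" "d \<le> 1" "0 \<le> T"
  shows "0 \<le> grid_weight T N \<tau> d k" "grid_weight T N \<tau> d k \<le> 1"
proof -
  have "ennreal (T * real (k - 1) / N) \<le> ennreal (T * k / N)"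
    using assms by (intro ennreal_leI divide_right_mono mult_left_mono) auto
  then have "\<tau> \<le> ennreal (T * real (k - 1) / N) \<Longrightarrow> \<tau> \<le> ennreal (T * k / N)"
    by (rule order_trans[rotated])
  then show "0 \<le> grid_weight T N \<tau> d k" "grid_weight T N \<tau> d k \<le> 1"
    using assms by (auto simp: grid_weight_def)
qed

lemma grid_weight_eq_0:
  assumes "\<not> \<tau> \<le> ennreal T" "0 \<le> T" "k \<le> N" "0 < N"
  shows "grid_weight T N \<tau> d k = 0"
proof -
  have *: "\<not> \<tau> \<le> ennreal (T * real j / N)" if "j \<le> N" for j
  proof -
    have "T * real j / N \<le> T"
      using that assms by (simp add: divide_le_eq mult_left_mono)
    then show ?thesis using assms(1) ennreal_leI order_trans by blast
  qed
  show ?thesis using *[of k] *[of "k - 1"] assms(3) unfolding grid_weight_def by (cases k) auto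
qed

text \<open>The whole weight sits at the least grid point that is not before \<open>\<tau>\<close>;
  its minimality places it within one mesh width of \<open>\<tau>\<close>.\<close>

lemma grid_weight_single:
  assumes \<tau>: "\<tau> \<le> ennreal T" and T: "0 \<le> T" and N: "0 < N"
  shows "\<exists>k\<le>N. enn2real \<tau> \<le> T * real k / N \<and> T * real k / N \<le> enn2real \<tau> + T / N \<and>
    (\<forall>j. grid_weight T N \<tau> d j = (if j = k then d else 0))"
proof -
  define r where "r = enn2real \<tau>"
  have "\<tau> < \<infinity>" using \<tau> by (rule order_le_less_trans) simp
  then have \<tau>_eq: "\<tau> = ennreal r" and r: "0 \<le> r" by (auto simp: r_def less_top)
  have rT: "r \<le> T" using \<tau> T unfolding \<tau>_eq by (simp add: ennreal_le_iff)
  define P where "P k \<longleftrightarrow> r \<le> T * real k / N" for k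
  have P_iff: "\<tau> \<le> ennreal (T * real k / N) \<longleftrightarrow> P k" for k
    using T unfolding \<tau>_eq P_def by (simp add: ennreal_le_iff)
  have PN: "P N" using N rT by (simp add: P_def)
  define k where "k = (LEAST k. P k)"
  have Pk: "P k" unfolding k_def by (rule LeastI[of P, OF PN])
  have kN: "k \<le> N" unfolding k_def by (rule Least_le[of P, OF PN])
  have lt: "\<not> P j" if "j < k" for j using not_less_Least[of j P] that by (simp add: k_def)
  have ge: "P j" if "k \<le> j" for j
  proof -
    have "T * real k / N \<le> T * real j / N" using that T by (intro divide_right_mono mult_left_mono) auto
    then show ?thesis using Pk unfolding P_def by linarith
  qed
  have P_all: "P j \<longleftrightarrow> k \<le> j" for j using lt[of j] ge[of j] by (meson not_less)
  have "T * real k / N \<le> r + T / N"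
  proof (cases k)
    case 0
    then show ?thesis using r T by simp
  next
    case (Suc i)
    then have "T * real i / N < r" using lt[of i] by (simp add: P_def)
    then show ?thesis using Suc by (simp add: field_simps add_divide_distrib)
  qed
  moreover have "grid_weight T N \<tau> d j = (if j = k then d else 0)" for j
    unfolding grid_weight_def P_iff P_all by (cases j) auto
  ultimately show ?thesis using Pk kN unfolding P_def r_def by auto
qed

locale bounded_ito_integral = brownian_filtration +
  fixes H I :: "real \<Rightarrow> 'a \<Rightarrow> real" and b :: real
  assumes ito: "is_ito_integral M F w H I"
    and H_measurable: "(\<lambda>(s, \<omega>). H s \<omega>) \<in> borel_measurable (borel \<Otimes>\<^sub>M M)"
    and H_nonneg: "\<omega> \<in> space M \<Longrightarrow> 0 \<le> H s \<omega>"
    and H_le: "\<omega> \<in> space M \<Longrightarrow> H s \<omega> \<le> b"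
    and b_nonneg: "0 \<le> b"
begin

lemma I_measurable: "0 \<le> t \<Longrightarrow> I t \<in> borel_measurable M"
  using ito by (simp add: is_ito_integral_def)

lemma H_section: "\<omega> \<in> space M \<Longrightarrow> (\<lambda>s. H s \<omega>) \<in> borel_measurable borel"
  using measurable_compose[OF measurable_Pair2' H_measurable] by simp

lemma H_square_bound: "\<omega> \<in> space M \<Longrightarrow> \<bar>(H s \<omega>)\<^sup>2\<bar> \<le> b\<^sup>2"
  using H_nonneg[of \<omega> s] H_le[of \<omega> s] b_nonneg by (auto simp: abs_le_square_iff[symmetric])

lemma ito_exp_measurable:
  assumes "0 \<le> t"
  shows "ito_exp \<theta> H I t \<in> borel_measurable M"
proof -
  note [measurable] = I_measurable[OF assms] H_measurable
  have [measurable]: "(\<lambda>\<omega>. LINT s:{0<..t}|lborel. (H s \<omega>)\<^sup>2) \<in> borel_measurable M"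
    unfolding set_lebesgue_integral_def by measurable
  show ?thesis unfolding ito_exp_def by measurable
qed

lemma ito_exp_martingale:
  assumes "0 \<le> s" "s \<le> t"
    and "Y \<in> borel_measurable (F (ennreal s))" "\<And>\<omega>. 0 \<le> Y \<omega>" "\<And>\<omega>. Y \<omega> \<le> 1"
  shows "(\<integral>\<^sup>+ \<omega>. ennreal (ito_exp \<theta> H I t \<omega> * Y \<omega>) \<partial>M) = (\<integral>\<^sup>+ \<omega>. ennreal (ito_exp \<theta> H I s \<omega> * Y \<omega>) \<partial>M)"
  using ito_exp_martingale_aux[OF ito H_measurable H_nonneg H_le b_nonneg assms(1) _ assms(3-5)] assms(2)
  by (cases "s = t") auto

lemma ito_exp_mean:
  assumes "0 \<le> t"
  shows "(\<integral>\<^sup>+ \<omega>. ennreal (ito_exp \<theta> H I t \<omega>) \<partial>M) = 1"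
proof -
  have "(\<integral>\<^sup>+ \<omega>. ennreal (ito_exp \<theta> H I t \<omega>) \<partial>M) = (\<integral>\<^sup>+ \<omega>. ennreal (ito_exp \<theta> H I 0 \<omega>) \<partial>M)"
    using ito_exp_martingale[of 0 t "\<lambda>_. 1" \<theta>] assms by simp
  also have "\<dots> = (\<integral>\<^sup>+ \<omega>. 1 \<partial>M)"
    using ito_integral_initial[OF ito]
    by (intro nn_integral_cong_AE) (auto simp: ito_exp_def set_lebesgue_integral_def)
  finally show ?thesis by (simp add: emeasure_space_1)
qed

lemma ito_exp_continuous: "AE \<omega> in M. continuous_on {0..} (\<lambda>t. ito_exp \<theta> H I t \<omega>)"
proof -
  have "AE \<omega> in M. continuous_on {0..} (\<lambda>t. I t \<omega>)"
    using ito by (simp add: is_ito_integral_def)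
  then show ?thesis using AE_space
  proof eventually_elim
    case (elim \<omega>)
    have "continuous_on {0..} (\<lambda>t. LINT s:{0<..t}|lborel. (H s \<omega>)\<^sup>2)"
      using H_section[OF elim(2)] H_square_bound[OF elim(2)]
      by (intro continuous_on_set_integral_Ioc[where B="b\<^sup>2"]) auto
    then show ?case unfolding ito_exp_def by (intro continuous_intros elim)
  qed
qed

lemma ito_exp_square_le:
  assumes "0 \<le> t" "t \<le> T" "\<omega> \<in> space M"
  shows "(ito_exp \<theta> H I t \<omega>)\<^sup>2 \<le> exp (\<theta>\<^sup>2 * b\<^sup>2 * T) * ito_exp (2 * \<theta>) H I t \<omega>"
proof -
  let ?Q = "LINT s:{0<..t}|lborel. (H s \<omega>)\<^sup>2"
  have "?Q \<le> b\<^sup>2 * t"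
    using set_integral_Ioc_lipschitz[of "\<lambda>s. (H s \<omega>)\<^sup>2" "b\<^sup>2" 0 t] H_section[OF assms(3)]
      H_square_bound[OF assms(3)] assms(1) by (simp add: set_lebesgue_integral_def)
  also have "\<dots> \<le> b\<^sup>2 * T" using assms by (intro mult_left_mono) auto
  finally have "\<theta>\<^sup>2 * ?Q \<le> \<theta>\<^sup>2 * b\<^sup>2 * T"
    using mult_left_mono[of ?Q "b\<^sup>2 * T" "\<theta>\<^sup>2"] by (simp add: mult.assoc)
  moreover have "(ito_exp \<theta> H I t \<omega>)\<^sup>2 = exp (\<theta>\<^sup>2 * ?Q) * ito_exp (2 * \<theta>) H I t \<omega>"
    by (simp add: ito_exp_def field_simps power2_eq_square flip: exp_add)
  ultimately show ?thesis by (simp add: ito_exp_def)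
qed

text \<open>Rounding \<open>\<tau>\<close> up, not down, makes the weight of each grid point known
  at that point, so the martingale property applies term by term. Path continuity and a uniform
  second moment then allow the mesh to tend to 0. The factor \<open>D\<close> stands for a variable
  known at time \<open>\<tau>\<close>, in the form in which the grid weights use it.\<close>

lemma optional_stopping:
  assumes \<tau>: "stopping_time F \<tau>" and T: "0 \<le> T"
    and D: "\<And>t. (\<lambda>\<omega>. D \<omega> * of_bool (\<tau> \<omega> \<le> t)) \<in> borel_measurable (F t)" "\<And>\<omega>. 0 \<le> D \<omega>" "\<And>\<omega>. D \<omega> \<le> 1"
  shows "(\<integral>\<^sup>+ \<omega>. ennreal (ito_exp \<theta> H I (enn2real (\<tau> \<omega>)) \<omega> * (D \<omega> * of_bool (\<tau> \<omega> \<le> ennreal T))) \<partial>M)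
    = (\<integral>\<^sup>+ \<omega>. ennreal (ito_exp \<theta> H I T \<omega> * (D \<omega> * of_bool (\<tau> \<omega> \<le> ennreal T))) \<partial>M)"
proof -
  define N where "N n = Suc n" for n
  define g where "g n k = T * real k / real (N n)" for n k
  define Y where "Y n k \<omega> = grid_weight T (N n) (\<tau> \<omega>) (D \<omega>) k" for n k \<omega>
  let ?D = "\<lambda>\<omega>. D \<omega> * of_bool (\<tau> \<omega> \<le> ennreal T)"
  have N: "0 < N n" for n by (simp add: N_def)
  have g: "0 \<le> g n k" "k \<le> N n \<Longrightarrow> g n k \<le> T" for n k
    using T N[of n] by (auto simp: g_def divide_le_eq mult_left_mono)
  have Y_01: "0 \<le> Y n k \<omega>" "Y n k \<omega> \<le> 1" for n k \<omega>
    using grid_weight_bounds[OF D(2,3) T] by (auto simp: Y_def)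
  have Y_F: "Y n k \<in> borel_measurable (F (ennreal (g n k)))" for n k
  proof -
    have "(\<lambda>\<omega>. if k = 0 then 0 else D \<omega> * of_bool (\<tau> \<omega> \<le> ennreal (g n (k - 1)))) \<in> borel_measurable (F (ennreal (g n k)))"
    proof (cases "k = 0")
      case False
      have "g n (k - 1) \<le> g n k" using T by (auto simp: g_def intro!: divide_right_mono mult_left_mono)
      then show ?thesis using False measurable_F_mono[OF D(1) ennreal_leI] by simp
    qed simp
    from borel_measurable_diff[OF D(1)[of "ennreal (g n k)"] this] show ?thesis
      unfolding Y_def[abs_def] grid_weight_def g_def .
  qed
  have Y_0: "Y n k \<omega> = 0" if "\<not> \<tau> \<omega> \<le> ennreal T" "k \<le> N n" for n k \<omega>
    unfolding Y_def by (rule grid_weight_eq_0[OF that(1) T that(2) N])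
  have Y_single: "\<exists>k\<le>N n. enn2real (\<tau> \<omega>) \<le> g n k \<and> g n k \<le> enn2real (\<tau> \<omega>) + T / N n \<and>
      (\<forall>j. Y n j \<omega> = (if j = k then D \<omega> else 0))" if "\<tau> \<omega> \<le> ennreal T" for n \<omega>
    using grid_weight_single[OF that T N[of n], of "D \<omega>"] by (simp add: g_def Y_def)
  have sum_single: "(\<Sum>j\<le>N n. f j * Y n j \<omega>) = f k * D \<omega>"
    if "k \<le> N n" "\<And>j. Y n j \<omega> = (if j = k then D \<omega> else 0)" for f :: "nat \<Rightarrow> real" and n k \<omega>
    using that by (simp add: if_distrib[of "(*) _"] sum.delta cong: if_cong)
  have Y_sum: "(\<Sum>k\<le>N n. c * Y n k \<omega>) = c * ?D \<omega>" for n \<omega> and c :: real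
  proof (cases "\<tau> \<omega> \<le> ennreal T")
    case True
    then show ?thesis using Y_single[OF True, of n] sum_single[of _ n \<omega> "\<lambda>_. c"] by auto
  qed (auto simp: Y_0)
  have Ym[measurable]: "Y n k \<in> borel_measurable M" for n k
    using Y_F by (rule measurable_F_M)
  have Zm: "ito_exp \<theta>' H I t \<in> borel_measurable M" if "0 \<le> t" for t \<theta>'
    by (rule ito_exp_measurable[OF that])
  have mart: "(\<Sum>k\<le>N n. \<integral>\<^sup>+ \<omega>. ennreal (ito_exp \<theta>' H I (g n k) \<omega> * Y n k \<omega>) \<partial>M)
      = (\<integral>\<^sup>+ \<omega>. ennreal (ito_exp \<theta>' H I T \<omega> * ?D \<omega>) \<partial>M)" for n \<theta>'
  proof -
    note [measurable] = Zm[OF T]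
    have "(\<Sum>k\<le>N n. \<integral>\<^sup>+ \<omega>. ennreal (ito_exp \<theta>' H I (g n k) \<omega> * Y n k \<omega>) \<partial>M)
      = (\<Sum>k\<le>N n. \<integral>\<^sup>+ \<omega>. ennreal (ito_exp \<theta>' H I T \<omega> * Y n k \<omega>) \<partial>M)"
      using g Y_01 Y_F by (intro sum.cong refl ito_exp_martingale[symmetric]) auto
    also have "\<dots> = (\<integral>\<^sup>+ \<omega>. (\<Sum>k\<le>N n. ennreal (ito_exp \<theta>' H I T \<omega> * Y n k \<omega>)) \<partial>M)"
      by (rule nn_integral_sum[symmetric]) measurable
    also have "\<dots> = (\<integral>\<^sup>+ \<omega>. ennreal (\<Sum>k\<le>N n. ito_exp \<theta>' H I T \<omega> * Y n k \<omega>) \<partial>M)"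
      using Y_01 by (intro nn_integral_cong sum_ennreal) (auto simp: ito_exp_def)
    finally show ?thesis by (simp only: Y_sum)
  qed
  define W where "W n \<omega> = (\<Sum>k\<le>N n. ito_exp \<theta> H I (g n k) \<omega> * Y n k \<omega>)" for n \<omega>
  have Wm[measurable]: "W n \<in> borel_measurable M" for n
  proof -
    note [measurable] = Zm[OF g(1)]
    show ?thesis unfolding W_def by measurable
  qed
  have W_mean: "(\<integral>\<^sup>+ \<omega>. ennreal (W n \<omega>) \<partial>M) = (\<integral>\<^sup>+ \<omega>. ennreal (ito_exp \<theta> H I T \<omega> * ?D \<omega>) \<partial>M)" for n
  proof -
    note [measurable] = Zm[OF g(1)]
    have "(\<integral>\<^sup>+ \<omega>. ennreal (W n \<omega>) \<partial>M) = (\<integral>\<^sup>+ \<omega>. (\<Sum>k\<le>N n. ennreal (ito_exp \<theta> H I (g n k) \<omega> * Y n k \<omega>)) \<partial>M)"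
      unfolding W_def using Y_01 by (intro nn_integral_cong sum_ennreal[symmetric]) (auto simp: ito_exp_def)
    also have "\<dots> = (\<Sum>k\<le>N n. \<integral>\<^sup>+ \<omega>. ennreal (ito_exp \<theta> H I (g n k) \<omega> * Y n k \<omega>) \<partial>M)"
      by (rule nn_integral_sum) measurable
    finally show ?thesis unfolding mart .
  qed
  have W_square: "(\<integral>\<^sup>+ \<omega>. ennreal ((W n \<omega>)\<^sup>2) \<partial>M) \<le> ennreal (exp (\<theta>\<^sup>2 * b\<^sup>2 * T))" for n
  proof -
    note [measurable] = Zm[OF g(1)]
    let ?c = "exp (\<theta>\<^sup>2 * b\<^sup>2 * T)"
    \<comment> \<open>At most one weight is nonzero, so squaring the sum squares a single term. With
      \<open>D\<^sup>2 \<le> D\<close> the result is again a weighted sum of the same kind, for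
      \<open>2 * \<theta>\<close>, and its mean is known from \<open>mart\<close>.\<close>
    have "(W n \<omega>)\<^sup>2 \<le> ?c * (\<Sum>k\<le>N n. ito_exp (2 * \<theta>) H I (g n k) \<omega> * Y n k \<omega>)" if \<omega>: "\<omega> \<in> space M" for \<omega>
    proof (cases "\<tau> \<omega> \<le> ennreal T")
      case True
      from Y_single[OF this, of n] obtain k where k: "k \<le> N n" "\<And>j. Y n j \<omega> = (if j = k then D \<omega> else 0)"
        by auto
      have D2: "(D \<omega>)\<^sup>2 \<le> D \<omega>" using D(2,3)[of \<omega>] by (simp add: power2_eq_square mult_left_le)
      have "(W n \<omega>)\<^sup>2 = (ito_exp \<theta> H I (g n k) \<omega>)\<^sup>2 * (D \<omega>)\<^sup>2"
        unfolding W_def sum_single[OF k] by (rule power_mult_distrib)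
      also have "\<dots> \<le> (?c * ito_exp (2 * \<theta>) H I (g n k) \<omega>) * D \<omega>"
        using g k(1) \<omega> D2 by (intro mult_mono ito_exp_square_le) (auto simp: ito_exp_def)
      finally show ?thesis unfolding sum_single[OF k] by simp
    qed (simp add: W_def Y_0)
    then have "(\<integral>\<^sup>+ \<omega>. ennreal ((W n \<omega>)\<^sup>2) \<partial>M)
        \<le> (\<integral>\<^sup>+ \<omega>. ennreal ?c * (\<Sum>k\<le>N n. ennreal (ito_exp (2 * \<theta>) H I (g n k) \<omega> * Y n k \<omega>)) \<partial>M)"
      using Y_01 by (intro nn_integral_mono)
        (subst sum_ennreal, auto simp: ito_exp_def simp flip: ennreal_mult' intro!: ennreal_leI)
    also have "\<dots> = ennreal ?c * (\<integral>\<^sup>+ \<omega>. ennreal (ito_exp (2 * \<theta>) H I T \<omega> * ?D \<omega>) \<partial>M)"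
      by (subst nn_integral_cmult, measurable, subst nn_integral_sum) (simp_all only: mart, measurable)
    also have "\<dots> \<le> ennreal ?c * (\<integral>\<^sup>+ \<omega>. ennreal (ito_exp (2 * \<theta>) H I T \<omega>) \<partial>M)"
      using D(2,3) by (intro mult_left_mono nn_integral_mono ennreal_leI mult_left_le) (auto simp: ito_exp_def)
    finally show ?thesis by (simp add: ito_exp_mean[OF T])
  qed
  have lim: "AE \<omega> in M. (\<lambda>n. W n \<omega>) \<longlonglongrightarrow> ito_exp \<theta> H I (enn2real (\<tau> \<omega>)) \<omega> * ?D \<omega>"
    using ito_exp_continuous[of \<theta>]
  proof eventually_elim
    case (elim \<omega>)
    show ?case
    proof (cases "\<tau> \<omega> \<le> ennreal T")
      case True
      let ?r = "enn2real (\<tau> \<omega>)"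
      from Y_single[OF True] obtain k where k: "\<And>n. k n \<le> N n" "\<And>n. ?r \<le> g n (k n)" "\<And>n. g n (k n) \<le> ?r + T / N n"
        "\<And>n j. Y n j \<omega> = (if j = k n then D \<omega> else 0)"
        by metis
      have "(\<lambda>n. ?r + T / N n) \<longlonglongrightarrow> ?r + 0"
        unfolding N_def by (intro tendsto_intros lim_const_over_n[THEN LIMSEQ_Suc])
      then have "(\<lambda>n. ?r + T / N n) \<longlonglongrightarrow> ?r" by simp
      then have "(\<lambda>n. g n (k n)) \<longlonglongrightarrow> ?r"
        by (intro tendsto_sandwich[OF _ _ tendsto_const, of "?r" "\<lambda>n. g n (k n)"]) (auto intro: always_eventually k)
      then have "(\<lambda>n. ito_exp \<theta> H I (g n (k n)) \<omega>) \<longlonglongrightarrow> ito_exp \<theta> H I ?r \<omega>"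
        by (intro continuous_on_tendsto_compose[OF elim]) (auto simp: g)
      moreover have "W n \<omega> = ito_exp \<theta> H I (g n (k n)) \<omega> * D \<omega>" for n
        unfolding W_def by (rule sum_single[OF k(1,4)])
      ultimately show ?thesis using True by (simp add: tendsto_mult_right)
    qed (simp add: W_def Y_0)
  qed
  \<comment> \<open>The value at the random time \<open>\<tau>\<close> may fail to be measurable,
    since paths are continuous only almost surely; \<open>lim\<close> of the measurable
    \<open>W n\<close> is a measurable version.\<close>
  have lim': "AE \<omega> in M. lim (\<lambda>n. W n \<omega>) = ito_exp \<theta> H I (enn2real (\<tau> \<omega>)) \<omega> * ?D \<omega>"
    using lim by eventually_elim (rule limI)
  have "(\<lambda>n. \<integral>\<^sup>+ \<omega>. ennreal (W n \<omega>) \<partial>M) \<longlonglongrightarrow> (\<integral>\<^sup>+ \<omega>. ennreal (lim (\<lambda>n. W n \<omega>)) \<partial>M)"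
  proof (rule nn_integral_tendsto_of_square_bound[OF _ _ _ _ W_square])
    show "AE \<omega> in M. (\<lambda>n. W n \<omega>) \<longlonglongrightarrow> lim (\<lambda>n. W n \<omega>)"
      using lim by eventually_elim (auto simp: limI)
    show "0 \<le> W n \<omega>" for n \<omega>
      unfolding W_def using Y_01 by (intro sum_nonneg) (simp add: ito_exp_def)
  qed measurable
  then have "(\<integral>\<^sup>+ \<omega>. ennreal (lim (\<lambda>n. W n \<omega>)) \<partial>M) = (\<integral>\<^sup>+ \<omega>. ennreal (ito_exp \<theta> H I T \<omega> * ?D \<omega>) \<partial>M)"
    unfolding W_mean by (simp add: LIMSEQ_const_iff)
  moreover have "(\<integral>\<^sup>+ \<omega>. ennreal (lim (\<lambda>n. W n \<omega>)) \<partial>M)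
      = (\<integral>\<^sup>+ \<omega>. ennreal (ito_exp \<theta> H I (enn2real (\<tau> \<omega>)) \<omega> * ?D \<omega>) \<partial>M)"
    using lim' by (intro nn_integral_cong_AE) auto
  ultimately show ?thesis by simp
qed

end

section \<open>Lower bound for the cost\<close>

text \<open>If all partial sums stayed below \<open>- u - e\<close>, so would their supremum, up to
  equality. As infinitely many injections may occur by time \<open>T\<close>, a nonnegative surplus
  is reached by finitely many of them only up to \<open>e\<close>.\<close>

lemma suminf_ennreal_ge_imp_partial_sum:
  fixes f :: "nat \<Rightarrow> real"
  assumes f: "\<And>i. 0 \<le> f i" and u: "0 \<le> ereal u + enn2ereal (\<Sum>i. ennreal (f i))" and e: "0 < e"
  shows "\<exists>n. - e \<le> u + (\<Sum>i<n. f i)"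
proof (rule ccontr)
  assume neg: "\<not> ?thesis"
  have less: "(\<Sum>i<n. f i) < - u - e" for n
  proof -
    from neg have "\<not> - e \<le> u + (\<Sum>i<n. f i)" by blast
    then show ?thesis by linarith
  qed
  then have pos: "0 < - u - e" using less[of 0] by simp
  have "(\<Sum>i. ennreal (f i)) = (SUP n. \<Sum>i<n. ennreal (f i))" by (rule suminf_eq_SUP)
  also have "\<dots> \<le> ennreal (- u - e)"
    using f less by (intro SUP_least) (simp add: sum_ennreal less_imp_le ennreal_leI)
  finally have "enn2ereal (\<Sum>i. ennreal (f i)) \<le> enn2ereal (ennreal (- u - e))"
    by (simp add: less_eq_ennreal.rep_eq)
  also have "\<dots> = ereal (- u - e)" using pos by (simp add: enn2ereal_ennreal)
  finally have "ereal u + enn2ereal (\<Sum>i. ennreal (f i)) \<le> ereal u + ereal (- u - e)"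
    by (rule add_left_mono)
  with u have "0 \<le> ereal u + ereal (- u - e)" by (rule order_trans)
  with e show False by simp
qed

text \<open>The integrands \<open>Z\<^sub>\<tau>\<close> below need not be measurable, as no completeness is imposed.\<close>

lemma nn_integral_cmult_le: "c * (\<integral>\<^sup>+ \<omega>. f \<omega> \<partial>M) \<le> (\<integral>\<^sup>+ \<omega>. c * f \<omega> \<partial>M)"
proof -
  have "c * integral\<^sup>S M g \<le> (\<integral>\<^sup>+ \<omega>. c * f \<omega> \<partial>M)" if g: "simple_function M g" "g \<le> f" for g
  proof -
    have "c * integral\<^sup>S M g = (\<integral>\<^sup>+ \<omega>. c * g \<omega> \<partial>M)"
      using g(1) by (simp add: nn_integral_eq_simple_integral borel_measurable_simple_function nn_integral_cmult)
    also have "\<dots> \<le> (\<integral>\<^sup>+ \<omega>. c * f \<omega> \<partial>M)"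
      using g(2) by (intro nn_integral_mono mult_left_mono) (auto simp: le_fun_def)
    finally show ?thesis .
  qed
  then show ?thesis
    unfolding nn_integral_def[of M f] SUP_mult_left_ennreal by (intro SUP_least) auto
qed

text \<open>The preceding inequality, applied with \<open>c\<close> and with \<open>1 / c\<close>,
  gives both directions.\<close>

lemma nn_integral_cmult_not_measurable:
  assumes c: "0 < c"
  shows "(\<integral>\<^sup>+ \<omega>. ennreal c * f \<omega> \<partial>M) = ennreal c * (\<integral>\<^sup>+ \<omega>. f \<omega> \<partial>M)"
proof (rule antisym[OF _ nn_integral_cmult_le])
  have inv: "ennreal (1 / c) * (ennreal c * y) = y" "ennreal c * (ennreal (1 / c) * y) = y" for y
    using c by (simp_all flip: ennreal_mult' mult.assoc)
  have "ennreal (1 / c) * (\<integral>\<^sup>+ \<omega>. ennreal c * f \<omega> \<partial>M) \<le> (\<integral>\<^sup>+ \<omega>. f \<omega> \<partial>M)"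
    using nn_integral_cmult_le[of "ennreal (1 / c)" M "\<lambda>\<omega>. ennreal c * f \<omega>"] by (simp only: inv)
  from mult_left_mono[OF this, of "ennreal c"]
  show "(\<integral>\<^sup>+ \<omega>. ennreal c * f \<omega> \<partial>M) \<le> ennreal c * (\<integral>\<^sup>+ \<omega>. f \<omega> \<partial>M)"
    by (simp only: inv zero_le)
qed

lemma ennreal_le_add_exp_imp_le:
  assumes "\<And>e. 0 < e \<Longrightarrow> a \<le> b + ennreal (exp (A + g * e))"
  shows "a \<le> b + ennreal (exp A)"
proof -
  have lim: "(\<lambda>n. b + ennreal (exp (A + g * (1 / real (Suc n))))) \<longlonglongrightarrow> b + ennreal (exp (A + g * 0))"
    by (intro tendsto_intros lim_const_over_n[THEN LIMSEQ_Suc])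
  have "a \<le> b + ennreal (exp (A + g * (1 / real (Suc n))))" for n
    by (rule assms) simp
  then have "a \<le> b + ennreal (exp (A + g * 0))"
    by (intro LIMSEQ_le_const[OF lim]) blast
  then show ?thesis by simp
qed

text \<open>The generating rectangles of the predictable sigma-algebra are measurable in the
  product. That sigma-algebra lives on positive times, hence the extension by 0.\<close>

lemma predictable_imp_measurable:
  assumes P: "predictable (space M) F u" and F: "\<And>t. sets (F t) \<subseteq> sets M"
  shows "(\<lambda>(s, \<omega>). indicator {0<..} s * u s \<omega>) \<in> borel_measurable (borel \<Otimes>\<^sub>M M)"
proof -
  let ?R = "restrict_space (borel \<Otimes>\<^sub>M M) ({0<..} \<times> space M)"
  let ?G = "{{a<..b} \<times> A |a b A. 0 \<le> a \<and> A \<in> sets (F (ennreal a))}"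
  have G: "?G \<subseteq> Pow ({0<..} \<times> space M)"
    using F sets.sets_into_space[of _ M] by (auto intro: le_less_trans)
  have "(\<lambda>z. z) \<in> measurable ?R (predictable_sigma (space M) F)"
    unfolding predictable_sigma_def
  proof (rule measurable_measure_of[OF G])
    show "(\<lambda>z. z) -` Z \<inter> space ?R \<in> sets ?R" if Z: "Z \<in> ?G" for Z
    proof -
      obtain a b A where "Z = {a<..b} \<times> A" "0 \<le> a" "A \<in> sets (F (ennreal a))" using Z by auto
      then have "Z \<in> sets (borel \<Otimes>\<^sub>M M)" using F by (auto intro!: pair_measureI)
      moreover have "Z \<subseteq> {0<..} \<times> space M" using G Z by auto
      ultimately show ?thesis
        by (subst sets_restrict_space_iff) (auto simp: space_restrict_space space_pair_measure)
    qed
  qed (auto simp: space_restrict_space)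
  then have "(\<lambda>(s, \<omega>). u s \<omega>) \<in> borel_measurable ?R"
    using P unfolding predictable_def by (rule measurable_compose[of "\<lambda>z. z"])
  then have "(\<lambda>z. indicator ({0<..} \<times> space M) z *\<^sub>R (case z of (s, \<omega>) \<Rightarrow> u s \<omega>)) \<in> borel_measurable (borel \<Otimes>\<^sub>M M)"
    by (subst (asm) borel_measurable_restrict_space_iff) (auto simp: space_pair_measure)
  then show ?thesis
    by (rule measurable_cong[THEN iffD1, rotated]) (auto simp: space_pair_measure indicator_def)
qed

text \<open>Brings variables known at time \<open>\<tau>\<close> into the form that
  \<open>optional_stopping\<close> asks of \<open>D\<close>.\<close>

lemma (in filtration) measurable_pre_sigma_times_of_bool:
  fixes f :: "'a \<Rightarrow> real"
  assumes \<tau>: "stopping_time F \<tau>" and f: "f \<in> borel_measurable (pre_sigma \<tau>)"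
  shows "(\<lambda>\<omega>. f \<omega> * of_bool (\<tau> \<omega> \<le> t)) \<in> borel_measurable (F t)"
proof (rule measurableI)
  fix B :: "real set" assume B: "B \<in> sets borel"
  have 1: "{\<omega> \<in> f -` B \<inter> \<Omega>. \<tau> \<omega> \<le> t} \<in> sets (F t)"
    using measurable_sets[OF f B] by (intro sets_pre_sigmaD[OF \<tau>]) (simp add: space_pre_sigma)
  have 2: "{\<omega> \<in> space (F t). \<tau> \<omega> \<le> t} \<in> sets (F t)"
    using stopping_timeD[OF \<tau>] by (simp add: pred_def)
  have "(\<lambda>\<omega>. f \<omega> * of_bool (\<tau> \<omega> \<le> t)) -` B \<inter> space (F t)
    = {\<omega> \<in> f -` B \<inter> \<Omega>. \<tau> \<omega> \<le> t} \<union> (if 0 \<in> B then space (F t) - {\<omega> \<in> space (F t). \<tau> \<omega> \<le> t} else {})"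
    by (auto simp: space_F of_bool_def split: if_splits)
  also have "\<dots> \<in> sets (F t)" using 1 2 by auto
  finally show "(\<lambda>\<omega>. f \<omega> * of_bool (\<tau> \<omega> \<le> t)) -` B \<inter> space (F t) \<in> sets (F t)" .
qed simp

text \<open>For \<open>V x = \<eta> * exp (- \<gamma> * x)\<close>, the assumption
  \<open>\<gamma>_root\<close> is the equation
  \<open>\<sigma>\<^sup>2 / 2 * V'' + (\<mu> - \<delta>) * V' = r * V\<close> of full retention. The
  equation \<open>\<eta>_root\<close> turns into the balance
  \<open>V 0 = V \<xi> + K + c * \<xi>\<close>.\<close>

locale injection_problem = brownian_filtration +
  fixes \<mu> \<sigma> \<delta> r K c \<gamma> \<eta> :: real
  assumes pos: "0 < \<mu>" "0 < \<sigma>" "0 < r" "0 < K" "0 < c" "0 < \<gamma>"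
    and \<gamma>_root: "\<sigma>\<^sup>2 / 2 * \<gamma>\<^sup>2 = (\<mu> - \<delta>) * \<gamma> + r"
    and \<gamma>_le: "\<sigma>\<^sup>2 * \<gamma> \<le> \<mu>"
    and \<eta>_gt: "c / \<gamma> < \<eta>"
    and \<eta>_root: "K + c / \<gamma> * ln (\<eta> * \<gamma> / c) + c / \<gamma> - \<eta> = 0"
begin

text \<open>The size at which the marginal decrease
  \<open>\<eta> * \<gamma> * exp (- \<gamma> * \<xi>)\<close> of the value equals the marginal cost
  \<open>c\<close>.\<close>

definition \<xi> :: real where "\<xi> = 1 / \<gamma> * ln (\<eta> * \<gamma> / c)"

lemma \<eta>_pos: "0 < \<eta>"
  using \<eta>_gt pos by (meson divide_pos_pos less_trans)

lemma \<xi>_pos: "0 < \<xi>"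
proof -
  have "1 < \<eta> * \<gamma> / c" using \<eta>_gt pos by (simp add: field_simps)
  then show ?thesis using pos by (simp add: \<xi>_def)
qed

lemma exp_\<xi>: "exp (- \<gamma> * \<xi>) = c / (\<eta> * \<gamma>)"
  using pos \<eta>_pos by (simp add: \<xi>_def exp_minus)

lemma K_eq: "K + c * \<xi> = \<eta> - c / \<gamma>"
  using \<eta>_root by (simp add: \<xi>_def)

text \<open>The left side is concave in \<open>y\<close> and the cost is its tangent at
  \<open>\<xi>\<close>: the slopes agree by \<open>exp_\<xi>\<close>, the values by
  \<open>K_eq\<close>. What remains is the tangent inequality of the exponential function.\<close>

lemma injection_cost_ge: "\<eta> * (1 - exp (- \<gamma> * y)) \<le> K + c * y"
proof -
  have "1 + - \<gamma> * (y - \<xi>) \<le> exp (- \<gamma> * (y - \<xi>))" by (rule exp_ge_add_one_self)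
  then have "c / \<gamma> * (1 + - \<gamma> * (y - \<xi>)) \<le> c / \<gamma> * exp (- \<gamma> * (y - \<xi>))"
    using pos by (intro mult_left_mono) auto
  also have "\<dots> = \<eta> * (c / (\<eta> * \<gamma>) * exp (- \<gamma> * (y - \<xi>)))"
    using \<eta>_pos by simp
  also have "\<dots> = \<eta> * exp (- \<gamma> * y)"
    unfolding exp_\<xi>[symmetric] by (simp add: algebra_simps flip: exp_add)
  finally show ?thesis using K_eq pos by (simp add: algebra_simps)
qed

end

section \<open>An arbitrary control and its exponential martingale\<close>

locale controlled_surplus = injection_problem +
  fixes x :: real and p :: "'a control" and I :: "real \<Rightarrow> 'a \<Rightarrow> real"
  assumes x_nonneg: "0 \<le> x"
    and control: "is_control M F p"
    and noise: "noise_integral M F w \<sigma> p I"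
begin

abbreviation U :: "real \<Rightarrow> 'a \<Rightarrow> real" where
  "U \<equiv> uninjected_surplus \<mu> \<delta> x p I"

text \<open>A control restricts the retention at positive times only; extended by 0 it is bounded
  and jointly measurable on all of the time axis.\<close>

definition u :: "real \<Rightarrow> 'a \<Rightarrow> real" where
  "u s \<omega> = indicator {0<..} s * retention p s \<omega>"

lemma u_bounds: "\<omega> \<in> space M \<Longrightarrow> 0 \<le> u s \<omega>" "\<omega> \<in> space M \<Longrightarrow> u s \<omega> \<le> 1"
  using control by (auto simp: u_def is_control_def indicator_def)

lemma sets_F_M: "sets (F t) \<subseteq> sets M"
  using filtered by (auto simp: filtered_prob_space_def subalgebra_def)

lemma u_measurable: "(\<lambda>(s, \<omega>). u s \<omega>) \<in> borel_measurable (borel \<Otimes>\<^sub>M M)"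
  unfolding u_def using control sets_F_M
  by (intro predictable_imp_measurable[of M F]) (auto simp: is_control_def)

lemma u_section: "\<omega> \<in> space M \<Longrightarrow> (\<lambda>s. u s \<omega>) \<in> borel_measurable borel"
  using measurable_compose[OF measurable_Pair2' u_measurable] by simp

sublocale bounded_ito_integral M F w "\<lambda>s \<omega>. \<sigma> * u s \<omega>" I \<sigma>
proof
  have "(\<integral>\<^sup>+ s\<in>{0<..T}. ennreal ((simple_value S s \<omega> - \<sigma> * retention p s \<omega>)\<^sup>2) \<partial>lborel)
     = (\<integral>\<^sup>+ s\<in>{0<..T}. ennreal ((simple_value S s \<omega> - \<sigma> * u s \<omega>)\<^sup>2) \<partial>lborel)" for S T \<omega>
    by (intro nn_integral_cong) (auto simp: u_def indicator_def)
  then show "is_ito_integral M F w (\<lambda>s \<omega>. \<sigma> * u s \<omega>) I"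
    using noise unfolding is_ito_integral_def by simp
  note [measurable] = u_measurable
  show "(\<lambda>(s, \<omega>). \<sigma> * u s \<omega>) \<in> borel_measurable (borel \<Otimes>\<^sub>M M)" by measurable
qed (use u_bounds pos in \<open>auto intro: mult_left_le\<close>)

lemma u_integrable:
  assumes "\<omega> \<in> space M"
  shows "set_integrable lborel {0<..t} (\<lambda>s. u s \<omega>)" "set_integrable lborel {0<..t} (\<lambda>s. (u s \<omega>)\<^sup>2)"
  using u_section[OF assms] u_bounds[OF assms]
  by (auto intro!: set_integrable_bounded[where B=1] simp: power_le_one)

lemma U_eq:
  assumes "\<omega> \<in> space M" "0 \<le> t"
  shows "U t \<omega> = x + (\<mu> * (LINT s:{0<..t}|lborel. u s \<omega>) - \<delta> * t) + I t \<omega>"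
proof -
  have "(LINT s:{0<..t}|lborel. \<mu> * retention p s \<omega> - \<delta>) = (LINT s:{0<..t}|lborel. \<mu> * u s \<omega> - \<delta>)"
    by (intro set_lebesgue_integral_cong) (auto simp: u_def)
  also have "\<dots> = \<mu> * (LINT s:{0<..t}|lborel. u s \<omega>) - \<delta> * t"
    using u_integrable[OF assms(1), of t] assms(2)
    by (subst set_integral_diff) (auto simp: set_integral_const intro!: set_integrable_bounded[where B="\<bar>\<delta>\<bar>"])
  finally show ?thesis by (simp add: uninjected_surplus_def)
qed

lemma U_continuous: "AE \<omega> in M. continuous_on {0..} (\<lambda>t. U t \<omega>)"
proof -
  have "AE \<omega> in M. continuous_on {0..} (\<lambda>t. I t \<omega>)"
    using noise by (simp add: is_ito_integral_def)
  then show ?thesis using AE_space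
  proof eventually_elim
    case (elim \<omega>)
    have "continuous_on {0..} (\<lambda>t. LINT s:{0<..t}|lborel. u s \<omega>)"
      using u_section[OF elim(2)] u_bounds[OF elim(2)]
      by (intro continuous_on_set_integral_Ioc[where B=1]) auto
    then have "continuous_on {0..} (\<lambda>t. x + (\<mu> * (LINT s:{0<..t}|lborel. u s \<omega>) - \<delta> * t) + I t \<omega>)"
      by (intro continuous_intros elim)
    then show ?case
      by (rule continuous_on_cong[THEN iffD1, rotated -1]) (auto simp: U_eq elim)
  qed
qed

lemma U_initial: "AE \<omega> in M. U 0 \<omega> = x"
  using ito_integral_initial[OF noise]
  by eventually_elim (simp add: uninjected_surplus_def set_lebesgue_integral_def)

abbreviation Z :: "real \<Rightarrow> 'a \<Rightarrow> real" where
  "Z \<equiv> ito_exp (- \<gamma>) (\<lambda>s \<omega>. \<sigma> * u s \<omega>) I"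

text \<open>Full retention minimises the drift of \<open>exp (- r t - \<gamma> U\<^sub>t)\<close>, and the minimum is \<open>0\<close>.\<close>

lemma drift_nonneg:
  assumes "0 \<le> v" "v \<le> 1"
  shows "r - \<gamma> * \<delta> \<le> \<sigma>\<^sup>2 / 2 * \<gamma>\<^sup>2 * v\<^sup>2 - \<gamma> * \<mu> * v"
proof -
  have "\<sigma>\<^sup>2 * \<gamma> * (1 + v) \<le> \<sigma>\<^sup>2 * \<gamma> * 2"
    using pos assms by (intro mult_left_mono) auto
  also have "\<dots> \<le> 2 * \<mu>" using \<gamma>_le by simp
  \<comment> \<open>The drift at \<open>v\<close> minus the drift at \<open>1\<close>, with the root
    \<open>v = 1\<close> factored out.\<close>
  finally have "0 \<le> \<gamma> * (1 - v) * (\<mu> - \<sigma>\<^sup>2 * \<gamma> * (1 + v) / 2)"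
    using pos assms by (intro mult_nonneg_nonneg) auto
  also have "\<dots> = \<gamma> * \<mu> - \<gamma> * \<mu> * v - \<sigma>\<^sup>2 / 2 * \<gamma>\<^sup>2 + \<sigma>\<^sup>2 / 2 * \<gamma>\<^sup>2 * v\<^sup>2"
    by (simp add: field_simps power2_eq_square)
  also have "\<dots> = \<gamma> * \<delta> - r - \<gamma> * \<mu> * v + \<sigma>\<^sup>2 / 2 * \<gamma>\<^sup>2 * v\<^sup>2"
    unfolding \<gamma>_root by (simp add: algebra_simps)
  finally show ?thesis by linarith
qed

text \<open>This is \<open>drift_nonneg\<close> integrated over time; the quotient of the right side
  by the left is the factor \<open>A\<close> of the overview.\<close>

lemma Z_le:
  assumes \<omega>: "\<omega> \<in> space M" and t: "0 \<le> t"
  shows "exp (- \<gamma> * x) * Z t \<omega> \<le> exp (- r * t - \<gamma> * U t \<omega>)"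
proof -
  let ?L = "LINT s:{0<..t}|lborel. u s \<omega>" and ?Q = "LINT s:{0<..t}|lborel. (u s \<omega>)\<^sup>2"
  have "(LINT s:{0<..t}|lborel. r - \<gamma> * \<delta>) \<le> (LINT s:{0<..t}|lborel. \<sigma>\<^sup>2 / 2 * \<gamma>\<^sup>2 * (u s \<omega>)\<^sup>2 - \<gamma> * \<mu> * u s \<omega>)"
  proof (rule set_integral_mono)
    show "set_integrable lborel {0<..t} (\<lambda>s. r - \<gamma> * \<delta>)"
      by (rule set_integrable_bounded[where B="\<bar>r - \<gamma> * \<delta>\<bar>"]) auto
    show "set_integrable lborel {0<..t} (\<lambda>s. \<sigma>\<^sup>2 / 2 * \<gamma>\<^sup>2 * (u s \<omega>)\<^sup>2 - \<gamma> * \<mu> * u s \<omega>)"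
      by (intro set_integral_diff(1) set_integrable_mult_right u_integrable[OF \<omega>])
  qed (rule drift_nonneg[OF u_bounds[OF \<omega>]])
  also have "\<dots> = \<sigma>\<^sup>2 / 2 * \<gamma>\<^sup>2 * ?Q - \<gamma> * \<mu> * ?L"
    using u_integrable[OF \<omega>, of t] by (subst set_integral_diff) auto
  finally have "(r - \<gamma> * \<delta>) * t \<le> \<sigma>\<^sup>2 / 2 * \<gamma>\<^sup>2 * ?Q - \<gamma> * \<mu> * ?L"
    using t by (simp add: set_integral_const mult.commute)
  then have "- \<gamma> * x + (- \<gamma> * I t \<omega> - \<gamma>\<^sup>2 / 2 * (\<sigma>\<^sup>2 * ?Q)) \<le> - r * t - \<gamma> * U t \<omega>"
    unfolding U_eq[OF \<omega> t] by (simp add: algebra_simps)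
  then show ?thesis
    by (simp add: ito_exp_def power_mult_distrib flip: exp_add)
qed

section \<open>Injections and the cost inequality\<close>

abbreviation injected :: "nat \<Rightarrow> 'a \<Rightarrow> real" where
  "injected i \<omega> \<equiv> \<Sum>j<i. inj_size p j \<omega>"

lemma inj_time_mono: "\<omega> \<in> space M \<Longrightarrow> i \<le> j \<Longrightarrow> inj_time p i \<omega> \<le> inj_time p j \<omega>"
  using control lift_Suc_mono_le[of "\<lambda>i. inj_time p i \<omega>" i j] by (simp add: is_control_def)

lemma inj_size_pos: "\<omega> \<in> space M \<Longrightarrow> 0 < inj_size p i \<omega>"
  using control by (auto simp: is_control_def)

lemma inj_time_stopping: "stopping_time F (inj_time p i)"
  using control by (auto simp: is_control_def)

lemma inj_time_measurable: "inj_time p i \<in> borel_measurable M"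
  using sets_F_M by (intro measurable_stopping_time[OF inj_time_stopping]) (auto simp: space_F)

text \<open>The bound \<open>Suc k\<close> includes the injection number \<open>k\<close> itself, so
  that the totals just before and just after it are both known at its time.\<close>

lemma injected_measurable:
  assumes "i \<le> Suc k"
  shows "injected i \<in> borel_measurable (pre_sigma (inj_time p k))"
proof (intro borel_measurable_sum)
  fix j assume "j \<in> {..<i}"
  with assms have "sets (pre_sigma (inj_time p j)) \<subseteq> sets (pre_sigma (inj_time p k))"
    by (intro mono_pre_sigma inj_time_stopping inj_time_mono) auto
  moreover have "inj_size p j \<in> borel_measurable (pre_sigma (inj_time p j))"
    using control by (auto simp: is_control_def)
  ultimately show "inj_size p j \<in> borel_measurable (pre_sigma (inj_time p k))"
    by (auto simp: measurable_def space_pre_sigma)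
qed

lemma inj_size_measurable: "inj_size p i \<in> borel_measurable M"
proof -
  have "sets (pre_sigma (inj_time p i)) \<subseteq> sets (F \<infinity>)"
    using sets_pre_sigmaD[OF inj_time_stopping, of _ i \<infinity>] by fastforce
  then have "sets (pre_sigma (inj_time p i)) \<subseteq> sets M" using sets_F_M by blast
  then show ?thesis
    using control by (auto simp: is_control_def measurable_def space_pre_sigma)
qed

text \<open>Admissibility speaks of the surplus after injections, while here the injection number
  \<open>i\<close> is still left out. At times before \<open>t\<close> at most the first
  \<open>i\<close> injections have been made, so the inequality holds there and passes to
  \<open>t\<close> by continuity. At \<open>t = 0\<close> no earlier time exists and the initial
  surplus takes over.\<close>

lemma surplus_at_injection_nonneg:
  assumes \<omega>: "\<omega> \<in> space M" and U0: "U 0 \<omega> = x" and cont: "continuous_on {0..} (\<lambda>t. U t \<omega>)"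
    and surplus: "\<And>t. 0 \<le> t \<Longrightarrow> 0 \<le> surplus \<mu> \<delta> x p I t \<omega>"
    and \<tau>: "inj_time p i \<omega> = ennreal t" "0 \<le> t"
  shows "0 \<le> U t \<omega> + injected i \<omega>"
proof (cases "t = 0")
  case True
  then show ?thesis using U0 x_nonneg inj_size_pos[OF \<omega>] by (simp add: add_nonneg_nonneg sum_nonneg less_imp_le)
next
  case False
  have before: "0 \<le> U s \<omega> + injected i \<omega>" if s: "0 \<le> s" "s < t" for s
  proof -
    have j: "j < i" if "inj_time p j \<omega> \<le> ennreal s" for j
    proof (rule ccontr)
      assume "\<not> j < i"
      then have "ennreal t \<le> inj_time p j \<omega>" using inj_time_mono[OF \<omega>, of i j] \<tau> by simp
      with that have "ennreal t \<le> ennreal s" by (rule order_trans[rotated])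
      then show False using s by (simp add: ennreal_le_iff)
    qed
    have "(\<Sum>j. if inj_time p j \<omega> \<le> ennreal s then ennreal (inj_size p j \<omega>) else 0)
      = (\<Sum>j<i. if inj_time p j \<omega> \<le> ennreal s then ennreal (inj_size p j \<omega>) else 0)"
      using j by (intro suminf_finite) auto
    also have "\<dots> \<le> (\<Sum>j<i. ennreal (inj_size p j \<omega>))"
      by (intro sum_mono) auto
    also have "\<dots> = ennreal (injected i \<omega>)"
      using inj_size_pos[OF \<omega>] by (intro sum_ennreal) (simp add: less_imp_le)
    finally have "enn2ereal (\<Sum>j. if inj_time p j \<omega> \<le> ennreal s then ennreal (inj_size p j \<omega>) else 0)
      \<le> enn2ereal (ennreal (injected i \<omega>))" by (simp add: less_eq_ennreal.rep_eq)
    also have "\<dots> = ereal (injected i \<omega>)"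
      using inj_size_pos[OF \<omega>] by (intro enn2ereal_ennreal sum_nonneg) (simp add: less_imp_le)
    finally have "surplus \<mu> \<delta> x p I s \<omega> \<le> ereal (U s \<omega>) + ereal (injected i \<omega>)"
      unfolding surplus_def by (rule add_left_mono)
    then have "0 \<le> ereal (U s \<omega>) + ereal (injected i \<omega>)"
      using surplus[OF s(1)] by (rule order_trans[rotated])
    then show ?thesis by simp
  qed
  define s where "s n = t - t / real (Suc n)" for n
  have s: "0 \<le> s n" "s n < t" for n
    using False \<tau>(2) by (auto simp: s_def field_simps)
  have "s \<longlonglongrightarrow> t - 0"
    unfolding s_def by (intro tendsto_intros lim_const_over_n[THEN LIMSEQ_Suc])
  then have "(\<lambda>n. U (s n) \<omega>) \<longlonglongrightarrow> U t \<omega>"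
    using s \<tau>(2) by (intro continuous_on_tendsto_compose[OF cont]) auto
  then have "(\<lambda>n. U (s n) \<omega> + injected i \<omega>) \<longlonglongrightarrow> U t \<omega> + injected i \<omega>"
    by (intro tendsto_intros)
  then show ?thesis
    using before[OF s] by (intro LIMSEQ_le_const) auto
qed

text \<open>The quantity \<open>D\<^sub>i\<close> of the overview: the decrease of the value by
  injection \<open>i\<close>, freed of the factor
  \<open>\<eta> * exp (- \<gamma> * U)\<close>.\<close>

definition V_decrement :: "nat \<Rightarrow> 'a \<Rightarrow> real" where
  "V_decrement i \<omega> = exp (- \<gamma> * injected i \<omega>) - exp (- \<gamma> * injected (Suc i) \<omega>)"

lemma control_cost_eq:
  "control_cost M r K c p = (\<Sum>i. \<integral>\<^sup>+ \<omega>. (if inj_time p i \<omega> < \<infinity>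
      then ennreal (exp (- r * enn2real (inj_time p i \<omega>)) * (K + c * inj_size p i \<omega>)) else 0) \<partial>M)"
proof -
  note [measurable] = inj_time_measurable inj_size_measurable
  show ?thesis unfolding control_cost_def by (rule nn_integral_suminf) measurable
qed

lemma control_cost_ge:
  assumes surplus: "AE \<omega> in M. \<forall>t\<ge>0. 0 \<le> surplus \<mu> \<delta> x p I t \<omega>" and T: "0 \<le> T"
  shows "ennreal (\<eta> * exp (- \<gamma> * x)) \<le> control_cost M r K c p + ennreal (\<eta> * exp (- r * T))"
proof -
  let ?\<tau> = "inj_time p"
  let ?k = "\<eta> * exp (- \<gamma> * x)"
  \<comment> \<open>Set to 0 off \<open>space M\<close>, where the injection sizes are
    unconstrained, because \<open>optional_stopping\<close> bounds its weight at every
    point.\<close>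
  let ?D = "\<lambda>i \<omega>. if \<omega> \<in> space M then V_decrement i \<omega> else 0"
  let ?ind = "\<lambda>i \<omega>. of_bool (?\<tau> i \<omega> \<le> ennreal T) :: real"
  have k: "0 \<le> ?k" using \<eta>_pos by simp
  have D01: "0 \<le> ?D i \<omega>" "?D i \<omega> \<le> 1" for i \<omega>
  proof -
    have "0 \<le> V_decrement i \<omega> \<and> V_decrement i \<omega> \<le> 1" if "\<omega> \<in> space M"
    proof -
      have "0 \<le> injected i \<omega>" "injected i \<omega> \<le> injected (Suc i) \<omega>"
        using inj_size_pos[OF that] by (auto intro!: sum_nonneg simp: less_imp_le)
      then have "exp (- \<gamma> * injected i \<omega>) \<le> 1" "exp (- \<gamma> * injected (Suc i) \<omega>) \<le> exp (- \<gamma> * injected i \<omega>)"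
        using pos by (auto simp: mult_le_cancel_left)
      moreover have "0 \<le> exp (- \<gamma> * injected (Suc i) \<omega>)" by simp
      ultimately show ?thesis unfolding V_decrement_def by linarith
    qed
    then show "0 \<le> ?D i \<omega>" "?D i \<omega> \<le> 1" by auto
  qed
  have D_F: "(\<lambda>\<omega>. ?D i \<omega> * of_bool (?\<tau> i \<omega> \<le> t)) \<in> borel_measurable (F t)" for i t
  proof (rule measurable_pre_sigma_times_of_bool[OF inj_time_stopping])
    note [measurable] = injected_measurable[of i i] injected_measurable[of "Suc i" i]
    have "V_decrement i \<in> borel_measurable (pre_sigma (?\<tau> i))"
      unfolding V_decrement_def by measurable
    then show "?D i \<in> borel_measurable (pre_sigma (?\<tau> i))"
      by (rule measurable_cong[THEN iffD1, rotated]) (simp add: space_pre_sigma)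
  qed
  have [measurable]: "(\<lambda>\<omega>. ?D i \<omega> * ?ind i \<omega>) \<in> borel_measurable M" for i
    using D_F[of i "ennreal T"] by (rule measurable_F_M)
  note [measurable] = ito_exp_measurable[OF T]
  have stop: "(\<integral>\<^sup>+ \<omega>. ennreal (Z (enn2real (?\<tau> i \<omega>)) \<omega> * (?D i \<omega> * ?ind i \<omega>)) \<partial>M)
      = (\<integral>\<^sup>+ \<omega>. ennreal (Z T \<omega> * (?D i \<omega> * ?ind i \<omega>)) \<partial>M)" for i
    by (rule optional_stopping[OF inj_time_stopping T D_F D01])
  have cost: "ennreal ?k * (\<integral>\<^sup>+ \<omega>. ennreal (Z T \<omega> * (?D i \<omega> * ?ind i \<omega>)) \<partial>M)
      \<le> (\<integral>\<^sup>+ \<omega>. (if ?\<tau> i \<omega> < \<infinity> then ennreal (exp (- r * enn2real (?\<tau> i \<omega>)) * (K + c * inj_size p i \<omega>)) else 0) \<partial>M)" for i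
  proof -
    have "AE \<omega> in M. ennreal ?k * ennreal (Z (enn2real (?\<tau> i \<omega>)) \<omega> * (?D i \<omega> * ?ind i \<omega>))
      \<le> (if ?\<tau> i \<omega> < \<infinity> then ennreal (exp (- r * enn2real (?\<tau> i \<omega>)) * (K + c * inj_size p i \<omega>)) else 0)"
      using surplus U_initial U_continuous AE_space
    proof eventually_elim
      case (elim \<omega>)
      show ?case
      proof (cases "?\<tau> i \<omega> < \<infinity>")
        case False
        then have "?ind i \<omega> = 0" by (auto simp: less_top[symmetric] top_unique)
        then show ?thesis by simp
      next
        case True
        define t where "t = enn2real (?\<tau> i \<omega>)"
        have t: "0 \<le> t" "?\<tau> i \<omega> = ennreal t" using True by (auto simp: t_def less_top)
        let ?y = "U t \<omega> + injected i \<omega>" and ?xi = "inj_size p i \<omega>"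
        have y: "0 \<le> ?y"
          using elim t by (intro surplus_at_injection_nonneg) auto
        have xi: "0 \<le> 1 - exp (- \<gamma> * ?xi)"
          using inj_size_pos[OF elim(4), of i] pos by simp
        have "?k * (Z t \<omega> * (?D i \<omega> * ?ind i \<omega>)) \<le> ?k * (Z t \<omega> * ?D i \<omega>)"
          using k D01[of \<omega> i] by (intro mult_left_mono mult_left_le) (auto simp: ito_exp_def)
        also have "\<dots> = \<eta> * ((exp (- \<gamma> * x) * Z t \<omega>) * (exp (- \<gamma> * injected i \<omega>) * (1 - exp (- \<gamma> * ?xi))))"
          using elim(4) by (simp add: V_decrement_def algebra_simps flip: exp_add)
        also have "\<dots> \<le> \<eta> * (exp (- r * t - \<gamma> * U t \<omega>) * (exp (- \<gamma> * injected i \<omega>) * (1 - exp (- \<gamma> * ?xi))))"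
          using \<eta>_pos xi Z_le[OF elim(4) t(1)] by (intro mult_left_mono mult_right_mono) auto
        also have "\<dots> = exp (- r * t) * (exp (- \<gamma> * ?y) * (\<eta> * (1 - exp (- \<gamma> * ?xi))))"
          by (simp add: algebra_simps flip: exp_add)
        \<comment> \<open>An injection of given size lowers the value most at surplus 0, and
          \<open>?y\<close> is nonnegative.\<close>
        also have "\<dots> \<le> exp (- r * t) * (1 * (\<eta> * (1 - exp (- \<gamma> * ?xi))))"
          using y pos xi \<eta>_pos by (intro mult_left_mono mult_right_mono) auto
        also have "\<dots> \<le> exp (- r * t) * (K + c * ?xi)"
          using injection_cost_ge by (intro mult_left_mono) auto
        finally show ?thesis
          using True k D01[of \<omega> i] unfolding t_def[symmetric]
          by (simp add: ennreal_leI ito_exp_def flip: ennreal_mult)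
      qed
    qed
    then have "(\<integral>\<^sup>+ \<omega>. ennreal ?k * ennreal (Z (enn2real (?\<tau> i \<omega>)) \<omega> * (?D i \<omega> * ?ind i \<omega>)) \<partial>M)
      \<le> (\<integral>\<^sup>+ \<omega>. (if ?\<tau> i \<omega> < \<infinity> then ennreal (exp (- r * enn2real (?\<tau> i \<omega>)) * (K + c * inj_size p i \<omega>)) else 0) \<partial>M)"
      by (rule nn_integral_mono_AE)
    moreover have "ennreal ?k * (\<integral>\<^sup>+ \<omega>. ennreal (Z (enn2real (?\<tau> i \<omega>)) \<omega> * (?D i \<omega> * ?ind i \<omega>)) \<partial>M)
      \<le> (\<integral>\<^sup>+ \<omega>. ennreal ?k * ennreal (Z (enn2real (?\<tau> i \<omega>)) \<omega> * (?D i \<omega> * ?ind i \<omega>)) \<partial>M)"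
      by (rule nn_integral_cmult_le)
    ultimately show ?thesis unfolding stop by (rule order_trans[rotated])
  qed
  have "AE \<omega> in M. ennreal (Z T \<omega>) \<le> (\<Sum>i. ennreal (Z T \<omega> * (?D i \<omega> * ?ind i \<omega>))) + ennreal (exp (\<gamma> * x - r * T))"
    using surplus AE_space
  proof eventually_elim
    case (elim \<omega>)
    \<comment> \<open>Sizes of injections after \<open>T\<close> count as 0, so that their terms
      vanish and the telescoping runs over all indices.\<close>
    let ?s = "\<lambda>i. inj_size p i \<omega> * ?ind i \<omega>"
    have s0: "0 \<le> ?s i" for i using inj_size_pos[OF elim(2)] by (simp add: less_imp_le)
    have D_eq: "?D i \<omega> * ?ind i \<omega> = exp (- \<gamma> * (\<Sum>j<i. ?s j)) - exp (- \<gamma> * (\<Sum>j<Suc i. ?s j))" for i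
    proof (cases "?\<tau> i \<omega> \<le> ennreal T")
      case True
      then have "?\<tau> j \<omega> \<le> ennreal T" if "j \<le> i" for j
        using inj_time_mono[OF elim(2) that] by (rule order_trans[rotated])
      then have "(\<Sum>j<i. ?s j) = injected i \<omega>" "(\<Sum>j<Suc i. ?s j) = injected (Suc i) \<omega>"
        by (auto intro!: sum.cong)
      then show ?thesis using True elim(2) by (simp add: V_decrement_def)
    qed simp
    have partial: "ennreal (Z T \<omega>) \<le> (\<Sum>i. ennreal (Z T \<omega> * (?D i \<omega> * ?ind i \<omega>))) + ennreal (Z T \<omega> * exp (- \<gamma> * (\<Sum>j<n. ?s j)))" for n
    proof -
      have "(\<Sum>i<n. Z T \<omega> * (?D i \<omega> * ?ind i \<omega>)) = Z T \<omega> * (1 - exp (- \<gamma> * (\<Sum>j<n. ?s j)))"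
        unfolding D_eq sum_distrib_left[symmetric]
        using sum_lessThan_telescope'[of "\<lambda>i. exp (- \<gamma> * (\<Sum>j<i. ?s j))" n] by simp
      then have "Z T \<omega> = (\<Sum>i<n. Z T \<omega> * (?D i \<omega> * ?ind i \<omega>)) + Z T \<omega> * exp (- \<gamma> * (\<Sum>j<n. ?s j))"
        by (simp add: algebra_simps)
      then have "ennreal (Z T \<omega>) = (\<Sum>i<n. ennreal (Z T \<omega> * (?D i \<omega> * ?ind i \<omega>))) + ennreal (Z T \<omega> * exp (- \<gamma> * (\<Sum>j<n. ?s j)))"
        using D01 by (subst sum_ennreal, simp add: ito_exp_def, subst ennreal_plus[symmetric])
          (auto simp: ito_exp_def intro!: sum_nonneg)
      also have "\<dots> \<le> (\<Sum>i. ennreal (Z T \<omega> * (?D i \<omega> * ?ind i \<omega>))) + ennreal (Z T \<omega> * exp (- \<gamma> * (\<Sum>j<n. ?s j)))"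
        by (intro add_right_mono sum_le_suminf) auto
      finally show ?thesis .
    qed
    have "(\<lambda>i. if ?\<tau> i \<omega> \<le> ennreal T then ennreal (inj_size p i \<omega>) else 0) = (\<lambda>i. ennreal (?s i))"
      by auto
    then have ge0: "0 \<le> ereal (U T \<omega>) + enn2ereal (\<Sum>i. ennreal (?s i))"
      using elim(1) T by (auto simp: surplus_def)
    show ?case
    proof (rule ennreal_le_add_exp_imp_le)
      fix e :: real assume "0 < e"
      from suminf_ennreal_ge_imp_partial_sum[OF s0 ge0 this] obtain n where n: "- e \<le> U T \<omega> + (\<Sum>j<n. ?s j)"
        by blast
      have "Z T \<omega> = exp (\<gamma> * x) * (exp (- \<gamma> * x) * Z T \<omega>)" by (simp flip: exp_add mult.assoc)
      also have "\<dots> \<le> exp (\<gamma> * x) * exp (- r * T - \<gamma> * U T \<omega>)"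
        by (intro mult_left_mono Z_le elim T) auto
      finally have "Z T \<omega> * exp (- \<gamma> * (\<Sum>j<n. ?s j)) \<le> exp (\<gamma> * x) * exp (- r * T - \<gamma> * U T \<omega>) * exp (- \<gamma> * (\<Sum>j<n. ?s j))"
        by (intro mult_right_mono) auto
      also have "\<dots> = exp (\<gamma> * x - r * T + \<gamma> * - (U T \<omega> + (\<Sum>j<n. ?s j)))"
        by (simp add: algebra_simps flip: exp_add)
      also have "\<dots> \<le> exp (\<gamma> * x - r * T + \<gamma> * e)"
        using n pos by (simp only: exp_le_cancel_iff) (intro add_left_mono mult_left_mono, auto)
      finally show "ennreal (Z T \<omega>) \<le> (\<Sum>i. ennreal (Z T \<omega> * (?D i \<omega> * ?ind i \<omega>))) + ennreal (exp (\<gamma> * x - r * T + \<gamma> * e))"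
        by (intro order_trans[OF partial[of n]] add_left_mono ennreal_leI)
    qed
  qed
  then have "(\<integral>\<^sup>+ \<omega>. ennreal (Z T \<omega>) \<partial>M)
      \<le> (\<integral>\<^sup>+ \<omega>. (\<Sum>i. ennreal (Z T \<omega> * (?D i \<omega> * ?ind i \<omega>))) + ennreal (exp (\<gamma> * x - r * T)) \<partial>M)"
    by (rule nn_integral_mono_AE)
  also have "\<dots> = (\<Sum>i. \<integral>\<^sup>+ \<omega>. ennreal (Z T \<omega> * (?D i \<omega> * ?ind i \<omega>)) \<partial>M) + ennreal (exp (\<gamma> * x - r * T))"
    by (subst nn_integral_add) (simp_all add: nn_integral_suminf emeasure_space_1)
  finally have "1 \<le> (\<Sum>i. \<integral>\<^sup>+ \<omega>. ennreal (Z T \<omega> * (?D i \<omega> * ?ind i \<omega>)) \<partial>M) + ennreal (exp (\<gamma> * x - r * T))"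
    by (simp add: ito_exp_mean[OF T])
  then have "ennreal ?k * 1 \<le> ennreal ?k * ((\<Sum>i. \<integral>\<^sup>+ \<omega>. ennreal (Z T \<omega> * (?D i \<omega> * ?ind i \<omega>)) \<partial>M) + ennreal (exp (\<gamma> * x - r * T)))"
    by (rule mult_left_mono) simp
  also have "\<dots> = (\<Sum>i. ennreal ?k * (\<integral>\<^sup>+ \<omega>. ennreal (Z T \<omega> * (?D i \<omega> * ?ind i \<omega>)) \<partial>M)) + ennreal (\<eta> * exp (- r * T))"
    using \<eta>_pos by (simp add: distrib_left ennreal_suminf_cmult exp_diff exp_minus field_simps flip: ennreal_mult exp_add)
  also have "\<dots> \<le> control_cost M r K c p + ennreal (\<eta> * exp (- r * T))"
    unfolding control_cost_eq by (intro add_right_mono suminf_le cost) auto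
  finally show ?thesis by simp
qed

lemma control_cost_ge_value:
  assumes surplus: "AE \<omega> in M. \<forall>t\<ge>0. 0 \<le> surplus \<mu> \<delta> x p I t \<omega>"
  shows "ennreal (\<eta> * exp (- \<gamma> * x)) \<le> control_cost M r K c p"
proof -
  have "filterlim (\<lambda>n. r * real n) at_top sequentially"
    using pos by (intro filterlim_tendsto_pos_mult_at_top[OF tendsto_const] filterlim_real_sequentially)
  then have "filterlim (\<lambda>n. - (r * real n)) at_bot sequentially"
    by (simp add: filterlim_uminus_at_bot)
  then have "(\<lambda>n. exp (- (r * real n))) \<longlonglongrightarrow> 0"
    by (rule filterlim_compose[OF exp_at_bot])
  then have "(\<lambda>n. control_cost M r K c p + ennreal (\<eta> * exp (- (r * real n)))) \<longlonglongrightarrow> control_cost M r K c p + ennreal (\<eta> * 0)"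
    by (intro tendsto_intros)
  then show ?thesis
    using control_cost_ge[OF surplus] by (intro LIMSEQ_le_const[of _ "control_cost M r K c p"]) auto
qed

end

section \<open>Injections at ruin\<close>

text \<open>By the intermediate value theorem \<open>f\<close> stays positive before
  \<open>T\<close>. At \<open>T\<close>, continuity from the left gives one inequality and points of
  \<open>A\<close> approaching \<open>T\<close> from above give the other. The set \<open>A\<close>
  is general because it will consist of zeros of the surplus, where \<open>f\<close>, which counts
  only some injections, is merely known to be at most 0.\<close>

lemma first_zero:
  fixes f :: "real \<Rightarrow> real"
  assumes cont: "continuous_on {0..} f" and a: "0 \<le> a" "0 \<le> f a"
    and T: "T = Inf (ennreal ` A)"
    and A: "\<forall>t\<in>A. a \<le> t \<and> f t \<le> 0"
    and nz: "\<forall>t\<ge>a. ennreal t < T \<longrightarrow> f t \<noteq> 0"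
  shows first_zero_pos: "\<And>t. a \<le> t \<Longrightarrow> ennreal t < T \<Longrightarrow> 0 < f t"
    and first_zero_eq: "\<And>t. 0 \<le> t \<Longrightarrow> T = ennreal t \<Longrightarrow> f t = 0"
proof -
  show pos: "0 < f t" if t: "a \<le> t" "ennreal t < T" for t
  proof (rule ccontr)
    assume "\<not> 0 < f t"
    moreover have "continuous_on {a..t} f"
      using a by (intro continuous_on_subset[OF cont]) auto
    ultimately obtain z where z: "a \<le> z" "z \<le> t" "f z = 0"
      using IVT2'[of f t 0 a] a t by (auto simp: not_less)
    have "ennreal z < T"
      using z t(2) by (intro le_less_trans[OF ennreal_leI t(2)])
    with nz z show False by blast
  qed
  fix s assume s: "0 \<le> s" "T = ennreal s"
  have "ennreal a \<le> ennreal s"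
    unfolding s(2)[symmetric] T using A by (intro Inf_greatest) (auto intro: ennreal_leI)
  then have as: "a \<le> s" using s by (simp add: ennreal_le_iff)
  have "0 \<le> f s"
  proof (cases "s = a")
    case False
    define q where "q n = s - (s - a) / real (Suc n)" for n
    have q: "a \<le> q n" "q n < s" for n
    proof -
      have "(s - a) / real (Suc n) \<le> (s - a) / 1"
        using as by (intro divide_left_mono) auto
      then show "a \<le> q n" "q n < s" using as False by (auto simp: q_def)
    qed
    have "q \<longlonglongrightarrow> s - 0"
      unfolding q_def by (intro tendsto_intros lim_const_over_n[THEN LIMSEQ_Suc])
    then have "(\<lambda>n. f (q n)) \<longlonglongrightarrow> f s"
      using q a s order_trans[OF a(1) q(1)] by (intro continuous_on_tendsto_compose[OF cont]) auto
    moreover have "0 \<le> f (q n)" for n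
      using s q[of n] a by (intro less_imp_le[OF pos]) (auto simp: ennreal_less_iff)
    ultimately show ?thesis by (intro LIMSEQ_le_const) auto
  qed (use a in simp)
  moreover have "f s \<le> 0"
  proof -
    have "\<exists>t\<in>A. s \<le> t \<and> t < s + 1 / real (Suc n)" for n
    proof -
      have "Inf (ennreal ` A) < ennreal (s + 1 / real (Suc n))"
        using s by (simp add: ennreal_less_iff flip: T)
      then obtain t where t: "t \<in> A" "ennreal t < ennreal (s + 1 / real (Suc n))"
        by (auto simp: Inf_less_iff)
      have "ennreal s \<le> ennreal t" unfolding s(2)[symmetric] T using t(1) by (intro Inf_lower) auto
      moreover have t0: "0 \<le> t" using A t(1) a by force
      ultimately have "s \<le> t" by (simp add: ennreal_le_iff)
      moreover have "t < s + 1 / real (Suc n)" using t(2) unfolding ennreal_less_iff[OF t0] .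
      ultimately show ?thesis using t(1) by blast
    qed
    then obtain t where t: "\<And>n. t n \<in> A" "\<And>n. s \<le> t n" "\<And>n. t n < s + 1 / real (Suc n)" by metis
    have "(\<lambda>n. s + 1 / real (Suc n)) \<longlonglongrightarrow> s + 0"
      by (intro tendsto_intros lim_const_over_n[THEN LIMSEQ_Suc])
    then have "(\<lambda>n. s + 1 / real (Suc n)) \<longlonglongrightarrow> s" by simp
    then have "t \<longlonglongrightarrow> s"
      by (rule tendsto_sandwich[OF _ _ tendsto_const, rotated 2]) (intro always_eventually allI less_imp_le[OF t(3)] t(2))+
    then have "(\<lambda>n. f (t n)) \<longlonglongrightarrow> f s"
      using s t(2) order_trans[OF s(1)] by (intro continuous_on_tendsto_compose[OF cont]) auto
    then show ?thesis using A t(1) by (intro LIMSEQ_le_const2) auto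
  qed
  ultimately show "f s = 0" by simp
qed

lemma suminf_if_less:
  assumes "\<And>i. P i \<longleftrightarrow> i < n" "0 \<le> d"
  shows "(\<Sum>i. if P i then ennreal d else 0) = ennreal (real n * d)"
proof -
  have "(\<Sum>i. if P i then ennreal d else 0) = (\<Sum>i<n. if P i then ennreal d else 0)"
    using assms by (intro suminf_finite) auto
  also have "\<dots> = of_nat n * ennreal d" using assms by simp
  finally show ?thesis by (simp add: ennreal_mult' ennreal_of_nat_eq_real_of_nat assms)
qed

lemma suminf_if_ge:
  assumes "\<And>i. i < n \<Longrightarrow> P i" "0 \<le> d"
  shows "ennreal (real n * d) \<le> (\<Sum>i. if P i then ennreal d else 0)"
proof -
  have "ennreal (real n * d) = (\<Sum>i<n. if P i then ennreal d else 0)"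
    using assms by (simp add: ennreal_mult' ennreal_of_nat_eq_real_of_nat)
  also have "\<dots> \<le> (\<Sum>i. if P i then ennreal d else 0)"
    by (intro sum_le_suminf) auto
  finally show ?thesis .
qed

lemma ereal_add_enn2ereal_ge:
  assumes "ennreal b \<le> S" "0 \<le> b"
  shows "ereal (a + b) \<le> ereal a + enn2ereal S"
proof -
  have "enn2ereal (ennreal b) \<le> enn2ereal S" using assms(1) by (simp add: less_eq_ennreal.rep_eq)
  then have "ereal a + ereal b \<le> ereal a + enn2ereal S"
    using assms(2) by (intro add_left_mono) (simp add: enn2ereal_ennreal)
  then show ?thesis by simp
qed

text \<open>Before and at the \<open>n\<close>-th ruin time, exactly \<open>n\<close> injections of size \<open>d\<close> have been made.\<close>

lemma successive_ruin_times:
  fixes U :: "real \<Rightarrow> real" and \<tau> :: "nat \<Rightarrow> ennreal" and d :: real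
  defines "X \<equiv> \<lambda>t. ereal (U t) + enn2ereal (\<Sum>i. if \<tau> i < ennreal t then ennreal d else 0)"
  assumes cont: "continuous_on {0..} U" and U0: "0 \<le> U 0" and d: "0 < d"
    and mono: "\<And>i j. i \<le> j \<Longrightarrow> \<tau> i \<le> \<tau> j"
    and \<tau>_0: "\<tau> 0 = Inf {ennreal t | t. 0 \<le> t \<and> X t = 0}"
    and \<tau>_Suc: "\<And>i. \<tau> (Suc i) = Inf {ennreal t | t. 0 \<le> t \<and> \<tau> i < ennreal t \<and> X t = 0}"
  shows ruin_time_before: "\<And>t. 0 \<le> t \<Longrightarrow> ennreal t < \<tau> n \<Longrightarrow> 0 < U t + real n * d"
    and ruin_time_at: "\<And>t. 0 \<le> t \<Longrightarrow> \<tau> n = ennreal t \<Longrightarrow> U t + real n * d = 0"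
proof -
  have X_eq: "X t = ereal (U t + real n * d)" if n: "\<And>i. i < n \<Longrightarrow> \<tau> i < ennreal t" "ennreal t \<le> \<tau> n" for n t
  proof -
    have P: "\<tau> i < ennreal t \<longleftrightarrow> i < n" for i
      using n(1)[of i] order_trans[OF n(2) mono[of n i]] by (auto simp: not_less[symmetric])
    show ?thesis
      unfolding X_def using d by (subst suminf_if_less[OF P]) (auto simp: enn2ereal_ennreal)
  qed
  \<comment> \<open>Without an upper bound on \<open>t\<close> more than \<open>n\<close> injections
    may have been made, possibly infinitely many, so only an inequality is available.\<close>
  have X_ge: "ereal (U t + real n * d) \<le> X t" if "\<And>i. i < n \<Longrightarrow> \<tau> i < ennreal t" for n t
    unfolding X_def using d that by (intro ereal_add_enn2ereal_ge suminf_if_ge) auto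
  \<comment> \<open>Joint induction: the step uses the zero at the previous ruin time as well as the
    positivity before it.\<close>
  have "(\<forall>t\<ge>0. ennreal t < \<tau> n \<longrightarrow> 0 < U t + real n * d) \<and> (\<forall>t\<ge>0. \<tau> n = ennreal t \<longrightarrow> U t + real n * d = 0)"
  proof (induction n)
    case 0
    let ?A = "{t. 0 \<le> t \<and> X t = 0}"
    have \<tau>: "\<tau> 0 = Inf (ennreal ` ?A)" unfolding \<tau>_0 by (intro arg_cong[where f=Inf]) auto
    have A: "\<forall>t\<in>?A. 0 \<le> t \<and> U t \<le> 0"
    proof
      fix t assume "t \<in> ?A"
      then show "0 \<le> t \<and> U t \<le> 0" using X_ge[of 0 t] by simp
    qed
    have nz: "\<forall>t\<ge>0. ennreal t < \<tau> 0 \<longrightarrow> U t \<noteq> 0"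
    proof (intro allI impI notI)
      fix t assume t: "0 \<le> t" "ennreal t < \<tau> 0" "U t = 0"
      then have "t \<in> ?A" using X_eq[of 0 t] by simp
      then have "\<tau> 0 \<le> ennreal t" unfolding \<tau> by (intro Inf_lower imageI)
      with t(2) show False by simp
    qed
    show ?case
      using first_zero_pos[OF cont order_refl U0 \<tau> A nz] first_zero_eq[OF cont order_refl U0 \<tau> A nz] by simp
  next
    case (Suc n)
    show ?case
    proof (cases "\<tau> n < \<infinity>")
      case False
      then have "\<tau> n = \<infinity>" "\<tau> (Suc n) = \<infinity>" using mono[of n "Suc n"] by (auto simp: less_top[symmetric] top_unique)
      then show ?thesis using Suc d by (auto simp: distrib_right add.assoc[symmetric] intro: add_pos_pos)
    next
      case True
      then obtain a where a: "0 \<le> a" "\<tau> n = ennreal a" by (cases "\<tau> n") (auto simp: less_top)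
      let ?f = "\<lambda>t. U t + real (Suc n) * d"
      \<comment> \<open>Right after the injection the surplus is \<open>d > 0\<close>; this
        separates consecutive ruin times and starts \<open>first_zero\<close> anew at
        \<open>a\<close>.\<close>
      have fa: "?f a = d" using Suc a by (simp add: algebra_simps)
      let ?A = "{t. 0 \<le> t \<and> \<tau> n < ennreal t \<and> X t = 0}"
      have \<tau>: "\<tau> (Suc n) = Inf (ennreal ` ?A)" unfolding \<tau>_Suc by (intro arg_cong[where f=Inf]) auto
      have past: "\<tau> i < ennreal t" if "\<tau> n < ennreal t" "i < Suc n" for i t
        using le_less_trans[OF mono[of i n] that(1)] that(2) by simp
      have A: "\<forall>t\<in>?A. a \<le> t \<and> ?f t \<le> 0"
      proof
        fix t assume t: "t \<in> ?A"
        have "ereal (?f t) \<le> X t" using t by (intro X_ge) (auto intro: past)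
        moreover have "a \<le> t" using t a by (simp add: ennreal_less_iff)
        ultimately show "a \<le> t \<and> ?f t \<le> 0" using t by simp
      qed
      have nz: "\<forall>t\<ge>a. ennreal t < \<tau> (Suc n) \<longrightarrow> ?f t \<noteq> 0"
      proof (intro allI impI notI)
        fix t assume t: "a \<le> t" "ennreal t < \<tau> (Suc n)" "?f t = 0"
        then have "t \<noteq> a" using fa d by auto
        then have at: "\<tau> n < ennreal t" using t a by (simp add: ennreal_less_iff)
        have "X t = ereal (?f t)" using t(2) past[OF at] by (intro X_eq) (auto simp: less_imp_le)
        then have "t \<in> ?A" using at t a by (simp add: zero_ereal_def)
        then have "\<tau> (Suc n) \<le> ennreal t" unfolding \<tau> by (intro Inf_lower imageI)
        with t(2) show False by simp
      qed
      have cont': "continuous_on {0..} ?f" by (intro continuous_intros cont)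
      have fa': "0 \<le> ?f a" using fa d by simp
      have "0 < ?f t" if t: "0 \<le> t" "ennreal t < \<tau> (Suc n)" for t
      proof (cases "a \<le> t")
        case True
        then show ?thesis using first_zero_pos[OF cont' a(1) fa' \<tau> A nz] t by blast
      next
        case False
        then have "0 < U t + real n * d" using Suc t a by (simp add: ennreal_less_iff)
        then show ?thesis using d by (simp add: algebra_simps)
      qed
      moreover have "?f t = 0" if "0 \<le> t" "\<tau> (Suc n) = ennreal t" for t
        using first_zero_eq[OF cont' a(1) fa' \<tau> A nz that] .
      ultimately show ?thesis by blast
    qed
  qed
  then show "\<And>t. 0 \<le> t \<Longrightarrow> ennreal t < \<tau> n \<Longrightarrow> 0 < U t + real n * d"
    and "\<And>t. 0 \<le> t \<Longrightarrow> \<tau> n = ennreal t \<Longrightarrow> U t + real n * d = 0" by auto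
qed

text \<open>If some ruin time lies after \<open>t\<close>, the first such \<open>n\<close> counts
  the injections made, and \<open>before\<close> applies to it. Otherwise all injections have been
  made by time \<open>t\<close>, and sufficiently many of size \<open>d\<close> outweigh
  \<open>a\<close>; this covers an accumulation of ruin times.\<close>

lemma surplus_nonneg_of_ruin_times:
  fixes \<tau> :: "nat \<Rightarrow> ennreal"
  assumes before: "\<And>n. ennreal t < \<tau> n \<Longrightarrow> 0 < a + real n * d"
    and d: "0 < d" and mono: "\<And>i j. i \<le> j \<Longrightarrow> \<tau> i \<le> \<tau> j"
  shows "0 \<le> ereal a + enn2ereal (\<Sum>i. if \<tau> i \<le> ennreal t then ennreal d else 0)"
proof -
  have "\<exists>n. 0 \<le> a + real n * d \<and> (\<forall>i<n. \<tau> i \<le> ennreal t)"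
  proof (cases "\<exists>n. ennreal t < \<tau> n")
    case True
    define n where "n = (LEAST n. ennreal t < \<tau> n)"
    have "ennreal t < \<tau> n" unfolding n_def using True by (rule LeastI_ex)
    moreover have "\<tau> i \<le> ennreal t" if "i < n" for i
      using not_less_Least[of i "\<lambda>n. ennreal t < \<tau> n"] that by (simp add: n_def not_less)
    ultimately show ?thesis using before[of n] by (auto intro: less_imp_le)
  next
    case False
    obtain n where "- a / d < real n" using reals_Archimedean2 by blast
    then show ?thesis using d False by (intro exI[of _ n]) (auto simp: field_simps not_less)
  qed
  then obtain n where n: "0 \<le> a + real n * d" "\<forall>i<n. \<tau> i \<le> ennreal t" by blast
  have "0 \<le> ereal (a + real n * d)" using n(1) by simp
  also have "\<dots> \<le> ereal a + enn2ereal (\<Sum>i. if \<tau> i \<le> ennreal t then ennreal d else 0)"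
    using n d by (intro ereal_add_enn2ereal_ge suminf_if_ge) auto
  finally show ?thesis .
qed

section \<open>The cost of injecting at ruin\<close>

locale ruin_control = controlled_surplus +
  assumes full_retention: "retention p = (\<lambda>s \<omega>. 1)"
    and constant_size: "inj_size p = (\<lambda>i \<omega>. \<xi>)"
    and at_ruin: "AE \<omega> in M.
           inj_time p 0 \<omega> = Inf {ennreal t | t. 0 \<le> t \<and> surplus_before \<mu> \<delta> x p I t \<omega> = 0} \<and>
           (\<forall>i. inj_time p (Suc i) \<omega> =
              Inf {ennreal t | t. 0 \<le> t \<and> inj_time p i \<omega> < ennreal t \<and>
                                  surplus_before \<mu> \<delta> x p I t \<omega> = 0})"
begin

lemma ruin_times:
  "AE \<omega> in M. \<forall>t\<ge>0. \<forall>n. (ennreal t < inj_time p n \<omega> \<longrightarrow> 0 < U t \<omega> + real n * \<xi>) \<and>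
     (inj_time p n \<omega> = ennreal t \<longrightarrow> U t \<omega> + real n * \<xi> = 0)"
  using at_ruin U_initial U_continuous AE_space
proof eventually_elim
  case (elim \<omega>)
  note X = surplus_before_def[of \<mu> \<delta> x p I _ \<omega>, unfolded constant_size]
  have U0: "0 \<le> U 0 \<omega>" using elim x_nonneg by simp
  note * = elim(3) U0 \<xi>_pos inj_time_mono[OF elim(4)] conjunct1[OF elim(1), unfolded X]
    conjunct2[OF elim(1), rule_format, unfolded X]
  show ?case
    using ruin_time_before[OF *] ruin_time_at[OF *] by blast
qed

lemma surplus_nonneg: "AE \<omega> in M. \<forall>t\<ge>0. 0 \<le> surplus \<mu> \<delta> x p I t \<omega>"
  using ruin_times AE_space
proof eventually_elim
  case (elim \<omega>)
  then show ?case
    unfolding surplus_def constant_size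
    using surplus_nonneg_of_ruin_times[of _ "\<lambda>n. inj_time p n \<omega>", OF _ \<xi>_pos inj_time_mono[OF elim(2)]]
    by blast
qed

text \<open>The equality case of \<open>Z_le\<close>: under full retention the drift is exactly 0 by
  \<open>\<gamma>_root\<close>.\<close>

lemma Z_eq:
  assumes \<omega>: "\<omega> \<in> space M" and t: "0 \<le> t"
  shows "exp (- \<gamma> * x) * Z t \<omega> = exp (- r * t - \<gamma> * U t \<omega>)"
proof -
  have "(LINT s:{0<..t}|lborel. u s \<omega>) = (LINT s:{0<..t}|lborel. 1)"
    "(LINT s:{0<..t}|lborel. (u s \<omega>)\<^sup>2) = (LINT s:{0<..t}|lborel. 1)"
    by (intro set_lebesgue_integral_cong; simp add: u_def full_retention)+
  then have L: "(LINT s:{0<..t}|lborel. u s \<omega>) = t" "(LINT s:{0<..t}|lborel. (u s \<omega>)\<^sup>2) = t"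
    using t by (simp_all add: set_integral_const)
  have "\<gamma>\<^sup>2 / 2 * (\<sigma>\<^sup>2 * t) = ((\<mu> - \<delta>) * \<gamma> + r) * t"
    unfolding \<gamma>_root[symmetric] by simp
  then have "- \<gamma> * x + (- \<gamma> * I t \<omega> - \<gamma>\<^sup>2 / 2 * (\<sigma>\<^sup>2 * t)) = - r * t - \<gamma> * U t \<omega>"
    unfolding U_eq[OF \<omega> t] L by (simp add: algebra_simps)
  then show ?thesis
    using L by (simp add: ito_exp_def power_mult_distrib flip: exp_add)
qed

text \<open>At the ruin time number \<open>i\<close> the uninjected path equals
  \<open>- i * \<xi>\<close>, so the discount factor is a constant multiple of \<open>Z\<close>.
  Optional stopping gives the bound up to each horizon \<open>n\<close>, and Fatou's lemma removes
  the horizon; paths with an infinite ruin time contribute 0.\<close>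

lemma discount_at_ruin_le:
  "(\<integral>\<^sup>+ \<omega>. (if inj_time p i \<omega> < \<infinity> then ennreal (exp (- r * enn2real (inj_time p i \<omega>))) else 0) \<partial>M)
    \<le> ennreal (exp (- \<gamma> * x) * exp (- \<gamma> * \<xi>) ^ i)"
proof -
  let ?\<tau> = "inj_time p i"
  let ?e = "\<lambda>\<omega>. exp (- r * enn2real (?\<tau> \<omega>))"
  let ?q = "exp (- \<gamma> * x) * exp (- \<gamma> * \<xi>) ^ i"
  note [measurable] = inj_time_measurable
  have bound: "(\<integral>\<^sup>+ \<omega>. ennreal (?e \<omega> * of_bool (?\<tau> \<omega> \<le> ennreal (real n))) \<partial>M) \<le> ennreal ?q" for n
  proof -
    \<comment> \<open>The factor \<open>1\<close> takes the place of the weight \<open>D\<close> in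
      \<open>optional_stopping\<close>.\<close>
    have "AE \<omega> in M. ?e \<omega> * of_bool (?\<tau> \<omega> \<le> ennreal (real n))
        = ?q * (Z (enn2real (?\<tau> \<omega>)) \<omega> * (1 * of_bool (?\<tau> \<omega> \<le> ennreal (real n))))"
      using ruin_times AE_space
    proof eventually_elim
      case (elim \<omega>)
      show ?case
      proof (cases "?\<tau> \<omega> \<le> ennreal (real n)")
        case True
        define t where "t = enn2real (?\<tau> \<omega>)"
        have "?\<tau> \<omega> < \<infinity>" using True by (rule le_less_trans) simp
        then have t: "0 \<le> t" "?\<tau> \<omega> = ennreal t" by (auto simp: t_def less_top)
        have U: "U t \<omega> = - (real i * \<xi>)" using elim(1) t by (auto simp: eq_neg_iff_add_eq_0)
        have "?q * Z t \<omega> = exp (- r * t - \<gamma> * U t \<omega>) * exp (real i * (- \<gamma> * \<xi>))"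
          unfolding Z_eq[OF elim(2) t(1), symmetric] exp_of_nat_mult by simp
        also have "\<dots> = exp (- r * t)" unfolding U by (simp flip: exp_add add: algebra_simps)
        finally show ?thesis using True by (simp add: t_def)
      qed simp
    qed
    then have "(\<integral>\<^sup>+ \<omega>. ennreal (?e \<omega> * of_bool (?\<tau> \<omega> \<le> ennreal (real n))) \<partial>M)
      = (\<integral>\<^sup>+ \<omega>. ennreal ?q * ennreal (Z (enn2real (?\<tau> \<omega>)) \<omega> * (1 * of_bool (?\<tau> \<omega> \<le> ennreal (real n)))) \<partial>M)"
      by (intro nn_integral_cong_AE) (auto simp: ennreal_mult mult.assoc ito_exp_def simp del: mult_1)
    also have "\<dots> = ennreal ?q * (\<integral>\<^sup>+ \<omega>. ennreal (Z (enn2real (?\<tau> \<omega>)) \<omega> * (1 * of_bool (?\<tau> \<omega> \<le> ennreal (real n)))) \<partial>M)"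
      by (rule nn_integral_cmult_not_measurable) simp
    also have "(\<integral>\<^sup>+ \<omega>. ennreal (Z (enn2real (?\<tau> \<omega>)) \<omega> * (1 * of_bool (?\<tau> \<omega> \<le> ennreal (real n)))) \<partial>M)
        = (\<integral>\<^sup>+ \<omega>. ennreal (Z (real n) \<omega> * (1 * of_bool (?\<tau> \<omega> \<le> ennreal (real n)))) \<partial>M)"
    proof (rule optional_stopping[OF inj_time_stopping])
      show "(\<lambda>\<omega>. 1 * of_bool (?\<tau> \<omega> \<le> t)) \<in> borel_measurable (F t)" for t
        using stopping_timeD[OF inj_time_stopping, of i t] by measurable
    qed auto
    also have "\<dots> \<le> (\<integral>\<^sup>+ \<omega>. ennreal (Z (real n) \<omega>) \<partial>M)"
      by (intro nn_integral_mono ennreal_leI) (simp add: ito_exp_def)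
    also have "\<dots> = 1" by (rule ito_exp_mean) simp
    finally show ?thesis by (simp add: mult_left_mono)
  qed
  have lim: "(\<lambda>n. ennreal (?e \<omega> * of_bool (?\<tau> \<omega> \<le> ennreal (real n)))) \<longlonglongrightarrow> (if ?\<tau> \<omega> < \<infinity> then ennreal (?e \<omega>) else 0)" for \<omega>
  proof (cases "?\<tau> \<omega> < \<infinity>")
    case True
    then have "?\<tau> \<omega> = ennreal (enn2real (?\<tau> \<omega>))" by (simp add: less_top)
    then have "?\<tau> \<omega> \<le> ennreal (real n)" if "enn2real (?\<tau> \<omega>) \<le> real n" for n
      using that by (metis ennreal_leI)
    then show ?thesis
      using True eventually_ge_at_top[of "nat \<lceil>enn2real (?\<tau> \<omega>)\<rceil>"]
      by (intro tendsto_eventually) (auto elim!: eventually_mono simp: nat_le_iff ceiling_le_iff)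
  qed (auto simp: less_top[symmetric] top_unique)
  have "(\<integral>\<^sup>+ \<omega>. (if ?\<tau> \<omega> < \<infinity> then ennreal (?e \<omega>) else 0) \<partial>M)
      = (\<integral>\<^sup>+ \<omega>. liminf (\<lambda>n. ennreal (?e \<omega> * of_bool (?\<tau> \<omega> \<le> ennreal (real n)))) \<partial>M)"
    using lim_imp_Liminf[OF _ lim] by simp
  also have "\<dots> \<le> liminf (\<lambda>n. \<integral>\<^sup>+ \<omega>. ennreal (?e \<omega> * of_bool (?\<tau> \<omega> \<le> ennreal (real n))) \<partial>M)"
    by (rule nn_integral_liminf) measurable
  also have "\<dots> \<le> ennreal ?q"
    using bound by (intro Liminf_le) auto
  finally show ?thesis .
qed

lemma control_cost_le: "control_cost M r K c p \<le> ennreal (\<eta> * exp (- \<gamma> * x))"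
proof -
  let ?q = "exp (- \<gamma> * \<xi>)"
  note [measurable] = inj_time_measurable
  have Kc: "0 \<le> K + c * \<xi>" using pos \<xi>_pos by (simp add: add_nonneg_nonneg)
  have q: "0 \<le> ?q" "?q < 1" using pos \<xi>_pos by auto
  have "control_cost M r K c p = (\<Sum>i. ennreal (K + c * \<xi>) *
      (\<integral>\<^sup>+ \<omega>. (if inj_time p i \<omega> < \<infinity> then ennreal (exp (- r * enn2real (inj_time p i \<omega>))) else 0) \<partial>M))"
    unfolding control_cost_eq constant_size
    using Kc by (subst nn_integral_cmult[symmetric])
      (auto intro!: suminf_cong nn_integral_cong simp: ennreal_mult mult.commute)
  also have "\<dots> \<le> (\<Sum>i. ennreal (K + c * \<xi>) * ennreal (exp (- \<gamma> * x) * ?q ^ i))"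
    by (intro suminf_le mult_left_mono discount_at_ruin_le) auto
  also have "\<dots> = (\<Sum>i. ennreal ((K + c * \<xi>) * exp (- \<gamma> * x) * ?q ^ i))"
    using Kc by (simp add: mult.assoc flip: ennreal_mult)
  also have "\<dots> = ennreal (\<Sum>i. (K + c * \<xi>) * exp (- \<gamma> * x) * ?q ^ i)"
    using Kc q by (intro suminf_ennreal2 summable_mult summable_geometric) auto
  also have "(\<Sum>i. (K + c * \<xi>) * exp (- \<gamma> * x) * ?q ^ i) = (K + c * \<xi>) * exp (- \<gamma> * x) * (1 / (1 - ?q))"
    using q by (subst suminf_mult) (auto simp: suminf_geometric summable_geometric)
  \<comment> \<open>An injection of size \<open>\<xi>\<close> at surplus 0 costs exactly the
    decrease of the value; the factor \<open>1 - ?q\<close> cancels against the geometric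
    series.\<close>
  also have "K + c * \<xi> = \<eta> * (1 - ?q)"
    unfolding K_eq exp_\<xi> using \<eta>_pos pos by (simp add: field_simps)
  also have "\<eta> * (1 - ?q) * exp (- \<gamma> * x) * (1 / (1 - ?q)) = \<eta> * exp (- \<gamma> * x)"
    using q pos \<xi>_pos by simp
  finally show ?thesis .
qed

end

section \<open>Existence of the ruin policy and optimality\<close>

text \<open>The right side is a countable condition on the path up to \<open>t\<close>, so hitting
  times become stopping times although the filtration need not be right-continuous. Conversely to
  the approximation by rationals, the path attains its minimum on the compact interval. That minimum
  is at most \<open>a\<close>, and the path starts at or above \<open>a\<close>, so it passes
  through \<open>a\<close>.\<close>

lemma hitting_le_iff_rational:
  fixes f :: "real \<Rightarrow> real"
  assumes cont: "continuous_on {0..} f" and f0: "a \<le> f 0" and t: "0 \<le> t"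
  shows "Inf (ennreal ` {s. 0 \<le> s \<and> f s = a}) \<le> ennreal t \<longleftrightarrow>
    (\<forall>k. \<exists>q\<in>\<rat> \<inter> {0..t}. f q < a + 1 / real (Suc k))"
proof -
  define T where "T = Inf (ennreal ` {s. 0 \<le> s \<and> f s = a})"
  have T_le: "T \<le> ennreal s" if "0 \<le> s" "f s = a" for s
    unfolding T_def using that by (intro Inf_lower imageI) auto
  have cont': "continuous_on {0..} (\<lambda>s. f s - a)" by (intro continuous_intros cont)
  have nz: "\<forall>s\<ge>0. ennreal s < T \<longrightarrow> f s - a \<noteq> 0"
    using T_le by (auto simp: not_le[symmetric])
  have T_at: "f s = a" if "0 \<le> s" "T = ennreal s" for s
    using first_zero_eq[OF cont' order_refl _ T_def _ nz that] f0 by auto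
  have hit: "T \<le> ennreal t \<longleftrightarrow> (\<exists>s\<in>{0..t}. f s = a)"
  proof
    assume le: "T \<le> ennreal t"
    then have "T < \<infinity>" by (rule le_less_trans) simp
    then obtain s where s: "0 \<le> s" "T = ennreal s" by (cases T) (auto simp: less_top)
    then show "\<exists>s\<in>{0..t}. f s = a"
      using T_at[OF s] le t by (intro bexI[of _ s]) (auto simp: ennreal_le_iff)
  next
    assume "\<exists>s\<in>{0..t}. f s = a"
    then obtain s where "0 \<le> s" "s \<le> t" "f s = a" by auto
    then show "T \<le> ennreal t" using T_le[of s] by (meson ennreal_leI order_trans)
  qed
  have "(\<exists>s\<in>{0..t}. f s = a) \<longleftrightarrow> (\<forall>k. \<exists>q\<in>\<rat> \<inter> {0..t}. f q < a + 1 / real (Suc k))"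
  proof (intro iffI allI)
    fix k assume "\<exists>s\<in>{0..t}. f s = a"
    then obtain s where s: "0 \<le> s" "s \<le> t" "f s = a" by auto
    show "\<exists>q\<in>\<rat> \<inter> {0..t}. f q < a + 1 / real (Suc k)"
    proof (cases "s = 0")
      case True
      then show ?thesis using s by (intro bexI[of _ 0]) auto
    next
      case False
      obtain d where d: "0 < d" "\<And>z. 0 \<le> z \<Longrightarrow> dist z s < d \<Longrightarrow> dist (f z) (f s) < 1 / real (Suc k)"
        using cont s(1) unfolding continuous_on_iff by (metis atLeast_iff divide_pos_pos of_nat_0_less_iff zero_less_Suc zero_less_one)
      \<comment> \<open>Approaching \<open>s\<close> from the left keeps \<open>q\<close> inside
        \<open>{0..t}\<close>; in the other case \<open>s = 0\<close> is itself rational.\<close>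
      obtain q where q: "q \<in> \<rat>" "max 0 (s - d) < q" "q < s"
        using Rats_dense_in_real[of "max 0 (s - d)" s] d(1) s(1) False by auto
      then have "dist (f q) (f s) < 1 / real (Suc k)" by (intro d(2)) (auto simp: dist_real_def)
      then have "f q < a + 1 / real (Suc k)" using s(3) by (auto simp: dist_real_def abs_less_iff)
      then show ?thesis using q s by (intro bexI[of _ q]) auto
    qed
  next
    assume q: "\<forall>k. \<exists>q\<in>\<rat> \<inter> {0..t}. f q < a + 1 / real (Suc k)"
    have "continuous_on {0..t} f" by (rule continuous_on_subset[OF cont]) auto
    then obtain s where s: "s \<in> {0..t}" "\<And>z. z \<in> {0..t} \<Longrightarrow> f s \<le> f z"
      using continuous_attains_inf[of "{0..t}" f] t by auto
    have "f s \<le> a + 1 / real (Suc k)" for k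
    proof -
      obtain z where "z \<in> {0..t}" "f z < a + 1 / real (Suc k)" using q by blast
      then show ?thesis using s(2)[of z] by simp
    qed
    moreover have "(\<lambda>k. a + 1 / real (Suc k)) \<longlonglongrightarrow> a + 0"
      by (intro tendsto_intros lim_const_over_n[THEN LIMSEQ_Suc])
    ultimately have "f s \<le> a + 0" by (intro LIMSEQ_le_const) blast+
    then obtain z where "0 \<le> z" "z \<le> s" "f z = a"
      using IVT2'[of f s a 0] f0 s(1) continuous_on_subset[OF cont, of "{0..s}"] by auto
    then show "\<exists>s\<in>{0..t}. f s = a" using s(1) by (intro bexI[of _ z]) auto
  qed
  then show ?thesis using hit by (simp add: T_def)
qed

text \<open>Converse of \<open>successive_ruin_times\<close>: injecting when the uninjected path first reaches the levels
  \<open>0, -d, -2 d, \<dots>\<close> is injecting at ruin.\<close>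

lemma hitting_times_are_ruin_times:
  fixes U :: "real \<Rightarrow> real" and d :: real
  defines "T \<equiv> \<lambda>n. Inf (ennreal ` {t. 0 \<le> t \<and> U t = - (real n * d)})"
  defines "X \<equiv> \<lambda>t. ereal (U t) + enn2ereal (\<Sum>i. if T i < ennreal t then ennreal d else 0)"
  assumes cont: "continuous_on {0..} U" and U0: "0 \<le> U 0" and d: "0 < d"
  shows hitting_times_mono: "T n \<le> T (Suc n)"
    and "T 0 = Inf {ennreal t | t. 0 \<le> t \<and> X t = 0}"
    and "T (Suc n) = Inf {ennreal t | t. 0 \<le> t \<and> T n < ennreal t \<and> X t = 0}"
proof -
  have T_le: "T n \<le> ennreal t" if "0 \<le> t" "U t = - (real n * d)" for n t
    unfolding T_def using that by (intro Inf_lower imageI) auto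
  have cont': "continuous_on {0..} (\<lambda>t. U t + real n * d)" for n by (intro continuous_intros cont)
  have T_eq: "T n = Inf (ennreal ` {t. 0 \<le> t \<and> U t = - (real n * d)})" for n by (simp add: T_def)
  have nz: "\<forall>t\<ge>0. ennreal t < T n \<longrightarrow> U t + real n * d \<noteq> 0" for n
    using T_le[of _ n] by (auto simp: not_le[symmetric] eq_neg_iff_add_eq_0)
  have U0': "0 \<le> U 0 + real n * d" for n using U0 d by simp
  have A: "\<forall>t\<in>{t. 0 \<le> t \<and> U t = - (real n * d)}. 0 \<le> t \<and> U t + real n * d \<le> 0" for n by auto
  note before = first_zero_pos[OF cont' order_refl U0' T_eq A nz]
    and at = first_zero_eq[OF cont' order_refl U0' T_eq A nz]
  \<comment> \<open>Strictness matters because the surplus counts injections strictly before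
    \<open>t\<close>: exactly \<open>n\<close> of them precede a finite \<open>T n\<close>.\<close>
  have less: "T n < T (Suc n)" if "T n < \<infinity>" for n
  proof (rule ccontr)
    assume not: "\<not> T n < T (Suc n)"
    then have "T (Suc n) < \<infinity>" using that by (auto simp: not_less intro: le_less_trans)
    then obtain t where t: "0 \<le> t" "T (Suc n) = ennreal t" by (cases "T (Suc n)") (auto simp: less_top)
    have "U t + real n * d < 0" using at[OF t] d by (simp add: algebra_simps)
    moreover have "0 \<le> U t + real n * d"
    proof (cases "ennreal t < T n")
      case False
      then have "T n = ennreal t" using not t by simp
      then show ?thesis using at[OF t(1)] by simp
    qed (use before[OF t(1)] in \<open>simp add: less_imp_le\<close>)
    ultimately show False by simp
  qed
  show mono1: "T n \<le> T (Suc n)" for n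
  proof (cases "T n < \<infinity>")
    case False
    show ?thesis
    proof (rule ccontr)
      assume "\<not> T n \<le> T (Suc n)"
      then have lt: "T (Suc n) < T n" by simp
      then have "T (Suc n) < \<infinity>" by (rule less_le_trans) simp
      then obtain t where t: "0 \<le> t" "T (Suc n) = ennreal t" by (cases "T (Suc n)") (auto simp: less_top)
      then have "0 < U t + real n * d" using before[OF t(1)] lt by simp
      then show False using at[OF t] d by (simp add: algebra_simps)
    qed
  qed (use less in \<open>simp add: less_imp_le\<close>)
  have mono: "T i \<le> T j" if "i \<le> j" for i j
    using that mono1 by (rule lift_Suc_mono_le[rotated])
  have X_eq: "X t = ereal (U t + real n * d)" if n: "\<And>i. i < n \<Longrightarrow> T i < ennreal t" "ennreal t \<le> T n" for n t
  proof -
    have P: "T i < ennreal t \<longleftrightarrow> i < n" for i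
      using n(1)[of i] order_trans[OF n(2) mono[of n i]] by (auto simp: not_less[symmetric])
    show ?thesis
      unfolding X_def using d by (subst suminf_if_less[OF P]) (auto simp: enn2ereal_ennreal)
  qed
  have X_at: "X t = 0" if t: "0 \<le> t" "T n = ennreal t" for n t
  proof -
    have "T i < ennreal t" if "i < n" for i
    proof -
      have "T i \<le> ennreal t" using mono[of i n] that t by simp
      then have "T i < \<infinity>" by (rule le_less_trans) simp
      then have "T i < T (Suc i)" by (rule less)
      also have "\<dots> \<le> T n" using that by (intro mono) simp
      finally show ?thesis using t by simp
    qed
    then show ?thesis using X_eq[of n t] at[OF t] t by (simp add: zero_ereal_def)
  qed
  show "T 0 = Inf {ennreal t | t. 0 \<le> t \<and> X t = 0}"
  proof (rule antisym)
    show "T 0 \<le> Inf {ennreal t | t. 0 \<le> t \<and> X t = 0}"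
    proof (intro Inf_greatest, safe)
      fix t assume t: "0 \<le> t" "X t = 0"
      show "T 0 \<le> ennreal t"
      proof (rule ccontr)
        assume "\<not> T 0 \<le> ennreal t"
        then show False using before[of t 0] X_eq[of 0 t] t by (simp add: not_le less_imp_le)
      qed
    qed
    show "Inf {ennreal t | t. 0 \<le> t \<and> X t = 0} \<le> T 0"
    proof (cases "T 0 < \<infinity>")
      case True
      then obtain t where "0 \<le> t" "T 0 = ennreal t" by (cases "T 0") (auto simp: less_top)
      then show ?thesis using X_at[of t 0] by (auto intro!: Inf_lower)
    qed (simp add: less_top[symmetric])
  qed
  show "T (Suc n) = Inf {ennreal t | t. 0 \<le> t \<and> T n < ennreal t \<and> X t = 0}"
  proof (rule antisym)
    show "T (Suc n) \<le> Inf {ennreal t | t. 0 \<le> t \<and> T n < ennreal t \<and> X t = 0}"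
    proof (intro Inf_greatest, safe)
      fix t assume t: "0 \<le> t" "T n < ennreal t" "X t = 0"
      show "T (Suc n) \<le> ennreal t"
      proof (rule ccontr)
        assume "\<not> T (Suc n) \<le> ennreal t"
        then have lt: "ennreal t < T (Suc n)" by simp
        have "T i < ennreal t" if "i < Suc n" for i
          using mono[of i n] that t(2) by (auto intro: le_less_trans)
        then show False using before[OF t(1) lt] X_eq[of "Suc n" t] lt t by (simp add: less_imp_le)
      qed
    qed
    show "Inf {ennreal t | t. 0 \<le> t \<and> T n < ennreal t \<and> X t = 0} \<le> T (Suc n)"
    proof (cases "T (Suc n) < \<infinity>")
      case True
      then obtain t where t: "0 \<le> t" "T (Suc n) = ennreal t" by (cases "T (Suc n)") (auto simp: less_top)
      have "T n < \<infinity>" using le_less_trans[OF mono1 True] .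
      then have "T n < ennreal t" using less[of n] t by simp
      then show ?thesis using t X_at[OF t] by (auto intro!: Inf_lower)
    qed (simp add: less_top[symmetric])
  qed
qed

section \<open>Stochastic integrals of constants and hitting times of adapted processes\<close>

context brownian_filtration
begin

lemma ito_integral_const: "is_ito_integral M F w (\<lambda>s \<omega>. k) (\<lambda>t \<omega>. k * w t \<omega>)"
  unfolding is_ito_integral_def
proof (intro conjI allI impI)
  show "(\<lambda>\<omega>. k * w t \<omega>) \<in> borel_measurable M" if "0 \<le> t" for t
    using w_measurable[OF that] by simp
  show "AE \<omega> in M. continuous_on {0..} (\<lambda>t. k * w t \<omega>)"
    by (intro AE_I2 continuous_intros w_continuous)
  define S :: "nat \<Rightarrow> 'a simple_process" where "S n = [(0, real n, \<lambda>_. k)]" for n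
  have "simple_process (space M) F (S n)" for n
    by (auto simp: S_def simple_process_def)
  moreover have "(\<lambda>n. \<integral>\<^sup>+ \<omega>. (\<integral>\<^sup>+ s\<in>{0<..T}. ennreal ((simple_value (S n) s \<omega> - k)\<^sup>2) \<partial>lborel) \<partial>M) \<longlonglongrightarrow> 0" for T
  proof (rule tendsto_eventually)
    have "(\<integral>\<^sup>+ \<omega>. (\<integral>\<^sup>+ s\<in>{0<..T}. ennreal ((simple_value (S n) s \<omega> - k)\<^sup>2) \<partial>lborel) \<partial>M) = 0" if "T \<le> real n" for n
    proof -
      have "(\<integral>\<^sup>+ s\<in>{0<..T}. ennreal ((simple_value (S n) s \<omega> - k)\<^sup>2) \<partial>lborel) = (\<integral>\<^sup>+ s. 0 \<partial>(lborel :: real measure))" for \<omega>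
        using that by (intro nn_integral_cong) (auto simp: S_def simple_value_def indicator_def)
      then show ?thesis by simp
    qed
    then show "\<forall>\<^sub>F n in sequentially. (\<integral>\<^sup>+ \<omega>. (\<integral>\<^sup>+ s\<in>{0<..T}. ennreal ((simple_value (S n) s \<omega> - k)\<^sup>2) \<partial>lborel) \<partial>M) = 0"
      using filterlim_real_sequentially by (auto simp: filterlim_at_top elim!: eventually_mono dest!: spec[of _ T])
  qed
  moreover have "(\<lambda>n. \<integral>\<^sup>+ \<omega>. ennreal ((simple_integral w (S n) t \<omega> - k * w t \<omega>)\<^sup>2) \<partial>M) \<longlonglongrightarrow> 0" if t: "0 \<le> t" for t
  proof (rule tendsto_eventually)
    have "(\<integral>\<^sup>+ \<omega>. ennreal ((simple_integral w (S n) t \<omega> - k * w t \<omega>)\<^sup>2) \<partial>M) = (\<integral>\<^sup>+ \<omega>. 0 \<partial>M)" if "t \<le> real n" for n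
      using that t by (intro nn_integral_cong) (auto simp: S_def simple_integral_def min_absorb1 min_absorb2 w_0)
    then show "\<forall>\<^sub>F n in sequentially. (\<integral>\<^sup>+ \<omega>. ennreal ((simple_integral w (S n) t \<omega> - k * w t \<omega>)\<^sup>2) \<partial>M) = 0"
      using filterlim_real_sequentially by (auto simp: filterlim_at_top elim!: eventually_mono dest!: spec[of _ t])
  qed
  ultimately show "\<exists>S :: nat \<Rightarrow> 'a simple_process. (\<forall>n. simple_process (space M) F (S n)) \<and>
      (\<forall>T\<ge>0. (\<lambda>n. \<integral>\<^sup>+ \<omega>. (\<integral>\<^sup>+ s\<in>{0<..T}. ennreal ((simple_value (S n) s \<omega> - k)\<^sup>2) \<partial>lborel) \<partial>M) \<longlonglongrightarrow> 0) \<and>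
      (\<forall>t\<ge>0. (\<lambda>n. \<integral>\<^sup>+ \<omega>. ennreal ((simple_integral w (S n) t \<omega> - k * w t \<omega>)\<^sup>2) \<partial>M) \<longlonglongrightarrow> 0)"
    by blast
qed

lemma stopping_time_hitting:
  assumes cont: "\<And>\<omega>. \<omega> \<in> space M \<Longrightarrow> continuous_on {0..} (\<lambda>t. Y t \<omega>)"
    and adapted: "\<And>s t. 0 \<le> s \<Longrightarrow> s \<le> t \<Longrightarrow> Y s \<in> borel_measurable (F (ennreal t))"
    and Y0: "\<And>\<omega>. \<omega> \<in> space M \<Longrightarrow> a \<le> Y 0 \<omega>"
  shows "stopping_time F (\<lambda>\<omega>. Inf (ennreal ` {s. 0 \<le> s \<and> Y s \<omega> = (a :: real)}))"
proof
  fix t :: ennreal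
  show "Measurable.pred (F t) (\<lambda>\<omega>. Inf (ennreal ` {s. 0 \<le> s \<and> Y s \<omega> = a}) \<le> t)"
  proof (cases t)
    case (real t')
    have "Measurable.pred (F t) (\<lambda>\<omega>. \<forall>k. \<exists>q\<in>\<rat> \<inter> {0..t'}. Y q \<omega> < a + 1 / real (Suc k))"
    proof (intro pred_intros_countable measurable_pred_countable countable_Int1 countable_rat)
      fix k q assume "q \<in> \<rat> \<inter> {0..t'}"
      then have [measurable]: "Y q \<in> borel_measurable (F t)" using adapted[of q t'] real by simp
      show "Measurable.pred (F t) (\<lambda>\<omega>. Y q \<omega> < a + 1 / real (Suc k))" by measurable
    qed
    then show ?thesis
      using hitting_le_iff_rational[OF cont Y0 real(1)] real(2)
      by (subst measurable_cong[where g="\<lambda>\<omega>. \<forall>k. \<exists>q\<in>\<rat> \<inter> {0..t'}. Y q \<omega> < a + 1 / real (Suc k)"])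
         (auto simp: space_F)
  qed simp
qed

end

context injection_problem
begin

text \<open>A recursive construction through the controlled surplus is avoided: the injection times
  are hitting times of levels by the uninjected path, which does not depend on the injections. This
  makes them stopping times, and \<open>hitting_times_are_ruin_times\<close> identifies them with
  the ruin times.\<close>

lemma ruin_control_exists:
  assumes x: "0 \<le> x"
  shows "\<exists>p. is_control M F p \<and> retention p = (\<lambda>s \<omega>. 1) \<and> inj_size p = (\<lambda>i \<omega>. \<xi>) \<and>
    injects_at_ruin M F w \<mu> \<sigma> \<delta> x p"
proof -
  define Y where "Y t \<omega> = x + (\<mu> - \<delta>) * t + \<sigma> * w t \<omega>" for t \<omega>
  define p where "p = \<lparr>retention = (\<lambda>s \<omega>. 1),
    inj_time = (\<lambda>n \<omega>. Inf (ennreal ` {t. 0 \<le> t \<and> Y t \<omega> = - (real n * \<xi>)})), inj_size = (\<lambda>i \<omega>. \<xi>)\<rparr>"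
  have Y_cont: "continuous_on {0..} (\<lambda>t. Y t \<omega>)" if "\<omega> \<in> space M" for \<omega>
    unfolding Y_def by (intro continuous_intros w_continuous that)
  have Y0: "Y 0 \<omega> = x" if "\<omega> \<in> space M" for \<omega> using w_0[OF that] by (simp add: Y_def)
  have U: "uninjected_surplus \<mu> \<delta> x p (\<lambda>t \<omega>. \<sigma> * w t \<omega>) t \<omega> = Y t \<omega>" if "0 \<le> t" for t \<omega>
    using that by (simp add: uninjected_surplus_def Y_def p_def set_integral_const mult.commute)
  have "is_control M F p"
    unfolding is_control_def
  proof (intro conjI allI ballI impI)
    show "predictable (space M) F (retention p)" by (simp add: p_def predictable_def)
    show "stopping_time F (inj_time p i)" for i
      unfolding p_def control.simps
    proof (rule stopping_time_hitting[OF Y_cont])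
      show "Y s \<in> borel_measurable (F (ennreal t))" if "0 \<le> s" "s \<le> t" for s t
        using w_measurable_F[OF that] unfolding Y_def by measurable
      show "- (real i * \<xi>) \<le> Y 0 \<omega>" if "\<omega> \<in> space M" for \<omega>
        using Y0[OF that] x \<xi>_pos by (simp add: mult_nonneg_nonneg order_trans[of _ 0])
    qed
    show "inj_time p i \<omega> \<le> inj_time p (Suc i) \<omega>" if "\<omega> \<in> space M" for i \<omega>
      using hitting_times_mono[OF Y_cont[OF that] _ \<xi>_pos] Y0[OF that] x by (simp add: p_def)
  qed (auto simp: p_def \<xi>_pos)
  moreover have "injects_at_ruin M F w \<mu> \<sigma> \<delta> x p"
    unfolding injects_at_ruin_def
  proof (intro exI[of _ "\<lambda>t \<omega>. \<sigma> * w t \<omega>"] conjI AE_I2 allI)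
    show "noise_integral M F w \<sigma> p (\<lambda>t \<omega>. \<sigma> * w t \<omega>)"
      using ito_integral_const[of \<sigma>] by (simp add: p_def)
    fix \<omega> assume \<omega>: "\<omega> \<in> space M"
    have sb: "surplus_before \<mu> \<delta> x p (\<lambda>t \<omega>. \<sigma> * w t \<omega>) t \<omega> = ereal (Y t \<omega>) +
        enn2ereal (\<Sum>i. if Inf (ennreal ` {t. 0 \<le> t \<and> Y t \<omega> = - (real i * \<xi>)}) < ennreal t then ennreal \<xi> else 0)"
      if "0 \<le> t" for t
      unfolding surplus_before_def U[OF that] by (simp add: p_def cong: if_cong)
    have Y0': "0 \<le> Y 0 \<omega>" using Y0[OF \<omega>] x by simp
    note * = hitting_times_are_ruin_times(2,3)[OF Y_cont[OF \<omega>] Y0' \<xi>_pos]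
    have tp: "inj_time p n \<omega> = Inf (ennreal ` {t. 0 \<le> t \<and> Y t \<omega> = - (real n * \<xi>)})" for n
      by (simp add: p_def)
    show "inj_time p 0 \<omega> = Inf {ennreal t |t. 0 \<le> t \<and> surplus_before \<mu> \<delta> x p (\<lambda>t \<omega>. \<sigma> * w t \<omega>) t \<omega> = 0}"
      unfolding tp by (subst *(1)) (intro arg_cong[where f=Inf] Collect_cong ex_cong conj_cong refl, simp add: sb)
    show "inj_time p (Suc i) \<omega> = Inf {ennreal t |t. 0 \<le> t \<and> inj_time p i \<omega> < ennreal t \<and>
        surplus_before \<mu> \<delta> x p (\<lambda>t \<omega>. \<sigma> * w t \<omega>) t \<omega> = 0}" for i
      unfolding tp by (subst *(2)) (intro arg_cong[where f=Inf] Collect_cong ex_cong conj_cong refl, simp add: sb)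
  qed
  ultimately show ?thesis by (intro exI[of _ p]) (simp add: p_def)
qed

section \<open>Verification: value function and optimality\<close>

lemma admissible_cost_ge:
  assumes "\<pi> \<in> admissible M F w \<mu> \<sigma> \<delta> r K c" "0 \<le> x"
  shows "ennreal (\<eta> * exp (- \<gamma> * x)) \<le> cost M r K c \<pi> x"
proof -
  obtain I where I: "is_control M F (\<pi> x)" "noise_integral M F w \<sigma> (\<pi> x) I"
    "AE \<omega> in M. \<forall>t\<ge>0. 0 \<le> surplus \<mu> \<delta> x (\<pi> x) I t \<omega>"
    using assms unfolding admissible_def by blast
  interpret controlled_surplus M F w \<mu> \<sigma> \<delta> r K c \<gamma> \<eta> x "\<pi> x" I
    using I assms(2) by unfold_locales
  show ?thesis unfolding cost_def by (rule control_cost_ge_value[OF I(3)])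
qed

text \<open>The version of the integral for which the injection times are ruin times also witnesses
  the nonnegativity of the surplus.\<close>

lemma ruin_policy_admissible:
  assumes \<pi>: "full_retention_ruin_policy M F w \<mu> \<sigma> \<delta> \<xi> \<pi>"
  shows "\<pi> \<in> admissible M F w \<mu> \<sigma> \<delta> r K c"
    and "\<And>x. 0 \<le> x \<Longrightarrow> cost M r K c \<pi> x \<le> ennreal (\<eta> * exp (- \<gamma> * x))"
proof -
  have *: "(\<exists>I. noise_integral M F w \<sigma> (\<pi> x) I \<and> (AE \<omega> in M. \<forall>t\<ge>0. 0 \<le> surplus \<mu> \<delta> x (\<pi> x) I t \<omega>)) \<and>
      cost M r K c \<pi> x \<le> ennreal (\<eta> * exp (- \<gamma> * x)) \<and> is_control M F (\<pi> x)" if x: "0 \<le> x" for x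
  proof -
    have p: "is_control M F (\<pi> x)" "retention (\<pi> x) = (\<lambda>s \<omega>. 1)" "inj_size (\<pi> x) = (\<lambda>i \<omega>. \<xi>)"
      and inj: "injects_at_ruin M F w \<mu> \<sigma> \<delta> x (\<pi> x)"
      using \<pi> x unfolding full_retention_ruin_policy_def by auto
    obtain I where I: "noise_integral M F w \<sigma> (\<pi> x) I" and ruin: "AE \<omega> in M.
           inj_time (\<pi> x) 0 \<omega> = Inf {ennreal t | t. 0 \<le> t \<and> surplus_before \<mu> \<delta> x (\<pi> x) I t \<omega> = 0} \<and>
           (\<forall>i. inj_time (\<pi> x) (Suc i) \<omega> =
              Inf {ennreal t | t. 0 \<le> t \<and> inj_time (\<pi> x) i \<omega> < ennreal t \<and>
                                  surplus_before \<mu> \<delta> x (\<pi> x) I t \<omega> = 0})"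
      using inj unfolding injects_at_ruin_def by blast
    interpret ruin_control M F w \<mu> \<sigma> \<delta> r K c \<gamma> \<eta> x "\<pi> x" I
      using x p I ruin by unfold_locales
    show ?thesis using I surplus_nonneg control_cost_le p(1) unfolding cost_def by blast
  qed
  then show "\<And>x. 0 \<le> x \<Longrightarrow> cost M r K c \<pi> x \<le> ennreal (\<eta> * exp (- \<gamma> * x))" by blast
  have "cost M r K c \<pi> x < \<infinity>" if "0 \<le> x" for x
    using *[OF that] by (auto intro: le_less_trans[OF _ ennreal_less_top])
  with * show "\<pi> \<in> admissible M F w \<mu> \<sigma> \<delta> r K c"
    unfolding admissible_def by blast
qed

lemma ruin_policy_exists: "\<exists>\<pi>. full_retention_ruin_policy M F w \<mu> \<sigma> \<delta> \<xi> \<pi>"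
  using ruin_control_exists unfolding full_retention_ruin_policy_def by metis

lemma value_function_eq:
  assumes x: "0 \<le> x"
  shows "value_function M F w \<mu> \<sigma> \<delta> r K c x = ennreal (\<eta> * exp (- \<gamma> * x))"
proof (rule antisym)
  obtain \<pi> where \<pi>: "full_retention_ruin_policy M F w \<mu> \<sigma> \<delta> \<xi> \<pi>" using ruin_policy_exists by blast
  show "value_function M F w \<mu> \<sigma> \<delta> r K c x \<le> ennreal (\<eta> * exp (- \<gamma> * x))"
    unfolding value_function_def
    using ruin_policy_admissible[OF \<pi>] x by (intro INF_lower2[of \<pi>]) auto
  show "ennreal (\<eta> * exp (- \<gamma> * x)) \<le> value_function M F w \<mu> \<sigma> \<delta> r K c x"
    unfolding value_function_def using admissible_cost_ge x by (intro INF_greatest) auto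
qed

lemma ruin_policy_optimal:
  assumes \<pi>: "full_retention_ruin_policy M F w \<mu> \<sigma> \<delta> \<xi> \<pi>"
  shows "optimal M F w \<mu> \<sigma> \<delta> r K c \<pi>"
  unfolding optimal_def using ruin_policy_admissible[OF \<pi>] admissible_cost_ge value_function_eq
  by (auto intro: antisym)

end

text \<open>With \<open>b = c / \<gamma>\<close> the function has derivative
  \<open>b / z - 1\<close>, so it decreases strictly beyond \<open>b\<close>. It starts there at
  \<open>K > 0\<close> and eventually becomes negative.\<close>

lemma ex1_injection_level:
  fixes K c \<gamma> :: real
  assumes "0 < K" "0 < c" "0 < \<gamma>"
  shows "\<exists>!\<eta>. c / \<gamma> < \<eta> \<and> K + c / \<gamma> * ln (\<eta> * \<gamma> / c) + c / \<gamma> - \<eta> = 0"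
proof -
  define b where "b = c / \<gamma>"
  have b: "0 < b" using assms by (simp add: b_def)
  define f where "f \<eta> = K + b * ln (\<eta> / b) + b - \<eta>" for \<eta>
  have f_eq: "K + c / \<gamma> * ln (\<eta> * \<gamma> / c) + c / \<gamma> - \<eta> = f \<eta>" for \<eta>
    by (simp add: f_def b_def)
  have deriv: "(f has_real_derivative b / z - 1) (at z)" if "0 < z" for z
    unfolding f_def using that b by (auto intro!: derivative_eq_intros simp: field_simps)
  have anti: "f y < f x" if "b \<le> x" "x < y" for x y
  proof (rule DERIV_neg_imp_decreasing_open[OF that(2)])
    show "\<exists>d. (f has_real_derivative d) (at z) \<and> d < 0" if "x < z" "z < y" for z
      using deriv[of z] that \<open>b \<le> x\<close> b by (intro exI[of _ "b / z - 1"]) (auto simp: field_simps)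
    show "continuous_on {x..y} f"
      using deriv that b by (intro DERIV_continuous_on[where D="\<lambda>z. b / z - 1"]) (auto intro: has_field_derivative_at_within)
  qed
  have f0: "0 < f b" using assms b by (simp add: f_def)
  have "\<exists>y\<ge>b. f y \<le> 0"
  proof -
    \<comment> \<open>Splitting off \<open>ln 2\<close> gives
      \<open>ln (y / b) \<le> y / (2 * b)\<close>, hence \<open>f y \<le> K + b - y / 2\<close>, and
      this choice of \<open>y\<close> makes the bound equal to \<open>- b\<close>.\<close>
    define y where "y = 4 * b + 2 * K"
    have yb: "b \<le> y" using b assms by (simp add: y_def)
    have "ln (y / (2 * b)) \<le> y / (2 * b) - 1" using b yb by (intro ln_le_minus_one) auto
    moreover have "ln (y / b) = ln (y / (2 * b)) + ln 2"
      using b yb by (simp add: ln_div ln_mult)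
    moreover have "ln 2 \<le> (1 :: real)" using ln_le_minus_one[of 2] by simp
    ultimately have "b * ln (y / b) \<le> b * (y / (2 * b))" using b by (intro mult_left_mono) auto
    also have "\<dots> = y / 2" using b by simp
    finally have "f y \<le> 0" using b assms by (simp add: f_def y_def)
    with yb show ?thesis by blast
  qed
  then obtain y where y: "b \<le> y" "f y \<le> 0" by blast
  have "continuous_on {b..y} f"
    using deriv b by (intro DERIV_continuous_on[where D="\<lambda>z. b / z - 1"]) (auto intro: has_field_derivative_at_within)
  then obtain z where z: "b \<le> z" "f z = 0" using IVT2'[of f y 0 b] f0 y by auto
  then have "b < z" using f0 by (cases "z = b") auto
  show ?thesis
    unfolding f_eq unfolding b_def[symmetric]
  proof (rule ex1I[of _ z])
    fix z' assume "b < z' \<and> f z' = 0"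
    then show "z' = z" using anti[of z z'] anti[of z' z] z by (cases z z' rule: linorder_cases) auto
  qed (use z \<open>b < z\<close> in auto)
qed

theorem theorem4p2:
  fixes M :: "'a measure" and F :: "ennreal \<Rightarrow> 'a measure" and w :: "real \<Rightarrow> 'a \<Rightarrow> real"
    and \<mu> \<sigma> \<delta> r K c \<gamma> :: real
  assumes "filtered_prob_space M F"
    and "standard_brownian_motion M F w"
    and "\<mu> > 0" and "\<sigma> > 0" and "\<delta> > 0" and "r > 0" and "K > 0" and "c \<ge> 1"
    and "\<delta> \<ge> (\<mu>\<^sup>2 + 2 * r * \<sigma>\<^sup>2) / (2 * \<mu>)"
    and "\<gamma> = (sqrt ((\<mu> - \<delta>)\<^sup>2 + 2 * r * \<sigma>\<^sup>2) + (\<mu> - \<delta>)) / \<sigma>\<^sup>2"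
  shows "(\<exists>!\<eta>. c / \<gamma> < \<eta> \<and> K + c / \<gamma> * ln (\<eta> * \<gamma> / c) + c / \<gamma> - \<eta> = 0) \<and>
    (\<forall>\<eta>. c / \<gamma> < \<eta> \<and> K + c / \<gamma> * ln (\<eta> * \<gamma> / c) + c / \<gamma> - \<eta> = 0 \<longrightarrow>
       (\<forall>x\<ge>0. value_function M F w \<mu> \<sigma> \<delta> r K c x = ennreal (\<eta> * exp (- \<gamma> * x))) \<and>
       (\<exists>\<pi>. full_retention_ruin_policy M F w \<mu> \<sigma> \<delta> (1 / \<gamma> * ln (\<eta> * \<gamma> / c)) \<pi>) \<and>
       (\<forall>\<pi>. full_retention_ruin_policy M F w \<mu> \<sigma> \<delta> (1 / \<gamma> * ln (\<eta> * \<gamma> / c)) \<pi> \<longrightarrow>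
            optimal M F w \<mu> \<sigma> \<delta> r K c \<pi>))"
proof -
  \<comment> \<open>The square root of the discriminant: \<open>\<gamma>\<close> is the positive
    root of \<open>\<sigma>\<^sup>2 / 2 * z\<^sup>2 - (\<mu> - \<delta>) * z - r\<close>, also when
    \<open>\<mu> < \<delta>\<close>.\<close>
  define q where "q = sqrt ((\<mu> - \<delta>)\<^sup>2 + 2 * r * \<sigma>\<^sup>2)"
  have \<sigma>2: "0 < \<sigma>\<^sup>2" "0 < r * \<sigma>\<^sup>2" using assms by auto
  have q2: "q\<^sup>2 = (\<mu> - \<delta>)\<^sup>2 + 2 * r * \<sigma>\<^sup>2" using \<sigma>2 by (simp add: q_def add_nonneg_nonneg)
  have \<gamma>: "\<sigma>\<^sup>2 * \<gamma> = q + (\<mu> - \<delta>)" using \<sigma>2 assms(10) by (simp add: q_def)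
  have "\<bar>\<mu> - \<delta>\<bar> < q" unfolding q_def using \<sigma>2 by (intro real_less_rsqrt) simp
  then have "0 < \<sigma>\<^sup>2 * \<gamma>" unfolding \<gamma> by linarith
  then have \<gamma>_pos: "0 < \<gamma>" using \<sigma>2 by (simp add: zero_less_mult_iff)
  have sq: "q\<^sup>2 + 2 * q * (\<mu> - \<delta>) + (\<mu> - \<delta>)\<^sup>2 = 2 * ((\<mu> - \<delta>) * (\<sigma>\<^sup>2 * \<gamma>) + \<sigma>\<^sup>2 * r)"
    unfolding q2 \<gamma> by (simp add: algebra_simps power2_eq_square)
  have "\<sigma>\<^sup>2 * (\<sigma>\<^sup>2 / 2 * \<gamma>\<^sup>2) = (\<sigma>\<^sup>2 * \<gamma>)\<^sup>2 / 2" by (simp add: power2_eq_square)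
  also have "\<dots> = (q\<^sup>2 + 2 * q * (\<mu> - \<delta>) + (\<mu> - \<delta>)\<^sup>2) / 2"
    unfolding \<gamma> by (simp add: power2_eq_square algebra_simps)
  also have "\<dots> = (\<mu> - \<delta>) * (\<sigma>\<^sup>2 * \<gamma>) + \<sigma>\<^sup>2 * r"
    unfolding sq by simp
  also have "\<dots> = \<sigma>\<^sup>2 * ((\<mu> - \<delta>) * \<gamma> + r)" by (simp add: algebra_simps)
  finally have root: "\<sigma>\<^sup>2 / 2 * \<gamma>\<^sup>2 = (\<mu> - \<delta>) * \<gamma> + r"
    using \<sigma>2(1) by (metis mult_left_cancel less_irrefl)
  \<comment> \<open>Since \<open>\<delta> > 0\<close>, the hypothesis on \<open>\<delta>\<close>
    amounts to \<open>q\<^sup>2 \<le> \<delta>\<^sup>2\<close>, that is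
    \<open>q \<le> \<delta>\<close>.\<close>
  have "\<mu>\<^sup>2 + 2 * r * \<sigma>\<^sup>2 \<le> 2 * \<mu> * \<delta>" using assms(3,9) by (simp add: field_simps)
  then have "q \<le> \<delta>"
    unfolding q_def using assms(5) by (intro real_le_lsqrt) (auto simp: power2_diff algebra_simps)
  then have \<gamma>_le: "\<sigma>\<^sup>2 * \<gamma> \<le> \<mu>" unfolding \<gamma> by simp
  have c: "0 < c" using assms(8) by simp
  have main: "(\<forall>x\<ge>0. value_function M F w \<mu> \<sigma> \<delta> r K c x = ennreal (\<eta> * exp (- \<gamma> * x))) \<and>
       (\<exists>\<pi>. full_retention_ruin_policy M F w \<mu> \<sigma> \<delta> (1 / \<gamma> * ln (\<eta> * \<gamma> / c)) \<pi>) \<and>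
       (\<forall>\<pi>. full_retention_ruin_policy M F w \<mu> \<sigma> \<delta> (1 / \<gamma> * ln (\<eta> * \<gamma> / c)) \<pi> \<longrightarrow>
            optimal M F w \<mu> \<sigma> \<delta> r K c \<pi>)"
    if \<eta>: "c / \<gamma> < \<eta>" "K + c / \<gamma> * ln (\<eta> * \<gamma> / c) + c / \<gamma> - \<eta> = 0" for \<eta>
  proof -
    interpret injection_problem M F w \<mu> \<sigma> \<delta> r K c \<gamma> \<eta>
      using assms(1-8) c \<gamma>_pos root \<gamma>_le \<eta> by unfold_locales
    show ?thesis
      using value_function_eq ruin_policy_exists ruin_policy_optimal unfolding \<xi>_def by blast
  qed
  then show ?thesis using ex1_injection_level[OF assms(7) c \<gamma>_pos] by blast
qed

end
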